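(* Let $f$ be a function and suppose, with $D_n^L=D_{1,n}^L+D_{2,n}^L$: 1. $\sup_{c\in I_n}\frac{|R_{1,n}^L(c,f)|+|R_{2,n}^L(c)|}{D_n^L(c,f)}\to0$ in $P_f$-probability; 2. $D_{2,n}^L$ is a good variance function (see context) with $D_{2,n}^L(c)\ge\log(nc)$ for $c\in I_n$; 3. there is a minimizer $c_n(f)$ of $c\mapsto D_n^L(c,f)+2\lambda/c$ over $c\in(0,\infty)$ that satisfies $c_n(f)\in I_n$ and $2c_n(f)\in I_n$. Then for sufficiently large $M$ $$\Pi_n\Bigl(c:D_n^L(c,f)+\frac1c\le M\inf_{c>0}\Bigl[D_n^L(c,f)+\frac1c\Bigr]\,\Big|\,\vec Y_n\Bigr)\to1\quad\text{in }P_f\text{-probability}.$$ Furthermore, if $f$ satisfies the good bias condition relative to $D_{1,n}^L$, then there is a constant $C$ such that $$\Pi_n\Bigl(c:D_{1,n}^L(c,f)+\frac1c\le C\,D_{2,n}^L(c)\,\Big|\,\vec Y_n\Bigr)\to1\quad\text{in }P_f\text{-probability};$$ moreover, there then exist constants $0<k<K<\infty$ such that $$\Pi_n\bigl(c:c\in[kc_n(f),Kc_n(f)]\,\big|\,\vec Y_n\bigr)\to1\quad\text{in }P_f\text{-probability}.$$ In particular, these assertions (the last two for $f$ satisfying the good bias condition) are true if the polynomial, the product or the Sobolev-type eigenvalue condition (see context) holds, for every $f$ satisfying assumption 3.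
   Context: Setting. $\mathcal X$ is a set and for each $n$, $x_{1,n},\dots,x_{n,n}\in\mathcal X$ are known design points. For $f:\mathcal X\to\mathbb R$ write $\vec f_n=(f(x_{1,n}),\dots,f(x_{n,n}))^T$. Under $P_f$ one observes $\vec Y_n=\vec f_n+\vec\varepsilon_n$ with $\vec\varepsilon_n\sim\mathcal N_n(0,I)$. $W^1$ is a mean-zero Gaussian process on $\mathcal X$; $U_n$ is the covariance matrix of $(W^1_{x_{1,n}},\dots,W^1_{x_{n,n}})$, with orthonormal eigenbasis $e_{1,n},\dots,e_{n,n}$ and eigenvalues $\lambda_{1,n},\dots,\lambda_{n,n}$; $f_{j,n}=\vec f_n^Te_{j,n}$, $Z_{j,n}=\vec\varepsilon_n^Te_{j,n}$ (i.i.d. standard normal); $\Sigma_{n,c}=I+cU_n$. $I_n=[\log n/n,n^{m-1}]$ for a fixed constant $m\ge1$ (the exponent in the eigenvalue condition when one is assumed). Hierarchical Bayes: $c$ has prior density $\pi(c)\propto c^{-1-\kappa}e^{-\lambda/c}$ for $c\in I_n$ (zero elsewhere), with fixed $\kappa,\lambda>0$; given $c$, $f$ is distributed as $\sqrt c\,W^1$; given $f,c$, $\vec Y_n\sim\mathcal N_n(\vec f_n,I)$. $\Pi_n(\cdot\mid\vec Y_n)$ is the resulting posterior distribution of $c$, with density proportional to $(\det\Sigma_{n,c})^{-1/2}e^{-\frac12\vec Y_n^T\Sigma_{n,c}^{-1}\vec Y_n}\pi(c)$. Functions: $D_{1,n}^L(c,f)=\sum_{j=1}^n\frac{f_{j,n}^2}{1+c\lambda_{j,n}}$,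 $D_{2,n}^L(c)=\sum_{j=1}^n\bigl[\log(1+c\lambda_{j,n})-\frac{c\lambda_{j,n}}{1+c\lambda_{j,n}}\bigr]$, $R_{1,n}^L(c,f)=2\sum_{j=1}^n\frac{Z_{j,n}f_{j,n}}{1+c\lambda_{j,n}}$, $R_{2,n}^L(c)=-\sum_{j=1}^n\frac{(Z_{j,n}^2-1)c\lambda_{j,n}}{1+c\lambda_{j,n}}$. Good bias condition relative to $D_{1,n}^L$: there is $a>0$ (independent of $n$) with $D_{1,n}^L(Kc,f)\le K^{-a}D_{1,n}^L(c,f)$ for all $c\in I_n$ and all $K>1$. Good variance function: there are $b,B,B'>0$ (independent of $n$) with $Bk^bD_{2,n}^L(c)\le D_{2,n}^L(kc)\le B'k^bD_{2,n}^L(c)$ for all $c\in I_n$ and $k\in(0,1)$ with $kc\in I_n$. Eigenvalue conditions. Polynomial: $\underline\delta n/j^m\le\lambda_{j,n}\le\overline\delta n/j^m$ for all $n$, $1\le j\le n$, with constants $0<\underline\delta\le\overline\delta<\infty$, $m\ge1$. Product: there are $n^2$ design points, the eigenvalues are indexed by $(i,j)\in\{1,\dots,n\}^2$ and $\lambda_{i,j,n}\asymp n^2/(i^mj^m)$, uniformly in $i,j$ and $n$. Sobolev-type: same with $\lambda_{i,j,n}\asymp n^2/(i^2+j^2)^m$. In the last two cases $m\ge1$ and everywhere $n$ is replaced by $n^2$ (in particular $I_n$ by $I_{n^2}$) and single sums by double sums. *)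

theory Defs
  imports
    "HOL-Probability.Probability"
    "Jordan_Normal_Form.Determinant"
    "Jordan_Normal_Form.Gauss_Jordan_Elimination"
begin

text \<open>
  Points, coordinates and eigenvalues are numbered from 1, whereas the entries of a vector
  are numbered from 0.  At stage \<open>n\<close> there are \<open>N n\<close> observations, where \<open>N n\<close> is \<open>n\<close> or \<open>n\<^sup>2\<close>.
  The conditions below that involve the interval \<open>c_interval\<close> are required for all sufficiently
  large \<open>n\<close>: for one observation this interval is \<open>[0, 1]\<close>, and its point 0 would force \<open>f\<close> to
  vanish at the design point (good bias) and \<open>b = 2\<close> (good variance).
\<close>

definition vec1 :: "nat \<Rightarrow> (nat \<Rightarrow> real) \<Rightarrow> real Matrix.vec" where
  "vec1 n g = Matrix.vec n (\<lambda>i. g (Suc i))"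

text \<open>The laws \<open>N(0, s\<^sup>2)\<close> with \<open>s = 0\<close> allowed are the laws of \<open>s\<close> times a standard normal variable.\<close>

definition centered_gaussian_process :: "'s measure \<Rightarrow> ('x \<Rightarrow> 's \<Rightarrow> real) \<Rightarrow> bool" where
  "centered_gaussian_process S W \<longleftrightarrow>
     prob_space S \<and> (\<forall>t. W t \<in> borel_measurable S) \<and>
     (\<forall>T a. finite T \<longrightarrow> (\<exists>s\<ge>0.
        distr S borel (\<lambda>\<omega>. \<Sum>t\<in>T. a t * W t \<omega>) =
        distr (density lborel (\<lambda>z. ennreal (std_normal_density z))) borel (\<lambda>z. s * z)))"

definition covariance_mat ::
  "'s measure \<Rightarrow> ('x \<Rightarrow> 's \<Rightarrow> real) \<Rightarrow> nat \<Rightarrow> (nat \<Rightarrow> 'x) \<Rightarrow> real Matrix.mat" where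
  "covariance_mat S W n x = Matrix.mat n n (\<lambda>(i, j).
     let V = W (x (Suc i)); V' = W (x (Suc j))
     in (\<integral>\<omega>. (V \<omega> - (\<integral>\<eta>. V \<eta> \<partial>S)) * (V' \<omega> - (\<integral>\<eta>. V' \<eta> \<partial>S)) \<partial>S))"

definition orthonormal_eigenbasis ::
  "nat \<Rightarrow> real Matrix.mat \<Rightarrow> (nat \<Rightarrow> real Matrix.vec) \<Rightarrow> (nat \<Rightarrow> real) \<Rightarrow> bool" where
  "orthonormal_eigenbasis n U e lam \<longleftrightarrow>
     (\<forall>j\<in>{1..n}. e j \<in> carrier_vec n \<and> U *\<^sub>v e j = lam j \<cdot>\<^sub>v e j) \<and>
     (\<forall>i\<in>{1..n}. \<forall>j\<in>{1..n}. scalar_prod (e i) (e j) = (if i = j then 1 else 0))"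

definition standard_gaussian_noise :: "'w measure \<Rightarrow> nat \<Rightarrow> (nat \<Rightarrow> 'w \<Rightarrow> real) \<Rightarrow> bool" where
  "standard_gaussian_noise P n eps \<longleftrightarrow>
     prob_space P \<and> prob_space.indep_vars P (\<lambda>_. borel) eps {1..n} \<and>
     (\<forall>i\<in>{1..n}. distributed P lborel (eps i) (\<lambda>z. ennreal (std_normal_density z)))"

text \<open>
  Convergence in probability to a constant.  The variables may live on different spaces;
  measurability is part of the definition because \<open>measure\<close> is 0 on nonmeasurable sets.
\<close>

definition tendsto_in_prob :: "(nat \<Rightarrow> 'w measure) \<Rightarrow> (nat \<Rightarrow> 'w \<Rightarrow> real) \<Rightarrow> real \<Rightarrow> bool" where
  "tendsto_in_prob P X l \<longleftrightarrow>
     (\<forall>\<^sub>F n in sequentially. X n \<in> borel_measurable (P n)) \<and>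
     (\<forall>r>0. (\<lambda>n. measure (P n) {\<omega> \<in> space (P n). r < \<bar>X n \<omega> - l\<bar>}) \<longlonglongrightarrow> 0)"

definition c_interval :: "real \<Rightarrow> nat \<Rightarrow> real set" where
  "c_interval m n = {ln (real n) / real n .. real n powr (m - 1)}"

definition D1 ::
  "nat \<Rightarrow> (nat \<Rightarrow> real Matrix.vec) \<Rightarrow> (nat \<Rightarrow> real) \<Rightarrow> real Matrix.vec \<Rightarrow> real \<Rightarrow> real" where
  "D1 n e lam fv c = (\<Sum>j=1..n. (scalar_prod fv (e j))\<^sup>2 / (1 + c * lam j))"

definition D2 :: "nat \<Rightarrow> (nat \<Rightarrow> real) \<Rightarrow> real \<Rightarrow> real" where
  "D2 n lam c = (\<Sum>j=1..n. ln (1 + c * lam j) - c * lam j / (1 + c * lam j))"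

definition D ::
  "nat \<Rightarrow> (nat \<Rightarrow> real Matrix.vec) \<Rightarrow> (nat \<Rightarrow> real) \<Rightarrow> real Matrix.vec \<Rightarrow> real \<Rightarrow> real" where
  "D n e lam fv c = D1 n e lam fv c + D2 n lam c"

definition R1 ::
  "nat \<Rightarrow> (nat \<Rightarrow> real Matrix.vec) \<Rightarrow> (nat \<Rightarrow> real) \<Rightarrow> real Matrix.vec \<Rightarrow> real Matrix.vec \<Rightarrow> real \<Rightarrow> real" where
  "R1 n e lam fv epsv c =
     2 * (\<Sum>j=1..n. scalar_prod epsv (e j) * scalar_prod fv (e j) / (1 + c * lam j))"

definition R2 ::
  "nat \<Rightarrow> (nat \<Rightarrow> real Matrix.vec) \<Rightarrow> (nat \<Rightarrow> real) \<Rightarrow> real Matrix.vec \<Rightarrow> real \<Rightarrow> real" where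
  "R2 n e lam epsv c =
     - (\<Sum>j=1..n. ((scalar_prod epsv (e j))\<^sup>2 - 1) * c * lam j / (1 + c * lam j))"

definition good_bias ::
  "real \<Rightarrow> (nat \<Rightarrow> nat) \<Rightarrow> (nat \<Rightarrow> nat \<Rightarrow> real Matrix.vec) \<Rightarrow> (nat \<Rightarrow> nat \<Rightarrow> real)
     \<Rightarrow> (nat \<Rightarrow> real Matrix.vec) \<Rightarrow> bool" where
  "good_bias m N e lam fv \<longleftrightarrow>
     (\<exists>a>0. \<forall>\<^sub>F n in sequentially. \<forall>c\<in>c_interval m (N n). \<forall>K>1.
        D1 (N n) (e n) (lam n) (fv n) (K * c) \<le> K powr (- a) * D1 (N n) (e n) (lam n) (fv n) c)"

definition good_variance :: "real \<Rightarrow> (nat \<Rightarrow> nat) \<Rightarrow> (nat \<Rightarrow> nat \<Rightarrow> real) \<Rightarrow> bool" where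
  "good_variance m N lam \<longleftrightarrow>
     (\<exists>b>0. \<exists>B>0. \<exists>B'>0. \<forall>\<^sub>F n in sequentially.
        \<forall>c\<in>c_interval m (N n). \<forall>k\<in>{0<..<1}. k * c \<in> c_interval m (N n) \<longrightarrow>
          B * k powr b * D2 (N n) (lam n) c \<le> D2 (N n) (lam n) (k * c) \<and>
          D2 (N n) (lam n) (k * c) \<le> B' * k powr b * D2 (N n) (lam n) c)"

definition polynomial_eigenvalues :: "real \<Rightarrow> (nat \<Rightarrow> nat \<Rightarrow> real) \<Rightarrow> bool" where
  "polynomial_eigenvalues m lam \<longleftrightarrow>
     (\<exists>d d'. 0 < d \<and> d \<le> d' \<and> (\<forall>n. \<forall>j\<in>{1..n}.
        d * real n / real j powr m \<le> lam n j \<and> lam n j \<le> d' * real n / real j powr m))"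

text \<open>Double indices are matched with \<open>1, \<dots>, n\<^sup>2\<close> by an arbitrary bijection \<open>h\<close>.\<close>

definition product_eigenvalues :: "real \<Rightarrow> (nat \<Rightarrow> nat \<Rightarrow> real) \<Rightarrow> bool" where
  "product_eigenvalues m lam \<longleftrightarrow>
     (\<exists>d d'. 0 < d \<and> d \<le> d' \<and> (\<forall>n. \<exists>h. bij_betw h ({1..n} \<times> {1..n}) {1..n\<^sup>2} \<and>
        (\<forall>i\<in>{1..n}. \<forall>j\<in>{1..n}.
           d * (real n)\<^sup>2 / (real i powr m * real j powr m) \<le> lam n (h (i, j)) \<and>
           lam n (h (i, j)) \<le> d' * (real n)\<^sup>2 / (real i powr m * real j powr m))))"

definition sobolev_eigenvalues :: "real \<Rightarrow> (nat \<Rightarrow> nat \<Rightarrow> real) \<Rightarrow> bool" where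
  "sobolev_eigenvalues m lam \<longleftrightarrow>
     (\<exists>d d'. 0 < d \<and> d \<le> d' \<and> (\<forall>n. \<exists>h. bij_betw h ({1..n} \<times> {1..n}) {1..n\<^sup>2} \<and>
        (\<forall>i\<in>{1..n}. \<forall>j\<in>{1..n}.
           d * (real n)\<^sup>2 / ((real i)\<^sup>2 + (real j)\<^sup>2) powr m \<le> lam n (h (i, j)) \<and>
           lam n (h (i, j)) \<le> d' * (real n)\<^sup>2 / ((real i)\<^sup>2 + (real j)\<^sup>2) powr m)))"

definition prior_weight :: "real \<Rightarrow> real \<Rightarrow> real \<Rightarrow> nat \<Rightarrow> real \<Rightarrow> real" where
  "prior_weight \<kappa> l m n c =
     indicator (c_interval m n) c * (c powr (- 1 - \<kappa>) * exp (- l / c))"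

text \<open>
  Given \<open>c\<close>, the observation vector has marginal law \<open>N(0, I + c U)\<close>; its density at \<open>y\<close> is,
  up to a constant, \<open>marginal_likelihood n U y c\<close>, and \<open>posterior\<close> is the normalised product
  of this likelihood and the prior weight.
\<close>

definition marginal_likelihood :: "nat \<Rightarrow> real Matrix.mat \<Rightarrow> real Matrix.vec \<Rightarrow> real \<Rightarrow> real" where
  "marginal_likelihood n U y c =
     (let \<Sigma> = 1\<^sub>m n + c \<cdot>\<^sub>m U
      in Determinant.det \<Sigma> powr (- 1 / 2) *
         exp (- 1 / 2 * scalar_prod y (the (mat_inverse \<Sigma>) *\<^sub>v y)))"

definition posterior ::
  "real \<Rightarrow> real \<Rightarrow> real \<Rightarrow> nat \<Rightarrow> real Matrix.mat \<Rightarrow> real Matrix.vec \<Rightarrow> real measure" where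
  "posterior \<kappa> l m n U y =
     (let g = (\<lambda>c. ennreal (marginal_likelihood n U y c * prior_weight \<kappa> l m n c))
      in density lborel (\<lambda>c. g c / (\<integral>\<^sup>+ c'. g c' \<partial>lborel)))"

end

theory Submission
  imports Defs "HOL-Real_Asymp.Real_Asymp"
begin

text \<open>
  Up to a factor free of \<open>c\<close>, the likelihood of \<open>c\<close> is \<open>exp (- (D + R1 + R2) / 2)\<close>.  The
  remainders \<open>R1 + R2\<close> are at most \<open>D / 2\<close> on the whole interval with probability tending to 1.
  To see this, take a geometric grid of values of \<open>c\<close>.  Between two grid points, expand
  \<open>1 / (1 + c \<lambda>)\<close> as a geometric series and apply Chebyshev's inequality to each coefficient.  The
  failure probabilities at a grid point \<open>c\<close> are of order \<open>1 / D2 c\<close>, and by the upper bound in the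
  good variance condition their sum is of order \<open>1 / D2\<close> at the left end point of the interval,
  where \<open>D2\<close> is at least a multiple of \<open>ln (ln N)\<close>.

  On this event the normalising constant is at least \<open>exp (- 3 h)\<close> times a power of \<open>N\<close>, where \<open>h\<close>
  is the minimum of \<open>D c + 2 l / c\<close>, as one sees from the contribution of \<open>[cmin, 2 cmin]\<close>, whereas
  \<open>{c. D c + 2 l / c > M h}\<close> contributes at most \<open>exp (- M h / 4)\<close> times a power of \<open>N\<close>.  Since \<open>h\<close>
  exceeds a multiple of \<open>ln N\<close>, the posterior concentrates on \<open>{c. D c + 2 l / c \<le> M h}\<close> for large
  \<open>M\<close>.  Under the good bias condition, comparing \<open>cmin\<close> with \<open>2 cmin\<close> and with \<open>cmin / K0\<close> shows that
  \<open>D1 + 2 l / c\<close> and \<open>D2\<close> balance at \<open>cmin\<close>, and this confines the set to \<open>[k cmin, K cmin]\<close>.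

  The eigenvalue conditions all have the form \<open>\<lambda> \<asymp> N / w powr m\<close>.  With \<open>t powr m = c N\<close> the upper
  bound on \<open>D2\<close> follows from \<open>(\<Sum>w \<le> t. sqrt (t / w)) \<le> C * card {w \<le> t}\<close>.
\<close>
section \<open>The variance function of a single eigenvalue\<close>

text \<open>The contribution of one eigenvalue to \<open>D2\<close>, as a function of the product
  \<open>c * lam j\<close>. It behaves like half the square near 0 and like the logarithm at
  infinity.\<close>

definition psi :: "real \<Rightarrow> real" where
  "psi x = ln (1 + x) - x / (1 + x)"

lemma psi_0 [simp]: "psi 0 = 0"
  by (simp add: psi_def)

lemma DERIV_psi:
  assumes "0 \<le> x"
  shows "(psi has_real_derivative x / (1 + x)\<^sup>2) (at x)"
proof -
  have "((\<lambda>x. ln (1 + x) - x / (1 + x)) has_real_derivative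
      1 / (1 + x) - (1 * (1 + x) - x * 1) / ((1 + x) * (1 + x))) (at x)"
    using assms by (auto intro!: derivative_eq_intros)
  moreover have "1 / (1 + x) - (1 * (1 + x) - x * 1) / ((1 + x) * (1 + x)) = x / (1 + x)\<^sup>2"
    using assms by (simp add: divide_simps power2_eq_square) (simp add: algebra_simps)?
  ultimately show ?thesis
    by (simp add: psi_def[abs_def])
qed

lemma psi_mono:
  assumes "0 \<le> x" "x \<le> y"
  shows "psi x \<le> psi y"
proof (rule DERIV_nonneg_imp_nondecreasing[OF assms(2)])
  fix u assume "x \<le> u" "u \<le> y"
  then show "\<exists>d. (psi has_real_derivative d) (at u) \<and> 0 \<le> d"
    using DERIV_psi[of u] assms by (intro exI[of _ "u / (1 + u)\<^sup>2"]) auto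
qed

lemma psi_nonneg: "0 \<le> x \<Longrightarrow> 0 \<le> psi x"
  using psi_mono[of 0 x] by simp

text \<open>The difference of the two sides vanishes at 0, and its derivative is
  \<open>K\<^sup>2\<close> times \<open>u / (1 + u)\<^sup>2 - u / (1 + K * u)\<^sup>2\<close>, which
  is nonnegative. The factor \<open>K\<^sup>2\<close> reflects the quadratic behaviour at 0.\<close>

lemma psi_mult_le:
  assumes "0 \<le> x" "1 \<le> K"
  shows "psi (K * x) \<le> K\<^sup>2 * psi x"
proof -
  let ?g = "\<lambda>u. K\<^sup>2 * psi u - psi (K * u)"
  have "?g 0 \<le> ?g x"
  proof (rule DERIV_nonneg_imp_nondecreasing[OF assms(1)])
    fix u :: real assume u: "0 \<le> u" "u \<le> x"
    have "((\<lambda>u. psi (K * u)) has_real_derivative (K * u / (1 + K * u)\<^sup>2) * K) (at u)"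
      using u assms by (intro DERIV_chain2[OF DERIV_psi]) (auto intro!: derivative_eq_intros)
    then have d: "(?g has_real_derivative K\<^sup>2 * (u / (1 + u)\<^sup>2) - (K * u / (1 + K * u)\<^sup>2) * K) (at u)"
      using u by (intro DERIV_diff DERIV_cmult DERIV_psi)
    have "u * 1 \<le> u * K" using u assms by (intro mult_left_mono) auto
    then have "(1 + u)\<^sup>2 \<le> (1 + K * u)\<^sup>2"
      using u by (intro power_mono) (auto simp: mult.commute)
    then have "u / (1 + K * u)\<^sup>2 \<le> u / (1 + u)\<^sup>2"
      using u assms by (intro divide_left_mono) (auto intro!: mult_pos_pos zero_less_power add_pos_nonneg)
    then have "K\<^sup>2 * (u / (1 + K * u)\<^sup>2) \<le> K\<^sup>2 * (u / (1 + u)\<^sup>2)"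
      by (intro mult_left_mono) auto
    then have "0 \<le> K\<^sup>2 * (u / (1 + u)\<^sup>2) - (K * u / (1 + K * u)\<^sup>2) * K"
      by (simp add: power2_eq_square mult_ac)
    with d show "\<exists>d. (?g has_real_derivative d) (at u) \<and> 0 \<le> d" by blast
  qed
  then show ?thesis by simp
qed

text \<open>Both sides vanish at 0, and the derivative of the left one is that of \<open>psi\<close>
  divided by \<open>1 + u\<close>. The squared ratios on the left make up the variance of
  \<open>R2\<close>, which is thereby controlled by \<open>D2\<close>.\<close>

lemma psi_ge_square:
  assumes "0 \<le> x"
  shows "(x / (1 + x))\<^sup>2 / 2 \<le> psi x"
proof -
  let ?g = "\<lambda>u. psi u - (u / (1 + u))\<^sup>2 / 2"
  have "?g 0 \<le> ?g x"
  proof (rule DERIV_nonneg_imp_nondecreasing[OF assms(1)])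
    fix u :: real assume u: "0 \<le> u" "u \<le> x"
    have "((\<lambda>u. u / (1 + u)) has_real_derivative 1 / (1 + u)\<^sup>2) (at u)"
      using u by (auto intro!: derivative_eq_intros simp: power2_eq_square)
    from DERIV_cdivide[OF DERIV_power[OF this, of 2], of 2]
    have "((\<lambda>u. (u / (1 + u))\<^sup>2 / 2) has_real_derivative (u / (1 + u)) * (1 / (1 + u)\<^sup>2)) (at u)"
      by (simp add: mult.commute)
    then have d: "(?g has_real_derivative u / (1 + u)\<^sup>2 - (u / (1 + u)) * (1 / (1 + u)\<^sup>2)) (at u)"
      using u by (intro DERIV_diff DERIV_psi)
    have "u / (1 + u) \<le> u" using u by (auto simp: divide_simps mult_left_mono algebra_simps)
    then have "u / (1 + u) * (1 / (1 + u)\<^sup>2) \<le> u * (1 / (1 + u)\<^sup>2)"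
      using u by (intro mult_right_mono) auto
    with d show "\<exists>d. (?g has_real_derivative d) (at u) \<and> 0 \<le> d" by (intro exI conjI) auto
  qed
  then show ?thesis by simp
qed

lemma psi_le_square:
  assumes "0 \<le> x"
  shows "psi x \<le> x\<^sup>2"
proof -
  have "ln (1 + x) \<le> x" using ln_add_one_self_le_self[OF assms] .
  then have "psi x \<le> x - x / (1 + x)" by (simp add: psi_def)
  also have "\<dots> = x\<^sup>2 / (1 + x)" using assms by (simp add: divide_simps power2_eq_square algebra_simps)
  also have "\<dots> \<le> x\<^sup>2 / 1" using assms by (intro divide_left_mono) auto
  finally show ?thesis by simp
qed

text \<open>Up to 1 the bound by the square suffices. Beyond 1 it comes from
  \<open>ln y \<le> y - 1\<close>, applied to \<open>y = 2\<close> and to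
  \<open>y = x powr s\<close>.\<close>

lemma psi_le_powr:
  assumes "0 < x" "0 < s" "s \<le> 1"
  shows "psi x \<le> x powr s / s"
proof -
  consider "x \<le> 1" | "1 \<le> x" by linarith
  then show ?thesis
  proof cases
    case 1
    have "psi x \<le> x powr 2" using psi_le_square[of x] assms by (simp add: powr_numeral)
    also have "\<dots> \<le> x powr s" using 1 assms by (intro powr_mono') auto
    also have "\<dots> \<le> x powr s / s" using assms by (simp add: le_divide_eq mult_left_le)
    finally show ?thesis .
  next
    case 2
    have "ln (1 + x) \<le> ln (2 * x)" using 2 by simp
    also have "\<dots> = ln 2 + ln (x powr s) / s" using assms by (simp add: ln_mult ln_powr)
    also have "\<dots> \<le> 1 + (x powr s - 1) / s"
      using assms ln_le_minus_one[of 2] ln_le_minus_one[of "x powr s"]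
      by (intro add_mono divide_right_mono) auto
    also have "\<dots> \<le> x powr s / s" using assms by (simp add: diff_divide_distrib)
    finally have "ln (1 + x) \<le> x powr s / s" .
    moreover have "0 \<le> x / (1 + x)" using 2 by simp
    ultimately show ?thesis by (simp add: psi_def)
  qed
qed

lemma D2_eq_sum_psi: "D2 n lam c = (\<Sum>j=1..n. psi (c * lam j))"
  by (simp add: D2_def psi_def)

section \<open>Diagonalization of the covariance matrix\<close>

locale eigenbasis =
  fixes n :: nat and U :: "real Matrix.mat" and e :: "nat \<Rightarrow> real Matrix.vec" and lam :: "nat \<Rightarrow> real"
  assumes U: "U \<in> carrier_mat n n"
    and eb: "orthonormal_eigenbasis n U e lam"
begin

lemma e_carrier [simp]: "j \<in> {1..n} \<Longrightarrow> e j \<in> carrier_vec n"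
  and U_mult_e: "j \<in> {1..n} \<Longrightarrow> U *\<^sub>v e j = lam j \<cdot>\<^sub>v e j"
  and e_orthonormal: "i \<in> {1..n} \<Longrightarrow> j \<in> {1..n} \<Longrightarrow> scalar_prod (e i) (e j) = (if i = j then 1 else 0)"
  using eb by (auto simp: orthonormal_eigenbasis_def)

text \<open>The orthogonal matrix with the eigenvectors as columns. \<open>Suc\<close> passes from
  matrix indices, which start at 0, to eigenvectors numbered from 1.\<close>

definition E :: "real Matrix.mat" where
  "E = Matrix.mat n n (\<lambda>(i, j). vec_index (e (Suc j)) i)"

definition diagonal :: "(nat \<Rightarrow> real) \<Rightarrow> real Matrix.mat" where
  "diagonal g = Matrix.mat n n (\<lambda>(i, j). if i = j then g (Suc j) else 0)"

lemma E_carrier [simp]: "E \<in> carrier_mat n n" "E\<^sup>T \<in> carrier_mat n n"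
  and diagonal_carrier [simp]: "diagonal g \<in> carrier_mat n n"
  by (auto simp: E_def diagonal_def)

lemma dim_E [simp]: "dim_row E = n" "dim_col E = n"
  and dim_diagonal [simp]: "dim_row (diagonal g) = n" "dim_col (diagonal g) = n"
  by (auto simp: E_def diagonal_def)

lemma dim_e [simp]: "j < n \<Longrightarrow> dim_vec (e (Suc j)) = n"
  using e_carrier[of "Suc j"] by auto

lemma col_E [simp]: "j < n \<Longrightarrow> Matrix.col E j = e (Suc j)"
  by (intro eq_vecI) (auto simp: E_def)

lemma E_transpose_E: "E\<^sup>T * E = 1\<^sub>m n"
proof (rule eq_matI)
  fix i j assume "i < dim_row (1\<^sub>m n :: real Matrix.mat)" "j < dim_col (1\<^sub>m n :: real Matrix.mat)"
  then have ij: "i < n" "j < n" by auto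
  then have "(E\<^sup>T * E) $$ (i, j) = scalar_prod (e (Suc i)) (e (Suc j))"
    by (simp add: index_mult_mat)
  then show "(E\<^sup>T * E) $$ (i, j) = 1\<^sub>m n $$ (i, j)" using ij by (simp add: e_orthonormal)
qed (use E_carrier in auto)

lemma E_E_transpose: "E * E\<^sup>T = 1\<^sub>m n"
  using mat_mult_left_right_inverse[OF E_carrier(2) E_carrier(1) E_transpose_E] .

text \<open>The eigenvalue equations say column by column that
  \<open>A * E = E * diagonal g\<close>; multiplication by the transpose of \<open>E\<close> on the
  right then isolates \<open>A\<close>.\<close>

lemma mult_diagonal:
  assumes A: "A \<in> carrier_mat n n"
    and ev: "\<And>j. j \<in> {1..n} \<Longrightarrow> A *\<^sub>v e j = g j \<cdot>\<^sub>v e j"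
  shows "A = E * diagonal g * E\<^sup>T"
proof -
  have "A * E = E * diagonal g"
  proof (rule eq_matI)
    fix i j assume "i < dim_row (E * diagonal g)" "j < dim_col (E * diagonal g)"
    then have ij: "i < n" "j < n" using E_carrier(1) diagonal_carrier[of g] by auto
    have "(A * E) $$ (i, j) = vec_index (A *\<^sub>v e (Suc j)) i"
      using ij A by auto
    also have "\<dots> = g (Suc j) * vec_index (e (Suc j)) i"
      using ij by (simp add: ev)
    also have "\<dots> = (\<Sum>k = 0..<n. if k = j then vec_index (e (Suc k)) i * g (Suc j) else 0)"
      using ij by (subst sum.delta) auto
    also have "\<dots> = (\<Sum>k = 0..<n. vec_index (e (Suc k)) i * (if k = j then g (Suc j) else 0))"
      by (rule sum.cong) auto
    also have "\<dots> = (E * diagonal g) $$ (i, j)"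
      using ij by (simp add: E_def diagonal_def scalar_prod_def)
    finally show "(A * E) $$ (i, j) = (E * diagonal g) $$ (i, j)" .
  qed (use A E_carrier diagonal_carrier[of g] in auto)
  then have "A * E * E\<^sup>T = E * diagonal g * E\<^sup>T" by simp
  moreover have "A * E * E\<^sup>T = A * (E * E\<^sup>T)"
    using A E_carrier by (intro assoc_mult_mat) auto
  ultimately show ?thesis using A by (simp add: E_E_transpose)
qed

lemma det_diagonal: "Determinant.det (diagonal g) = (\<Prod>j=1..n. g j)"
proof -
  have "Determinant.det (diagonal g) = prod_list (diag_mat (diagonal g))"
    by (rule det_upper_triangular[OF _ diagonal_carrier]) (auto simp: diagonal_def upper_triangular_def)
  also have "\<dots> = (\<Prod>j<n. g (Suc j))"
    by (simp add: prod_list_diag_prod diagonal_def atLeast0LessThan)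
  finally show ?thesis by (simp add: prod.atLeast1_atMost_eq)
qed

lemma diagonal_mult_inverse:
  assumes "\<And>j. j \<in> {1..n} \<Longrightarrow> g j \<noteq> 0"
  shows "diagonal g * diagonal (\<lambda>j. 1 / g j) = 1\<^sub>m n"
proof (rule eq_matI)
  fix i j assume "i < dim_row (1\<^sub>m n :: real Matrix.mat)" "j < dim_col (1\<^sub>m n :: real Matrix.mat)"
  then have ij: "i < n" "j < n" by auto
  have "(diagonal g * diagonal (\<lambda>j. 1 / g j)) $$ (i, j) =
     (\<Sum>k = 0..<n. (if i = k then g (Suc k) else 0) * (if k = j then 1 / g (Suc j) else 0))"
    using ij by (simp add: scalar_prod_def) (simp add: diagonal_def)
  also have "\<dots> = (\<Sum>k = 0..<n. (if k = i then (if i = j then g (Suc i) * (1 / g (Suc j)) else 0) else 0))"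
    by (rule sum.cong) auto
  also have "\<dots> = (if i = j then g (Suc i) * (1 / g (Suc j)) else 0)"
    using ij by (subst sum.delta) auto
  also have "\<dots> = 1\<^sub>m n $$ (i, j)" using ij assms[of "Suc j"] by auto
  finally show "(diagonal g * diagonal (\<lambda>j. 1 / g j)) $$ (i, j) = 1\<^sub>m n $$ (i, j)" .
qed (auto simp: diagonal_def)

lemma shifted_matrix:
  "1\<^sub>m n + c \<cdot>\<^sub>m U = E * diagonal (\<lambda>j. 1 + c * lam j) * E\<^sup>T"
proof (rule mult_diagonal)
  fix j assume j: "j \<in> {1..n}"
  have "(1\<^sub>m n + c \<cdot>\<^sub>m U) *\<^sub>v e j = 1\<^sub>m n *\<^sub>v e j + (c \<cdot>\<^sub>m U) *\<^sub>v e j"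
    using U j by (intro add_mult_distrib_mat_vec) auto
  also have "(c \<cdot>\<^sub>m U) *\<^sub>v e j = c \<cdot>\<^sub>v (lam j \<cdot>\<^sub>v e j)"
    using U e_carrier[OF j] by (subst U_mult_e[OF j, symmetric]) (auto simp: smult_scalar_prod_distrib[of _ n])
  finally show "(1\<^sub>m n + c \<cdot>\<^sub>m U) *\<^sub>v e j = (1 + c * lam j) \<cdot>\<^sub>v e j"
    using e_carrier[OF j] by (intro eq_vecI) (auto simp: algebra_simps)
qed (use U in auto)

lemma det_shifted:
  "Determinant.det (1\<^sub>m n + c \<cdot>\<^sub>m U) = (\<Prod>j=1..n. 1 + c * lam j)"
proof -
  have "Determinant.det E * Determinant.det (E\<^sup>T) = 1"
    using det_mult[of E n "E\<^sup>T"] by (simp add: E_E_transpose)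
  then show ?thesis
    unfolding shifted_matrix
    by (subst det_mult[of _ n] det_mult[of E n]; (simp add: mult_carrier_mat[of _ n n])?)+
       (simp add: det_diagonal algebra_simps)
qed

text \<open>The inverse is \<open>E\<close> times the diagonal of reciprocals times the transpose of
  \<open>E\<close>, so the quadratic form is a weighted sum of the squared coordinates of
  \<open>y\<close> in the eigenbasis.\<close>

lemma quadratic_form_inverse_shifted:
  assumes nz: "\<And>j. j \<in> {1..n} \<Longrightarrow> 1 + c * lam j \<noteq> 0" and y: "y \<in> carrier_vec n"
  shows "scalar_prod y (the (mat_inverse (1\<^sub>m n + c \<cdot>\<^sub>m U)) *\<^sub>v y) =
           (\<Sum>j=1..n. (scalar_prod y (e j))\<^sup>2 / (1 + c * lam j))"
proof -
  define A where "A = 1\<^sub>m n + c \<cdot>\<^sub>m U"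
  let ?G = "diagonal (\<lambda>j. 1 + c * lam j)" and ?H = "diagonal (\<lambda>j. 1 / (1 + c * lam j))"
  define V where "V = E * (?H * E\<^sup>T)"
  have A: "A \<in> carrier_mat n n" and V: "V \<in> carrier_mat n n"
    using U by (auto simp: A_def V_def intro!: mult_carrier_mat[of _ n n])
  have "A * V = E * ?G * E\<^sup>T * (E * (?H * E\<^sup>T))"
    by (simp add: A_def V_def shifted_matrix)
  also have "\<dots> = E * ?G * (E\<^sup>T * (E * (?H * E\<^sup>T)))"
    by (rule assoc_mult_mat) (auto intro!: mult_carrier_mat)
  also have "E\<^sup>T * (E * (?H * E\<^sup>T)) = E\<^sup>T * E * (?H * E\<^sup>T)"
    by (rule assoc_mult_mat[symmetric]) (auto intro!: mult_carrier_mat)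
  also have "\<dots> = ?H * E\<^sup>T"
    unfolding E_transpose_E by (rule left_mult_one_mat) (auto intro!: mult_carrier_mat)
  also have "E * ?G * (?H * E\<^sup>T) = E * (?G * (?H * E\<^sup>T))"
    by (rule assoc_mult_mat) (auto intro!: mult_carrier_mat)
  also have "?G * (?H * E\<^sup>T) = ?G * ?H * E\<^sup>T"
    by (rule assoc_mult_mat[symmetric]) (auto intro!: mult_carrier_mat)
  also have "\<dots> = E\<^sup>T"
    using nz by (subst diagonal_mult_inverse) auto
  finally have AV: "A * V = 1\<^sub>m n" by (simp add: E_E_transpose)
  have VA: "V * A = 1\<^sub>m n" by (rule mat_mult_left_right_inverse[OF A V AV])
  \<comment> \<open>\<open>mat_inverse\<close> yields an option. \<open>None\<close> would mean that
    \<open>A\<close> is not a unit of the matrix ring, but \<open>V\<close> is a two-sided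
    inverse.\<close>
  have "mat_inverse A \<noteq> None"
  proof
    assume "mat_inverse A = None"
    from mat_inverse(1)[OF A this] have "A \<notin> Units (ring_mat TYPE(real) n ())" .
    moreover have "A \<in> Units (ring_mat TYPE(real) n ())"
      using A V AV VA by (auto simp: Units_def ring_mat_simps intro!: bexI[of _ V])
    ultimately show False by blast
  qed
  then obtain B where B: "mat_inverse A = Some B" by blast
  from mat_inverse(2)[OF A this] have BA: "B * A = 1\<^sub>m n" and Bc: "B \<in> carrier_mat n n" by auto
  have "B = B * (A * V)" using Bc AV by simp
  also have "\<dots> = B * A * V" using A Bc V by (intro assoc_mult_mat[symmetric]) auto
  also have "\<dots> = V" using BA V by simp
  finally have BV: "B = V" .
  \<comment> \<open>The coordinates of \<open>y\<close> in the eigenbasis.\<close>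
  define w where "w = E\<^sup>T *\<^sub>v y"
  have w: "w \<in> carrier_vec n" using y by (auto simp: w_def intro!: mult_mat_vec_carrier)
  have wj: "vec_index w j = scalar_prod y (e (Suc j))" if "j < n" for j
    using that y col_E[OF that] comm_scalar_prod[OF y e_carrier[of "Suc j"]] E_carrier(1)
    by (simp add: w_def)
  have "V *\<^sub>v y = E *\<^sub>v (?H *\<^sub>v w)"
    unfolding V_def w_def using y
    by (subst assoc_mult_mat_vec[of _ n n _ n]; (simp add: mult_carrier_mat[of _ n n])?)
       (subst assoc_mult_mat_vec[of _ n n _ n]; simp)
  then have "scalar_prod y (V *\<^sub>v y) = scalar_prod w (?H *\<^sub>v w)"
    using transpose_vec_mult_scalar[OF E_carrier(1) mult_mat_vec_carrier[OF diagonal_carrier w] y]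
    by (simp add: w_def)
  also have "\<dots> = scalar_prod (?H *\<^sub>v w) w"
    by (rule comm_scalar_prod[OF w mult_mat_vec_carrier[OF diagonal_carrier w]])
  also have "\<dots> = (\<Sum>i = 0..<n. vec_index (?H *\<^sub>v w) i * vec_index w i)"
    using w by (simp add: scalar_prod_def)
  also have "\<dots> = (\<Sum>i = 0..<n. (vec_index w i)\<^sup>2 / (1 + c * lam (Suc i)))"
  proof (rule sum.cong)
    fix i assume i: "i \<in> {0..<n}"
    have "vec_index (?H *\<^sub>v w) i = (\<Sum>k = 0..<n. (if i = k then 1 / (1 + c * lam (Suc k)) else 0) * vec_index w k)"
      using i w by (simp add: scalar_prod_def) (simp add: diagonal_def)
    also have "\<dots> = (\<Sum>k = 0..<n. if k = i then 1 / (1 + c * lam (Suc k)) * vec_index w k else 0)"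
      by (rule sum.cong) auto
    also have "\<dots> = 1 / (1 + c * lam (Suc i)) * vec_index w i"
      using i by (subst sum.delta) auto
    finally show "vec_index (?H *\<^sub>v w) i * vec_index w i = (vec_index w i)\<^sup>2 / (1 + c * lam (Suc i))"
      by (simp add: power2_eq_square)
  qed simp
  also have "\<dots> = (\<Sum>j=1..n. (scalar_prod y (e j))\<^sup>2 / (1 + c * lam j))"
    by (simp add: sum.atLeast1_atMost_eq atLeast0LessThan wj)
  finally show ?thesis using B BV by (simp add: A_def)
qed

end

section \<open>Gaussian coordinates\<close>

text \<open>The definition of the process, applied to the one-point set \<open>{t}\<close> with
  coefficient 1, identifies the law of \<open>W t\<close> with that of a multiple of a standard
  normal variable, whose second moment is finite.\<close>

lemma gaussian_process_square_integrable:
  assumes "centered_gaussian_process S W"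
  shows "integrable S (\<lambda>\<omega>. (W t \<omega>)\<^sup>2)"
proof -
  from assms have W: "W t \<in> borel_measurable S"
    by (auto simp: centered_gaussian_process_def)
  have "\<exists>s\<ge>0. distr S borel (\<lambda>\<omega>. \<Sum>u\<in>{t}. (\<lambda>_. 1) u * W u \<omega>) =
      distr (density lborel (\<lambda>z. ennreal (std_normal_density z))) borel (\<lambda>z. s * z)"
    using assms unfolding centered_gaussian_process_def by (elim conjE) (erule allE, erule allE, erule mp, simp)
  then obtain s where s: "distr S borel (W t) =
      distr (density lborel (\<lambda>z. ennreal (std_normal_density z))) borel (\<lambda>z. s * z)"
    by auto
  have "integrable lborel (\<lambda>z. std_normal_density z * (s * z)\<^sup>2)"
    using integrable_mult_right[OF integrable_std_normal_moment[of 2], of "s\<^sup>2"]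
    by (simp add: power_mult_distrib mult_ac)
  then have "integrable (density lborel (\<lambda>z. ennreal (std_normal_density z))) (\<lambda>z. (s * z)\<^sup>2)"
    by (subst integrable_density) auto
  then have "integrable (distr S borel (W t)) (\<lambda>y. y\<^sup>2)"
    unfolding s by (subst integrable_distr_eq) auto
  then show ?thesis
    using W by (subst (asm) integrable_distr_eq) auto
qed

text \<open>As \<open>e j\<close> is a unit vector, \<open>lam j\<close> equals the quadratic form
  of the covariance matrix at \<open>e j\<close>, which is the expectation of a square.\<close>

lemma covariance_eigenvalue_nonneg:
  assumes gp: "centered_gaussian_process S W"
    and eb: "orthonormal_eigenbasis n (covariance_mat S W n x) e lam"
    and j: "j \<in> {1..n}"
  shows "0 \<le> lam j"
proof -
  interpret prob_space S using gp by (simp add: centered_gaussian_process_def)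
  have W [measurable]: "W t \<in> borel_measurable S" for t
    using gp by (auto simp: centered_gaussian_process_def)
  have Wi: "integrable S (W t)" for t
    by (rule square_integrable_imp_integrable) (auto intro: gaussian_process_square_integrable[OF gp])
  define V where "V i \<omega> = W (x (Suc i)) \<omega> - expectation (W (x (Suc i)))" for i \<omega>
  have V [measurable]: "V i \<in> borel_measurable S" for i
    unfolding V_def by measurable
  have V2: "integrable S (\<lambda>\<omega>. (V i \<omega>)\<^sup>2)" for i
    unfolding V_def power2_diff
    by (intro Bochner_Integration.integrable_add Bochner_Integration.integrable_diff
        integrable_mult_left integrable_mult_right gaussian_process_square_integrable[OF gp] Wi) auto
  \<comment> \<open>A product is dominated by the sum of the two squares.\<close>
  have VV: "integrable S (\<lambda>\<omega>. V i \<omega> * V k \<omega>)" for i k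
  proof (rule Bochner_Integration.integrable_bound)
    show "integrable S (\<lambda>\<omega>. (V i \<omega>)\<^sup>2 + (V k \<omega>)\<^sup>2)" by (intro Bochner_Integration.integrable_add V2)
    show "AE \<omega> in S. norm (V i \<omega> * V k \<omega>) \<le> norm ((V i \<omega>)\<^sup>2 + (V k \<omega>)\<^sup>2)"
    proof (rule AE_I2)
      fix \<omega>
      have "2 * (\<bar>V i \<omega>\<bar> * \<bar>V k \<omega>\<bar>) \<le> (V i \<omega>)\<^sup>2 + (V k \<omega>)\<^sup>2"
        using zero_le_power2[of "\<bar>V i \<omega>\<bar> - \<bar>V k \<omega>\<bar>"] by (simp add: power2_diff)
      moreover have "0 \<le> \<bar>V i \<omega>\<bar> * \<bar>V k \<omega>\<bar>" by simp
      ultimately have "\<bar>V i \<omega>\<bar> * \<bar>V k \<omega>\<bar> \<le> (V i \<omega>)\<^sup>2 + (V k \<omega>)\<^sup>2" by linarith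
      then show "norm (V i \<omega> * V k \<omega>) \<le> norm ((V i \<omega>)\<^sup>2 + (V k \<omega>)\<^sup>2)"
        by (simp add: abs_mult)
    qed
  qed auto
  let ?U = "covariance_mat S W n x" and ?v = "vec_index (e j)"
  from eb j have ej: "e j \<in> carrier_vec n" "?U *\<^sub>v e j = lam j \<cdot>\<^sub>v e j" "scalar_prod (e j) (e j) = 1"
    by (auto simp: orthonormal_eigenbasis_def)
  have "lam j = scalar_prod (e j) (?U *\<^sub>v e j)"
    using ej by simp
  also have "\<dots> = (\<Sum>i<n. ?v i * (\<Sum>k<n. expectation (\<lambda>\<omega>. V i \<omega> * V k \<omega>) * ?v k))"
    using ej(1) by (auto simp: scalar_prod_def covariance_mat_def V_def Let_def atLeast0LessThan intro!: sum.cong)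
  also have "\<dots> = expectation (\<lambda>\<omega>. \<Sum>i<n. ?v i * (\<Sum>k<n. (V i \<omega> * V k \<omega>) * ?v k))"
    using VV by (simp add: Bochner_Integration.integral_sum)
  also have "\<dots> = expectation (\<lambda>\<omega>. (\<Sum>i<n. ?v i * V i \<omega>)\<^sup>2)"
    by (intro Bochner_Integration.integral_cong refl)
       (simp add: power2_eq_square sum_product sum_distrib_left mult_ac)
  also have "0 \<le> \<dots>" by simp
  finally show ?thesis by simp
qed

section \<open>Second and fourth moments, and tail bounds\<close>

context prob_space
begin

text \<open>A linear combination of independent standard normal variables is centered normal with
  variance the sum of the squared coefficients, so its even moments are known.\<close>

lemma gaussian_linear_combination_moments:
  fixes a :: "'i \<Rightarrow> real"
  assumes indep: "indep_vars (\<lambda>_. borel) X I" and I: "finite I"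
    and D: "\<And>i. i \<in> I \<Longrightarrow> distributed M lborel (X i) (\<lambda>z. ennreal (std_normal_density z))"
  defines "L \<equiv> \<lambda>\<omega>. \<Sum>i\<in>I. a i * X i \<omega>"
  shows "has_bochner_integral M (\<lambda>\<omega>. (L \<omega>)\<^sup>2) (\<Sum>i\<in>I. (a i)\<^sup>2)"
    and "has_bochner_integral M (\<lambda>\<omega>. (L \<omega>) ^ 4) (3 * (\<Sum>i\<in>I. (a i)\<^sup>2)\<^sup>2)"
proof -
  \<comment> \<open>Normal densities require a positive standard deviation, so vanishing
    coefficients are dropped first. If none remain, the combination is 0.\<close>
  define J where "J = {i\<in>I. a i \<noteq> 0}"
  have J: "finite J" "J \<subseteq> I" using I by (auto simp: J_def)
  have LJ: "L \<omega> = (\<Sum>i\<in>J. a i * X i \<omega>)" for \<omega>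
    unfolding L_def J_def using I by (intro sum.mono_neutral_right) auto
  have sJ: "(\<Sum>i\<in>I. (a i)\<^sup>2) = (\<Sum>i\<in>J. (a i)\<^sup>2)"
    unfolding J_def using I by (intro sum.mono_neutral_right) auto
  define v where "v = (\<Sum>i\<in>J. (a i)\<^sup>2)"
  have "has_bochner_integral M (\<lambda>\<omega>. (L \<omega>)\<^sup>2) v \<and> has_bochner_integral M (\<lambda>\<omega>. (L \<omega>) ^ 4) (3 * v\<^sup>2)"
  proof (cases "J = {}")
    case True
    then show ?thesis by (simp add: LJ v_def has_bochner_integral_iff)
  next
    case False
    have v: "0 < v" unfolding v_def using J False by (intro sum_pos) (auto simp: J_def)
    have "distributed M lborel (\<lambda>\<omega>. 0 + a i * X i \<omega>) (normal_density (0 + a i * 0) (\<bar>a i\<bar> * 1))" if "i \<in> J" for i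
      using that D by (intro normal_density_affine) (auto simp: J_def)
    then have 1: "distributed M lborel (\<lambda>\<omega>. a i * X i \<omega>) (normal_density 0 \<bar>a i\<bar>)" if "i \<in> J" for i
      using that by simp
    have 2: "indep_vars (\<lambda>_. borel) (\<lambda>i \<omega>. a i * X i \<omega>) J"
      using indep_vars_subset[OF indep J(2)]
      by (rule indep_vars_compose2[where Y="\<lambda>i y. a i * y"]) auto
    have "distributed M lborel (\<lambda>\<omega>. \<Sum>i\<in>J. a i * X i \<omega>) (normal_density (\<Sum>i\<in>J. 0) (sqrt (\<Sum>i\<in>J. \<bar>a i\<bar>\<^sup>2)))"
      by (rule sum_indep_normal[OF J(1) False 2]) (use 1 in \<open>auto simp: J_def\<close>)
    then have dL: "distributed M lborel L (normal_density 0 (sqrt v))"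
      by (simp add: LJ[abs_def] v_def)
    have mom: "has_bochner_integral M (\<lambda>\<omega>. (L \<omega>) ^ (2 * k)) (fact (2 * k) / ((2 / v) ^ k * fact k))" for k
    proof -
      have "has_bochner_integral lborel (\<lambda>z. normal_density 0 (sqrt v) z * (z - 0) ^ (2 * k))
          (fact (2 * k) / ((2 / (sqrt v)\<^sup>2) ^ k * fact k))"
        using v by (intro normal_moment_even) auto
      then have *: "has_bochner_integral lborel (\<lambda>z. normal_density 0 (sqrt v) z * z ^ (2 * k))
          (fact (2 * k) / ((2 / v) ^ k * fact k))"
        using v by simp
      have "integrable M (\<lambda>\<omega>. (L \<omega>) ^ (2 * k))"
        using * by (subst distributed_integrable[OF dL, symmetric]) (auto simp: has_bochner_integral_iff)
      moreover have "expectation (\<lambda>\<omega>. (L \<omega>) ^ (2 * k)) = fact (2 * k) / ((2 / v) ^ k * fact k)"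
        using * by (subst distributed_integral[OF dL, symmetric]) (auto simp: has_bochner_integral_iff)
      ultimately show ?thesis by (simp add: has_bochner_integral_iff)
    qed
    show ?thesis
      using mom[of 1] mom[of 2] v by (simp add: fact_numeral power2_eq_square field_simps)
  qed
  then show "has_bochner_integral M (\<lambda>\<omega>. (L \<omega>)\<^sup>2) (\<Sum>i\<in>I. (a i)\<^sup>2)"
    and "has_bochner_integral M (\<lambda>\<omega>. (L \<omega>) ^ 4) (3 * (\<Sum>i\<in>I. (a i)\<^sup>2)\<^sup>2)"
    by (simp_all add: sJ v_def)
qed

text \<open>When the square is expanded, only the diagonal terms have nonzero expectation. The lemma
  serves \<open>Z j\<close> with \<open>v = 1\<close> and \<open>(Z j)\<^sup>2 - 1\<close> with
  \<open>v = 2\<close>.\<close>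

lemma orthogonal_sum_second_moment:
  fixes a :: "'i \<Rightarrow> real"
  assumes orth: "\<And>i j. i \<in> J \<Longrightarrow> j \<in> J \<Longrightarrow>
      has_bochner_integral M (\<lambda>\<omega>. \<xi> i \<omega> * \<xi> j \<omega>) (if i = j then v else 0)"
    and J: "finite J"
  shows "has_bochner_integral M (\<lambda>\<omega>. (\<Sum>j\<in>J. a j * \<xi> j \<omega>)\<^sup>2) (v * (\<Sum>j\<in>J. (a j)\<^sup>2))"
proof -
  have "has_bochner_integral M (\<lambda>\<omega>. \<Sum>i\<in>J. \<Sum>j\<in>J. (a i * a j) * (\<xi> i \<omega> * \<xi> j \<omega>))
      (\<Sum>i\<in>J. \<Sum>j\<in>J. (a i * a j) * (if i = j then v else 0))"
    by (intro has_bochner_integral_sum has_bochner_integral_mult_right orth) auto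
  moreover have "(\<Sum>i\<in>J. \<Sum>j\<in>J. (a i * a j) * (if i = j then v else 0)) = v * (\<Sum>j\<in>J. (a j)\<^sup>2)"
  proof -
    have "(\<Sum>j\<in>J. (a i * a j) * (if i = j then v else 0)) = v * (a i)\<^sup>2" if "i \<in> J" for i
    proof -
      have "(\<Sum>j\<in>J. (a i * a j) * (if i = j then v else 0)) = (\<Sum>j\<in>J. if j = i then v * (a i)\<^sup>2 else 0)"
        by (rule sum.cong) (auto simp: power2_eq_square)
      then show ?thesis using that J by simp
    qed
    then show ?thesis by (simp add: sum_distrib_left)
  qed
  moreover have "(\<Sum>i\<in>J. \<Sum>j\<in>J. (a i * a j) * (\<xi> i \<omega> * \<xi> j \<omega>)) = (\<Sum>j\<in>J. a j * \<xi> j \<omega>)\<^sup>2" for \<omega>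
    by (simp add: power2_eq_square sum_product mult_ac)
  ultimately show ?thesis by simp
qed

text \<open>Chebyshev's inequality, obtained as Markov's inequality for the square.\<close>

lemma prob_abs_gt_le_second_moment:
  assumes "has_bochner_integral M (\<lambda>\<omega>. (X \<omega>)\<^sup>2) s" "X \<in> borel_measurable M" "0 < t"
  shows "prob {\<omega> \<in> space M. t < \<bar>X \<omega>\<bar>} \<le> s / t\<^sup>2"
proof -
  have [measurable]: "X \<in> borel_measurable M" by fact
  have "prob {\<omega> \<in> space M. t < \<bar>X \<omega>\<bar>} \<le> prob {\<omega> \<in> space M. t\<^sup>2 \<le> (X \<omega>)\<^sup>2}"
    using assms(3) by (intro finite_measure_mono) (auto simp: abs_le_square_iff[symmetric])
  also have "\<dots> \<le> expectation (\<lambda>\<omega>. (X \<omega>)\<^sup>2) / t\<^sup>2"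
    using assms by (intro integral_Markov_inequality_measure[where A = "{}"])
      (auto simp: has_bochner_integral_iff)
  finally show ?thesis using assms(1) by (simp add: has_bochner_integral_iff)
qed

lemma prob_countable_union_le:
  assumes A: "\<And>i. A i \<in> events" and g: "\<And>i. prob (A i) \<le> g i" "g sums s"
  shows "prob (\<Union>i::nat. A i) \<le> s"
proof -
  have sm: "summable (\<lambda>i. prob (A i))"
    by (rule summable_comparison_test'[OF sums_summable[OF g(2)], of 0]) (use g in auto)
  have "prob (\<Union>i. A i) \<le> (\<Sum>i. prob (A i))"
    using A by (intro finite_measure_subadditive_countably sm) auto
  also have "\<dots> \<le> (\<Sum>i. g i)"
    by (intro suminf_le sm g sums_summable[OF g(2)])
  finally show ?thesis using g(2) by (simp add: sums_iff)
qed

end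

text \<open>A single stage of the experiment with \<open>n\<close> observations, where
  \<open>fv\<close> is the vector of values of \<open>f\<close> at the design points.\<close>

locale gaussian_model = eigenbasis + prob_space P for P :: "'w measure" +
  fixes eps :: "nat \<Rightarrow> 'w \<Rightarrow> real" and fv :: "real Matrix.vec"
  assumes noise: "standard_gaussian_noise P n eps"
    and fv: "fv \<in> carrier_vec n"
    and lam_nonneg: "\<And>j. j \<in> {1..n} \<Longrightarrow> 0 \<le> lam j"
begin

definition Z :: "nat \<Rightarrow> 'w \<Rightarrow> real" where
  "Z j \<omega> = scalar_prod (vec1 n (\<lambda>i. eps i \<omega>)) (e j)"

abbreviation "f_coord j \<equiv> scalar_prod fv (e j)"

lemma Z_eq:
  assumes "j \<in> {1..n}"
  shows "Z j \<omega> = (\<Sum>i=1..n. vec_index (e j) (i - 1) * eps i \<omega>)"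
  using e_carrier[OF assms]
  by (auto simp: Z_def vec1_def scalar_prod_def sum.atLeast1_atMost_eq atLeast0LessThan intro!: sum.cong)

lemma eps_indep: "indep_vars (\<lambda>_. borel) eps {1..n}"
  and eps_distributed: "i \<in> {1..n} \<Longrightarrow> distributed P lborel (eps i) (\<lambda>z. ennreal (std_normal_density z))"
  using noise by (auto simp: standard_gaussian_noise_def)

lemma eps_measurable: "i \<in> {1..n} \<Longrightarrow> eps i \<in> borel_measurable P"
  using distributed_measurable[OF eps_distributed] by simp

lemma Z_measurable [measurable]: "j \<in> {1..n} \<Longrightarrow> Z j \<in> borel_measurable P"
proof -
  assume j: "j \<in> {1..n}"
  have "Z j = (\<lambda>\<omega>. \<Sum>i=1..n. vec_index (e j) (i - 1) * eps i \<omega>)"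
    using Z_eq[OF j] by auto
  then show ?thesis using eps_measurable by simp
qed

lemma sum_e_product:
  assumes "i \<in> {1..n}" "j \<in> {1..n}"
  shows "(\<Sum>k=1..n. vec_index (e i) (k - 1) * vec_index (e j) (k - 1)) = (if i = j then 1 else 0)"
proof -
  have "(\<Sum>k=1..n. vec_index (e i) (k - 1) * vec_index (e j) (k - 1)) = scalar_prod (e i) (e j)"
    using e_carrier[OF assms(2)]
    by (simp add: scalar_prod_def sum.atLeast1_atMost_eq atLeast0LessThan)
  then show ?thesis using e_orthonormal[OF assms] by simp
qed

text \<open>The combination of \<open>Z i\<close> and \<open>Z j\<close> is a linear combination of
  the noise variables with coefficient vector \<open>\<alpha> e i + \<beta> e j\<close>, whose
  squared length is computed from orthonormality.\<close>

lemma Z_pair_moments: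
  assumes i: "i \<in> {1..n}" and j: "j \<in> {1..n}"
  shows "has_bochner_integral P (\<lambda>\<omega>. (\<alpha> * Z i \<omega> + \<beta> * Z j \<omega>)\<^sup>2)
      (\<alpha>\<^sup>2 + \<beta>\<^sup>2 + 2 * \<alpha> * \<beta> * (if i = j then 1 else 0))"
    and "has_bochner_integral P (\<lambda>\<omega>. (\<alpha> * Z i \<omega> + \<beta> * Z j \<omega>) ^ 4)
      (3 * (\<alpha>\<^sup>2 + \<beta>\<^sup>2 + 2 * \<alpha> * \<beta> * (if i = j then 1 else 0))\<^sup>2)"
proof -
  define a where "a k = \<alpha> * vec_index (e i) (k - 1) + \<beta> * vec_index (e j) (k - 1)" for k
  have L: "(\<Sum>k\<in>{1..n}. a k * eps k \<omega>) = \<alpha> * Z i \<omega> + \<beta> * Z j \<omega>" for \<omega>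
    by (simp add: a_def Z_eq[OF i] Z_eq[OF j] sum_distrib_left sum.distrib[symmetric] algebra_simps)
  have "(\<Sum>k\<in>{1..n}. (a k)\<^sup>2) =
      \<alpha>\<^sup>2 * (\<Sum>k=1..n. vec_index (e i) (k - 1) * vec_index (e i) (k - 1))
      + \<beta>\<^sup>2 * (\<Sum>k=1..n. vec_index (e j) (k - 1) * vec_index (e j) (k - 1))
      + 2 * \<alpha> * \<beta> * (\<Sum>k=1..n. vec_index (e i) (k - 1) * vec_index (e j) (k - 1))"
    by (simp add: a_def sum_distrib_left sum.distrib[symmetric] power2_eq_square algebra_simps)
  then have S: "(\<Sum>k\<in>{1..n}. (a k)\<^sup>2) = \<alpha>\<^sup>2 + \<beta>\<^sup>2 + 2 * \<alpha> * \<beta> * (if i = j then 1 else 0)"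
    unfolding sum_e_product[OF i i] sum_e_product[OF j j] sum_e_product[OF i j] by simp
  show "has_bochner_integral P (\<lambda>\<omega>. (\<alpha> * Z i \<omega> + \<beta> * Z j \<omega>)\<^sup>2)
      (\<alpha>\<^sup>2 + \<beta>\<^sup>2 + 2 * \<alpha> * \<beta> * (if i = j then 1 else 0))"
    using gaussian_linear_combination_moments(1)[OF eps_indep _ eps_distributed, of a] unfolding L S by simp
  show "has_bochner_integral P (\<lambda>\<omega>. (\<alpha> * Z i \<omega> + \<beta> * Z j \<omega>) ^ 4)
      (3 * (\<alpha>\<^sup>2 + \<beta>\<^sup>2 + 2 * \<alpha> * \<beta> * (if i = j then 1 else 0))\<^sup>2)"
    using gaussian_linear_combination_moments(2)[OF eps_indep _ eps_distributed, of a] unfolding L S by simp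
qed

text \<open>The mixed moments follow by polarization from the second and fourth moments of \<open>Z i \<plusminus> Z j\<close>.\<close>

lemma Z_orthonormal:
  assumes i: "i \<in> {1..n}" and j: "j \<in> {1..n}"
  shows "has_bochner_integral P (\<lambda>\<omega>. Z i \<omega> * Z j \<omega>) (if i = j then 1 else 0)"
proof -
  let ?d = "if i = j then 1 else 0 :: real"
  have "has_bochner_integral P (\<lambda>\<omega>. ((1 * Z i \<omega> + 1 * Z j \<omega>)\<^sup>2 - (1 * Z i \<omega> + (-1) * Z j \<omega>)\<^sup>2) / 4)
     (((1\<^sup>2 + 1\<^sup>2 + 2 * 1 * 1 * ?d) - (1\<^sup>2 + (-1)\<^sup>2 + 2 * 1 * (-1) * ?d)) / 4)"
    by (intro has_bochner_integral_divide has_bochner_integral_diff Z_pair_moments i j)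
  moreover have "((1 * Z i \<omega> + 1 * Z j \<omega>)\<^sup>2 - (1 * Z i \<omega> + (-1) * Z j \<omega>)\<^sup>2) / 4 = Z i \<omega> * Z j \<omega>" for \<omega>
    by (simp add: power2_eq_square algebra_simps)
  ultimately show ?thesis by (simp split: if_splits)
qed

lemma Z_square_orthogonal:
  assumes i: "i \<in> {1..n}" and j: "j \<in> {1..n}"
  shows "has_bochner_integral P (\<lambda>\<omega>. ((Z i \<omega>)\<^sup>2 - 1) * ((Z j \<omega>)\<^sup>2 - 1)) (if i = j then 2 else 0)"
proof -
  let ?d = "if i = j then 1 else 0 :: real"
  let ?q = "\<lambda>\<alpha> \<beta> \<omega>. \<alpha> * Z i \<omega> + \<beta> * Z j \<omega>"
  \<comment> \<open>The identity is \<open>(a + b) ^ 4 + (a - b) ^ 4 - 2 * a ^ 4 - 2 * b ^ 4 = 12 *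
    a\<^sup>2 * b\<^sup>2\<close>; the remaining terms turn \<open>a\<^sup>2 * b\<^sup>2\<close>
    into the product of the centered squares.\<close>
  have "has_bochner_integral P (\<lambda>\<omega>. ((?q 1 1 \<omega>) ^ 4 + (?q 1 (-1) \<omega>) ^ 4 - 2 * (?q 1 0 \<omega>) ^ 4 - 2 * (?q 0 1 \<omega>) ^ 4) / 12
        - (?q 1 0 \<omega>)\<^sup>2 - (?q 0 1 \<omega>)\<^sup>2 + 1)
     ((3 * (1\<^sup>2 + 1\<^sup>2 + 2 * 1 * 1 * ?d)\<^sup>2 + 3 * (1\<^sup>2 + (-1)\<^sup>2 + 2 * 1 * (-1) * ?d)\<^sup>2
        - 2 * (3 * (1\<^sup>2 + 0\<^sup>2 + 2 * 1 * 0 * ?d)\<^sup>2) - 2 * (3 * (0\<^sup>2 + 1\<^sup>2 + 2 * 0 * 1 * ?d)\<^sup>2)) / 12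
        - (1\<^sup>2 + 0\<^sup>2 + 2 * 1 * 0 * ?d) - (0\<^sup>2 + 1\<^sup>2 + 2 * 0 * 1 * ?d) + 1)"
    by (intro has_bochner_integral_divide has_bochner_integral_diff has_bochner_integral_add
        has_bochner_integral_mult_right Z_pair_moments i j)
       (auto simp: has_bochner_integral_iff prob_space)
  moreover have "((?q 1 1 \<omega>) ^ 4 + (?q 1 (-1) \<omega>) ^ 4 - 2 * (?q 1 0 \<omega>) ^ 4 - 2 * (?q 0 1 \<omega>) ^ 4) / 12
        - (?q 1 0 \<omega>)\<^sup>2 - (?q 0 1 \<omega>)\<^sup>2 + 1 = ((Z i \<omega>)\<^sup>2 - 1) * ((Z j \<omega>)\<^sup>2 - 1)" for \<omega>
    by (simp add: power2_eq_square power4_eq_xxxx field_simps)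
  ultimately show ?thesis by (simp split: if_splits)
qed

end

section \<open>Uniform control of the remainders\<close>

text \<open>The power series of \<open>1 / (1 + u * v j)\<close> separates \<open>u\<close> from the
  coefficients, so countably many bounds give one that is uniform in \<open>u\<close>. The allowance
  \<open>2 ^ r\<close> is absorbed by \<open>u ^ r \<le> (1/4) ^ r\<close>, and the series with
  ratio \<open>1/2\<close> sums to \<open>2 * T\<close>.\<close>

lemma geometric_chaining:
  fixes y v :: "'i \<Rightarrow> real"
  assumes J: "finite J" and v: "\<And>j. j \<in> J \<Longrightarrow> 0 \<le> v j" "\<And>j. j \<in> J \<Longrightarrow> v j \<le> 1"
    and u: "0 \<le> u" "u \<le> 1/4"
    and bound: "\<And>r. \<bar>\<Sum>j\<in>J. y j * v j ^ r\<bar> \<le> 2 ^ r * T"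
  shows "\<bar>\<Sum>j\<in>J. y j / (1 + u * v j)\<bar> \<le> 2 * T"
proof -
  have T: "0 \<le> T" using order_trans[OF abs_ge_zero bound[of 0]] by simp
  have uv: "\<bar>- (u * v j)\<bar> < 1" if "j \<in> J" for j
  proof -
    have "u * v j \<le> 1/4 * 1" using v[OF that] u by (intro mult_mono) auto
    then show ?thesis using v[OF that] u by simp
  qed
  have "(\<lambda>r. y j * (- (u * v j)) ^ r) sums (y j * (1 / (1 - - (u * v j))))" if "j \<in> J" for j
    using geometric_sums[of "- (u * v j)"] uv[OF that] by (intro sums_mult) auto
  then have "(\<lambda>r. \<Sum>j\<in>J. y j * (- (u * v j)) ^ r) sums (\<Sum>j\<in>J. y j * (1 / (1 - - (u * v j))))"
    by (rule sums_sum)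
  moreover have "(\<Sum>j\<in>J. y j * (- (u * v j)) ^ r) = (- u) ^ r * (\<Sum>j\<in>J. y j * v j ^ r)" for r
    by (simp add: sum_distrib_left power_mult_distrib[of "- u", simplified] mult_ac)
  ultimately have s: "(\<lambda>r. (- u) ^ r * (\<Sum>j\<in>J. y j * v j ^ r)) sums (\<Sum>j\<in>J. y j / (1 + u * v j))"
    by simp
  have le: "norm ((- u) ^ r * (\<Sum>j\<in>J. y j * v j ^ r)) \<le> (1/2) ^ r * T" for r
  proof -
    have "norm ((- u) ^ r * (\<Sum>j\<in>J. y j * v j ^ r)) = u ^ r * \<bar>\<Sum>j\<in>J. y j * v j ^ r\<bar>"
      using u by (simp add: abs_mult power_abs)
    also have "\<dots> \<le> (1/4) ^ r * (2 ^ r * T)"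
      using u bound by (intro mult_mono power_mono) auto
    also have "\<dots> = (1/2) ^ r * T"
      using power_mult_distrib[of "1/4" "2::real" r] by (simp add: mult.assoc[symmetric])
    finally show ?thesis .
  qed
  have g: "(\<lambda>r. (1/2) ^ r * T) sums (2 * T)"
    using sums_mult2[OF geometric_sums[of "1/2::real"], of T] by simp
  have "norm (\<Sum>r. (- u) ^ r * (\<Sum>j\<in>J. y j * v j ^ r)) \<le> (\<Sum>r. (1/2) ^ r * T)"
    using le sums_summable[OF g] by (rule norm_suminf_le)
  then show ?thesis using s g by (simp add: sums_iff)
qed

section \<open>Deviations on a geometric grid\<close>

context gaussian_model
begin

abbreviation "bias c \<equiv> D1 n e lam fv c"
abbreviation "vari c \<equiv> D2 n lam c"
abbreviation "risk c \<equiv> D n e lam fv c"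

lemma bias_nonneg: "0 \<le> c \<Longrightarrow> 0 \<le> bias c"
  unfolding D1_def by (intro sum_nonneg divide_nonneg_nonneg add_nonneg_nonneg mult_nonneg_nonneg lam_nonneg) auto

lemma bias_antimono:
  assumes "0 \<le> c" "c \<le> c'"
  shows "bias c' \<le> bias c"
  unfolding D1_def using assms lam_nonneg
  by (intro sum_mono divide_left_mono add_left_mono mult_right_mono mult_pos_pos add_pos_nonneg mult_nonneg_nonneg) auto

text \<open>Termwise this is \<open>1 + K * x \<le> K * (1 + x)\<close> for nonnegative
  \<open>x\<close>.\<close>

lemma bias_le_mult:
  assumes "0 \<le> c" "1 \<le> K"
  shows "bias c \<le> K * bias (K * c)"
  unfolding D1_def sum_distrib_left
proof (rule sum_mono)
  fix j assume j: "j \<in> {1..n}"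
  have l: "0 \<le> c * lam j" using assms lam_nonneg[OF j] by simp
  then have "1 + K * c * lam j \<le> K * (1 + c * lam j)"
    using assms by (simp add: algebra_simps)
  then have "(f_coord j)\<^sup>2 * (1 + K * c * lam j) \<le> (f_coord j)\<^sup>2 * (K * (1 + c * lam j))"
    by (intro mult_left_mono) auto
  moreover have "0 < 1 + c * lam j" "0 < 1 + K * c * lam j"
    using l assms by (auto intro!: add_pos_nonneg simp: mult.assoc)
  ultimately show "(f_coord j)\<^sup>2 / (1 + c * lam j) \<le> K * ((f_coord j)\<^sup>2 / (1 + K * c * lam j))"
    by (simp add: field_simps)
qed

lemma vari_nonneg: "0 \<le> c \<Longrightarrow> 0 \<le> vari c"
  unfolding D2_eq_sum_psi by (intro sum_nonneg psi_nonneg mult_nonneg_nonneg lam_nonneg) auto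

lemma vari_mono: "0 \<le> c \<Longrightarrow> c \<le> c' \<Longrightarrow> vari c \<le> vari c'"
  unfolding D2_eq_sum_psi by (intro sum_mono psi_mono mult_right_mono mult_nonneg_nonneg lam_nonneg) auto

lemma vari_mult_le:
  assumes "0 \<le> c" "1 \<le> K"
  shows "vari (K * c) \<le> K\<^sup>2 * vari c"
  unfolding D2_eq_sum_psi sum_distrib_left
proof (rule sum_mono)
  fix j assume "j \<in> {1..n}"
  then show "psi (K * c * lam j) \<le> K\<^sup>2 * psi (c * lam j)"
    using psi_mult_le[of "c * lam j" K] assms lam_nonneg by (simp add: mult.assoc)
qed

abbreviation "remainder1 \<omega> c \<equiv> R1 n e lam fv (vec1 n (\<lambda>i. eps i \<omega>)) c"
abbreviation "remainder2 \<omega> c \<equiv> R2 n e lam (vec1 n (\<lambda>i. eps i \<omega>)) c"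

text \<open>For \<open>c = (1 + u) * c0\<close>, the values
  \<open>linear_moment c0 r \<omega>\<close> are the coefficients of half of
  \<open>remainder1 \<omega> c\<close> as a power series in \<open>- u\<close>.\<close>

definition linear_moment :: "real \<Rightarrow> nat \<Rightarrow> 'w \<Rightarrow> real" where
  "linear_moment c r \<omega> = (\<Sum>j=1..n. (f_coord j / (1 + c * lam j) * (c * lam j / (1 + c * lam j)) ^ r) * Z j \<omega>)"

text \<open>Likewise \<open>remainder2 \<omega> c\<close> is \<open>- (1 + u)\<close> times the
  power series in \<open>- u\<close> with coefficients \<open>square_moment c0 r \<omega>\<close>.
  The exponent is \<open>Suc r\<close> because \<open>R2\<close> already carries one factor
  \<open>c * lam j / (1 + c * lam j)\<close>.\<close>

definition square_moment :: "real \<Rightarrow> nat \<Rightarrow> 'w \<Rightarrow> real" where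
  "square_moment c r \<omega> = (\<Sum>j=1..n. (c * lam j / (1 + c * lam j)) ^ Suc r * ((Z j \<omega>)\<^sup>2 - 1))"

text \<open>The growth \<open>2 ^ r\<close> of the threshold makes the Chebyshev bounds summable
  over \<open>r\<close> and is still weak enough for \<open>geometric_chaining\<close>. The fraction
  \<open>1/20\<close> leaves room for bounding the sum of both remainders by half of the
  risk.\<close>

definition deviation_set :: "real \<Rightarrow> nat \<Rightarrow> 'w set" where
  "deviation_set c r = {\<omega> \<in> space P. 2 ^ r * risk c / 20 < \<bar>linear_moment c r \<omega>\<bar>} \<union>
     {\<omega> \<in> space P. 2 ^ r * risk c / 20 < \<bar>square_moment c r \<omega>\<bar>}"

lemma moment_measurable [measurable]:
  "linear_moment c r \<in> borel_measurable P" "square_moment c r \<in> borel_measurable P"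
  unfolding linear_moment_def[abs_def] square_moment_def[abs_def]
  by (auto intro!: borel_measurable_sum borel_measurable_times borel_measurable_diff borel_measurable_power)

lemma deviation_set_event [measurable]: "deviation_set c r \<in> events"
  unfolding deviation_set_def by measurable

lemma ratio_bounds:
  assumes "0 \<le> c" "j \<in> {1..n}"
  shows "0 \<le> c * lam j / (1 + c * lam j)" "c * lam j / (1 + c * lam j) \<le> 1"
  using mult_nonneg_nonneg[OF assms(1) lam_nonneg[OF assms(2)]] by auto

text \<open>The second moments of the linear and the square moment are at most \<open>bias c\<close>
  and \<open>4 * vari c\<close>, hence at most \<open>risk c\<close> and \<open>4 * risk c\<close>.
  Division by the squared threshold \<open>4 ^ r * (risk c)\<^sup>2 / 400\<close> gives the factor
  \<open>5 * 400 = 2000\<close>.\<close>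

lemma prob_deviation_set:
  assumes c: "0 \<le> c" and pos: "0 < vari c"
  shows "prob (deviation_set c r) \<le> 2000 / vari c * (1/4) ^ r"
proof -
  define d where "d = risk c"
  have d: "0 < d" "bias c \<le> d" "vari c \<le> d"
    using pos bias_nonneg[OF c] by (auto simp: d_def D_def)
  have t: "0 < 2 ^ r * d / 20" using d by simp
  let ?v = "\<lambda>j. c * lam j / (1 + c * lam j)"
  have v1: "(?v j ^ k)\<^sup>2 \<le> 1" if "j \<in> {1..n}" for j k
    using ratio_bounds[OF c that] by (intro power_le_one zero_le_power) auto
  have "prob {\<omega> \<in> space P. 2 ^ r * d / 20 < \<bar>linear_moment c r \<omega>\<bar>}
      \<le> (1 * (\<Sum>j=1..n. (f_coord j / (1 + c * lam j) * ?v j ^ r)\<^sup>2)) / (2 ^ r * d / 20)\<^sup>2"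
    by (rule prob_abs_gt_le_second_moment[OF _ moment_measurable(1) t])
       (unfold linear_moment_def, intro orthogonal_sum_second_moment Z_orthonormal, auto)
  also have "\<dots> \<le> d / (2 ^ r * d / 20)\<^sup>2"
  proof (rule divide_right_mono)
    have "(f_coord j / (1 + c * lam j) * ?v j ^ r)\<^sup>2 \<le> (f_coord j)\<^sup>2 / (1 + c * lam j)" if j: "j \<in> {1..n}" for j
    proof -
      have l: "0 \<le> c * lam j" using c lam_nonneg[OF j] by simp
      have "(f_coord j / (1 + c * lam j) * ?v j ^ r)\<^sup>2 = (f_coord j / (1 + c * lam j))\<^sup>2 * (?v j ^ r)\<^sup>2"
        by (simp only: power_mult_distrib)
      also have "\<dots> \<le> (f_coord j / (1 + c * lam j))\<^sup>2 * 1"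
        by (intro mult_left_mono v1 j) auto
      also have "\<dots> = (f_coord j)\<^sup>2 / (1 + c * lam j)\<^sup>2" by (simp add: power_divide)
      also have "\<dots> \<le> (f_coord j)\<^sup>2 / (1 + c * lam j)"
        using l by (intro divide_left_mono self_le_power) (auto intro!: mult_pos_pos zero_less_power add_pos_nonneg)
      finally show ?thesis .
    qed
    then have "(\<Sum>j=1..n. (f_coord j / (1 + c * lam j) * ?v j ^ r)\<^sup>2) \<le> bias c"
      unfolding D1_def by (rule sum_mono)
    then show "1 * (\<Sum>j=1..n. (f_coord j / (1 + c * lam j) * ?v j ^ r)\<^sup>2) \<le> d"
      using d by simp
  qed auto
  finally have 1: "prob {\<omega> \<in> space P. 2 ^ r * d / 20 < \<bar>linear_moment c r \<omega>\<bar>} \<le> d / (2 ^ r * d / 20)\<^sup>2" .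
  have "prob {\<omega> \<in> space P. 2 ^ r * d / 20 < \<bar>square_moment c r \<omega>\<bar>}
      \<le> (2 * (\<Sum>j=1..n. (?v j ^ Suc r)\<^sup>2)) / (2 ^ r * d / 20)\<^sup>2"
    by (rule prob_abs_gt_le_second_moment[OF _ moment_measurable(2) t])
       (unfold square_moment_def, intro orthogonal_sum_second_moment Z_square_orthogonal, auto)
  also have "\<dots> \<le> (4 * d) / (2 ^ r * d / 20)\<^sup>2"
  proof (rule divide_right_mono)
    have "(?v j ^ Suc r)\<^sup>2 \<le> 2 * psi (c * lam j)" if j: "j \<in> {1..n}" for j
    proof -
      have "(?v j ^ Suc r)\<^sup>2 = (?v j)\<^sup>2 * (?v j ^ r)\<^sup>2" by (simp only: power_Suc power_mult_distrib)
      also have "\<dots> \<le> (?v j)\<^sup>2 * 1" by (intro mult_left_mono v1 j) auto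
      also have "\<dots> \<le> 2 * psi (c * lam j)" using psi_ge_square[of "c * lam j"] c lam_nonneg[OF j] by simp
      finally show ?thesis .
    qed
    then have "(\<Sum>j=1..n. (?v j ^ Suc r)\<^sup>2) \<le> 2 * vari c"
      unfolding D2_eq_sum_psi sum_distrib_left by (rule sum_mono)
    then show "2 * (\<Sum>j=1..n. (?v j ^ Suc r)\<^sup>2) \<le> 4 * d" using d by simp
  qed auto
  finally have 2: "prob {\<omega> \<in> space P. 2 ^ r * d / 20 < \<bar>square_moment c r \<omega>\<bar>} \<le> (4 * d) / (2 ^ r * d / 20)\<^sup>2" .
  have "prob (deviation_set c r) \<le> d / (2 ^ r * d / 20)\<^sup>2 + (4 * d) / (2 ^ r * d / 20)\<^sup>2"
    unfolding deviation_set_def d_def[symmetric]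
    using 1 2 by (intro order_trans[OF measure_Un_le] add_mono) auto
  also have "\<dots> = 2000 * (1/4) ^ r / d"
  proof -
    have "(2 ^ r * d / 20)\<^sup>2 = 4 ^ r * d\<^sup>2 / 400"
      by (simp add: power_mult_distrib power_divide power2_eq_square power_mult_distrib[symmetric])
    then show ?thesis using d by (simp add: power2_eq_square field_simps power_one_over)
  qed
  also have "\<dots> \<le> 2000 * (1/4) ^ r / vari c"
    using d pos by (intro divide_left_mono) auto
  finally show ?thesis by simp
qed

text \<open>Off the deviation sets at \<open>c0\<close>, chaining bounds the two remainders by
  \<open>risk c0 / 5\<close> and \<open>risk c0 / 8\<close>. Passing from \<open>risk c0\<close> to
  \<open>risk c\<close> costs a factor \<open>5/4\<close>, and \<open>(1/5 + 1/8) * 5/4\<close> is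
  below \<open>1/2\<close>.\<close>

lemma remainders_le_half_risk:
  assumes c0: "0 < c0" and c: "c0 \<le> c" "c \<le> 5/4 * c0" and \<omega>: "\<omega> \<in> space P"
    and good: "\<And>r. \<omega> \<notin> deviation_set c0 r"
  shows "\<bar>remainder1 \<omega> c\<bar> + \<bar>remainder2 \<omega> c\<bar> \<le> risk c / 2"
proof -
  define u where "u = c / c0 - 1"
  have u: "0 \<le> u" "u \<le> 1/4" "c = (1 + u) * c0"
    using c0 c by (auto simp: u_def field_simps)
  define v where "v j = c0 * lam j / (1 + c0 * lam j)" for j
  have v: "0 \<le> v j" "v j \<le> 1" if "j \<in> {1..n}" for j
    using ratio_bounds[of c0 j] that c0 by (auto simp: v_def)
  \<comment> \<open>This factorization isolates the dependence on \<open>u\<close> in the form that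
    \<open>geometric_chaining\<close> treats.\<close>
  have split: "1 + c * lam j = (1 + c0 * lam j) * (1 + u * v j)" "0 < 1 + c0 * lam j" if "j \<in> {1..n}" for j
  proof -
    show "0 < 1 + c0 * lam j" using c0 lam_nonneg[OF that] by (auto intro!: add_pos_nonneg)
    then show "1 + c * lam j = (1 + c0 * lam j) * (1 + u * v j)"
      by (simp add: v_def u(3) field_simps)
  qed
  have lin: "\<bar>linear_moment c0 r \<omega>\<bar> \<le> 2 ^ r * (risk c0 / 20)"
    and sq: "\<bar>square_moment c0 r \<omega>\<bar> \<le> 2 ^ r * (risk c0 / 20)" for r
    using good[of r] \<omega> by (auto simp: deviation_set_def not_less)
  have "\<bar>\<Sum>j\<in>{1..n}. (Z j \<omega> * f_coord j / (1 + c0 * lam j)) / (1 + u * v j)\<bar> \<le> 2 * (risk c0 / 20)"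
    using lin by (intro geometric_chaining v u) (auto simp: linear_moment_def v_def mult_ac)
  moreover have "remainder1 \<omega> c = 2 * (\<Sum>j\<in>{1..n}. (Z j \<omega> * f_coord j / (1 + c0 * lam j)) / (1 + u * v j))"
    unfolding R1_def by (intro arg_cong[where f="\<lambda>x. 2 * x"] sum.cong) (auto simp: split Z_def)
  ultimately have 1: "\<bar>remainder1 \<omega> c\<bar> \<le> risk c0 / 5" by simp
  have "\<bar>\<Sum>j\<in>{1..n}. (((Z j \<omega>)\<^sup>2 - 1) * v j) / (1 + u * v j)\<bar> \<le> 2 * (risk c0 / 20)"
    using sq by (intro geometric_chaining v u) (auto simp: square_moment_def v_def mult_ac)
  then have "(1 + u) * \<bar>\<Sum>j\<in>{1..n}. (((Z j \<omega>)\<^sup>2 - 1) * v j) / (1 + u * v j)\<bar> \<le> (5/4) * (2 * (risk c0 / 20))"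
    using u by (intro mult_mono) auto
  moreover have "remainder2 \<omega> c = - ((1 + u) * (\<Sum>j\<in>{1..n}. (((Z j \<omega>)\<^sup>2 - 1) * v j) / (1 + u * v j)))"
    unfolding R2_def sum_distrib_left
  proof (intro arg_cong[where f=uminus] sum.cong refl)
    fix j assume j: "j \<in> {1..n}"
    have "((Z j \<omega>)\<^sup>2 - 1) * c * lam j / (1 + c * lam j) =
        ((Z j \<omega>)\<^sup>2 - 1) * ((1 + u) * c0) * lam j / ((1 + c0 * lam j) * (1 + u * v j))"
      unfolding split(1)[OF j] using u(3) by simp
    also have "\<dots> = (1 + u) * ((((Z j \<omega>)\<^sup>2 - 1) * v j) / (1 + u * v j))"
      by (simp add: v_def[of j] mult_ac)
    finally show "((scalar_prod (vec1 n (\<lambda>i. eps i \<omega>)) (e j))\<^sup>2 - 1) * c * lam j / (1 + c * lam j) =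
        (1 + u) * ((((Z j \<omega>)\<^sup>2 - 1) * v j) / (1 + u * v j))"
      by (simp add: Z_def)
  qed
  ultimately have 2: "\<bar>remainder2 \<omega> c\<bar> \<le> risk c0 / 8"
    using u by (simp add: abs_mult)
  have "bias c0 \<le> (1 + u) * bias c" using bias_le_mult[of c0 "1 + u"] c0 u by simp
  also have "\<dots> \<le> 5/4 * bias c" using u bias_nonneg[of c] c0 c by (intro mult_right_mono) auto
  finally have "bias c0 \<le> 5/4 * bias c" .
  moreover have "vari c0 \<le> vari c" "0 \<le> vari c" "0 \<le> bias c"
    using vari_mono[of c0 c] vari_nonneg[of c] bias_nonneg[of c] c0 c by auto
  ultimately have "risk c0 \<le> 5/4 * risk c" "0 \<le> risk c" by (auto simp: D_def)
  with 1 2 show ?thesis by linarith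
qed

text \<open>The bad event is the union of all deviation sets at the grid points
  \<open>a * (5/4) ^ k\<close> up to \<open>b\<close>. The sum over \<open>r\<close> costs
  \<open>4/3\<close>, and \<open>2000 * 4/3 \<le> 3000\<close>. The sum over \<open>k\<close> is
  geometric with ratio \<open>(4/5) powr \<beta>\<close>, because the variance function grows at
  least at that rate along the grid.\<close>

lemma uniform_remainder_bound:
  assumes a: "0 < a" and B: "1 \<le> B" and \<beta>: "0 < \<beta>"
    and var: "\<And>c k. a \<le> c \<Longrightarrow> c \<le> b \<Longrightarrow> 0 < k \<Longrightarrow> k < 1 \<Longrightarrow> a \<le> k * c \<Longrightarrow>
        vari (k * c) \<le> B * k powr \<beta> * vari c"
    and pos: "0 < vari a"
  shows "\<exists>bad\<in>events. prob bad \<le> 3000 * B / (1 - (4/5) powr \<beta>) / vari a \<and>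
    (\<forall>\<omega>\<in>space P - bad. \<forall>c\<in>{a..b}. \<bar>remainder1 \<omega> c\<bar> + \<bar>remainder2 \<omega> c\<bar> \<le> risk c / 2)"
proof -
  define g where "g k = a * (5/4) ^ k" for k :: nat
  define A where "A k = (if g k \<le> b then (\<Union>r. deviation_set (g k) r) else {})" for k
  define \<rho> where "\<rho> = (4/5 :: real) powr \<beta>"
  have \<rho>: "0 < \<rho>" "\<rho> < 1"
    using \<beta> powr_less_mono2[of \<beta> "4/5" "1::real"] by (auto simp: \<rho>_def)
  have ga: "a \<le> g k" for k
    using a by (simp add: g_def)
  have Aev: "A k \<in> events" for k by (auto simp: A_def)
  have 1: "(\<Union>k. A k) \<in> events" using Aev by auto
  have Ak: "prob (A k) \<le> 3000 * B / vari a * \<rho> ^ k" for k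
  proof (cases "g k \<le> b")
    case True
    \<comment> \<open>The hypothesis on \<open>vari\<close> is applied at \<open>g k\<close> with
      the factor \<open>(4/5) ^ k\<close>, which leads back to \<open>a\<close>. It demands a factor
      below 1, so \<open>k = 0\<close> is separate and rests on \<open>1 \<le> B\<close>.\<close>
    have *: "vari a \<le> B * \<rho> ^ k * vari (g k)"
    proof (cases "k = 0")
      case True
      then show ?thesis using B pos mult_right_mono[of 1 B "vari a"] by (simp add: g_def)
    next
      case False
      have "(4/5 :: real) ^ k * g k = a"
        by (simp add: g_def power_mult_distrib[symmetric])
      moreover have "(4/5 :: real) ^ k < 1" using False by (simp add: power_less_one_iff)
      ultimately have "vari a \<le> B * ((4/5) ^ k) powr \<beta> * vari (g k)"
        using var[of "g k" "(4/5) ^ k"] ga[of k] True by simp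
      moreover have "((4/5 :: real) ^ k) powr \<beta> = \<rho> ^ k"
        by (simp add: \<rho>_def powr_realpow[symmetric] powr_powr powr_power mult.commute)
      ultimately show ?thesis by simp
    qed
    have gk: "0 < vari (g k)" using pos vari_mono[of a "g k"] ga[of k] a by simp
    have "prob (\<Union>r. deviation_set (g k) r) \<le> 2000 / vari (g k) * (4/3)"
      using a ga[of k] gk
      by (intro prob_countable_union_le[where g="\<lambda>r. 2000 / vari (g k) * (1/4) ^ r"] prob_deviation_set sums_mult)
         (use geometric_sums[of "1/4 :: real"] in auto)
    also have "\<dots> \<le> 3000 / vari (g k)" using gk by (simp add: field_simps)
    also have "\<dots> \<le> 3000 * B / vari a * \<rho> ^ k"
      using * gk pos by (simp add: field_simps)
    finally show ?thesis using True by (simp add: A_def)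
  next
    case False
    then show ?thesis using B pos \<rho> by (simp add: A_def)
  qed
  have "prob (\<Union>k. A k) \<le> 3000 * B / vari a * (1 / (1 - \<rho>))"
    using \<rho> by (intro prob_countable_union_le[OF Aev Ak] sums_mult geometric_sums) auto
  then have 2: "prob (\<Union>k. A k) \<le> 3000 * B / (1 - (4/5) powr \<beta>) / vari a"
    by (simp add: \<rho>_def mult_ac)
  have 3: "\<bar>remainder1 \<omega> c\<bar> + \<bar>remainder2 \<omega> c\<bar> \<le> risk c / 2"
    if \<omega>: "\<omega> \<in> space P - (\<Union>k. A k)" and c': "c \<in> {a..b}" for \<omega> c
  proof -
    have c: "a \<le> c" "c \<le> b" using c' by auto
    \<comment> \<open>The index of the last grid point not exceeding \<open>c\<close>.\<close>
    define k where "k = nat \<lfloor>log (5/4) (c / a)\<rfloor>"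
    have ca: "1 \<le> c / a" using a c by simp
    then have "real k \<le> log (5/4) (c / a)" "log (5/4) (c / a) < real k + 1"
      by (auto simp: k_def)
    then have "(5/4) powr real k \<le> c / a" "c / a < (5/4) powr (real k + 1)"
      using ca by (auto simp: le_log_iff log_less_iff)
    then have gk: "g k \<le> c" "c \<le> 5/4 * g k"
      using a by (auto simp: g_def powr_realpow powr_add field_simps)
    then show ?thesis
      using \<omega> c a ga[of k] by (intro remainders_le_half_risk[of "g k"]) (auto simp: A_def)
  qed
  show ?thesis using 1 2 3 by blast
qed

end

section \<open>The posterior distribution\<close>

lemma prob_space_normalized_density:
  assumes [measurable]: "g \<in> borel_measurable lborel"
    and G: "G = (\<integral>\<^sup>+ c. g c \<partial>lborel)" "0 < G" "G < \<infinity>"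
  shows "prob_space (density lborel (\<lambda>c. g c / G))"
proof
  have "emeasure (density lborel (\<lambda>c. g c / G)) (space (density lborel (\<lambda>c. g c / G))) =
      (\<integral>\<^sup>+ c. g c / G \<partial>lborel)"
    by (subst emeasure_density) auto
  also have "\<dots> = G / G" by (subst nn_integral_divide) (auto simp: G(1))
  also have "\<dots> = 1" using G by (intro ennreal_divide_self) auto
  finally show "emeasure (density lborel (\<lambda>c. g c / G)) (space (density lborel (\<lambda>c. g c / G))) = 1" .
qed

text \<open>The complement of \<open>A\<close> has as its mass the quotient of its integral by the
  total integral, hence at most \<open>w / z\<close>. Any factor free of \<open>c\<close> cancels in
  this quotient.\<close>

lemma normalized_density_lower_bound:
  fixes g :: "real \<Rightarrow> real"
  assumes g [measurable]: "g \<in> borel_measurable lborel" and A [measurable]: "A \<in> sets borel"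
    and fin: "(\<integral>\<^sup>+ c. ennreal (g c) \<partial>lborel) < \<infinity>"
    and den: "ennreal z \<le> (\<integral>\<^sup>+ c. ennreal (g c) \<partial>lborel)" "0 < z"
    and num: "(\<integral>\<^sup>+ c. ennreal (g c) * indicator (- A) c \<partial>lborel) \<le> ennreal w" "0 \<le> w"
  defines "Q \<equiv> density lborel (\<lambda>c. ennreal (g c) / (\<integral>\<^sup>+ c'. ennreal (g c') \<partial>lborel))"
  shows "prob_space Q" "1 - w / z \<le> measure Q A"
proof -
  define G where "G = (\<integral>\<^sup>+ c. ennreal (g c) \<partial>lborel)"
  have "0 < ennreal z" using den(2) by simp
  also have "\<dots> \<le> G" using den(1) by (simp add: G_def)
  finally have G: "0 < G" "G < \<infinity>" using fin by (auto simp: G_def)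
  show Q: "prob_space Q"
    unfolding Q_def G_def[symmetric] by (rule prob_space_normalized_density) (use G in \<open>auto simp: G_def\<close>)
  interpret Q: prob_space Q by fact
  have "emeasure Q (- A) = (\<integral>\<^sup>+ c. ennreal (g c) / G * indicator (- A) c \<partial>lborel)"
    unfolding Q_def G_def[symmetric] by (rule emeasure_density) auto
  also have "\<dots> = (\<integral>\<^sup>+ c. ennreal (g c) * indicator (- A) c / G \<partial>lborel)"
    by (simp add: ennreal_times_divide mult.commute)
  also have "\<dots> = (\<integral>\<^sup>+ c. ennreal (g c) * indicator (- A) c \<partial>lborel) / G"
    by (rule nn_integral_divide) auto
  also have "\<dots> \<le> ennreal w / G"
    using num(1) by (rule divide_right_mono_ennreal)
  also have "\<dots> \<le> ennreal w / ennreal z"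
  proof -
    obtain y where y: "G = ennreal y" "0 \<le> y"
      using G(2) by (cases G) auto
    have "z \<le> y" using den y by (simp add: G_def[symmetric])
    then show ?thesis
      using den(2) num(2) y by (simp add: divide_ennreal ennreal_leI divide_left_mono)
  qed
  also have "\<dots> = ennreal (w / z)" using num(2) den(2) by (simp add: divide_ennreal)
  finally have "Q.prob (- A) \<le> w / z"
    using num(2) den(2) by (simp add: Q.emeasure_eq_measure)
  moreover have "Q.prob (- A) = 1 - Q.prob A"
    using Q.prob_compl[of A] by (simp add: Q_def Compl_eq_Diff_UNIV)
  ultimately show "1 - w / z \<le> measure Q A" by simp
qed

section \<open>The posterior in terms of risk and remainders\<close>

context gaussian_model
begin

abbreviation "observation \<omega> \<equiv> fv + vec1 n (\<lambda>i. eps i \<omega>)"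

text \<open>Minus twice the logarithm of \<open>marginal_likelihood\<close>, written in the
  coordinates \<open>f_coord j + Z j \<omega>\<close> of the observation.\<close>

definition likelihood_exponent :: "'w \<Rightarrow> real \<Rightarrow> real" where
  "likelihood_exponent \<omega> c = (\<Sum>j=1..n. ln (1 + c * lam j) + (f_coord j + Z j \<omega>)\<^sup>2 / (1 + c * lam j))"

lemma one_plus_pos: "0 \<le> c \<Longrightarrow> j \<in> {1..n} \<Longrightarrow> 0 < 1 + c * lam j"
  using lam_nonneg by (auto intro!: add_pos_nonneg)

lemma marginal_likelihood_eq:
  assumes c: "0 \<le> c"
  shows "marginal_likelihood n U (observation \<omega>) c = exp (- likelihood_exponent \<omega> c / 2)"
proof -
  have carrier: "observation \<omega> \<in> carrier_vec n" using fv by (auto simp: vec1_def)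
  have coord: "scalar_prod (observation \<omega>) (e j) = f_coord j + Z j \<omega>" if "j \<in> {1..n}" for j
    unfolding Z_def using fv e_carrier[OF that] by (intro add_scalar_prod_distrib[of _ n]) (auto simp: vec1_def)
  have nz: "1 + c * lam j \<noteq> 0" if "j \<in> {1..n}" for j using one_plus_pos[OF c that] by simp
  have quad: "scalar_prod (observation \<omega>) (the (mat_inverse (1\<^sub>m n + c \<cdot>\<^sub>m U)) *\<^sub>v observation \<omega>) =
      (\<Sum>j=1..n. (f_coord j + Z j \<omega>)\<^sup>2 / (1 + c * lam j))"
    using quadratic_form_inverse_shifted[OF nz carrier] coord by simp
  have prod_pos: "0 < (\<Prod>j=1..n. 1 + c * lam j)"
    using one_plus_pos[OF c] by (intro prod_pos) auto
  have "(\<Prod>j=1..n. 1 + c * lam j) powr (- 1 / 2) = exp (- 1 / 2 * ln (\<Prod>j=1..n. 1 + c * lam j))"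
    using prod_pos by (simp only: powr_def order_less_imp_not_eq2 if_False)
  also have "ln (\<Prod>j=1..n. 1 + c * lam j) = (\<Sum>j=1..n. ln (1 + c * lam j))"
    using nz one_plus_pos[OF c] by (intro ln_prod) auto
  finally show ?thesis
    unfolding marginal_likelihood_def Let_def det_shifted quad likelihood_exponent_def
    by (simp add: exp_add[symmetric] sum.distrib field_simps)
qed

text \<open>With \<open>s = 1 + c * lam j\<close>, expand the square and write
  \<open>z\<^sup>2 / s\<close> as
  \<open>z\<^sup>2 - (z\<^sup>2 - 1) * (s - 1) / s - (s - 1) / s\<close> for
  \<open>z = Z j \<omega>\<close>. The sum of the squares of \<open>Z j \<omega>\<close> is free of
  \<open>c\<close> and disappears in the posterior.\<close>

lemma likelihood_exponent_eq:
  assumes c: "0 \<le> c"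
  shows "likelihood_exponent \<omega> c = risk c + remainder1 \<omega> c + remainder2 \<omega> c + (\<Sum>j=1..n. (Z j \<omega>)\<^sup>2)"
proof -
  have "likelihood_exponent \<omega> c =
      (\<Sum>j=1..n. (f_coord j)\<^sup>2 / (1 + c * lam j) + (ln (1 + c * lam j) - c * lam j / (1 + c * lam j))
         + 2 * (Z j \<omega> * f_coord j / (1 + c * lam j)) + - (((Z j \<omega>)\<^sup>2 - 1) * c * lam j / (1 + c * lam j)) + (Z j \<omega>)\<^sup>2)"
    unfolding likelihood_exponent_def
  proof (rule sum.cong)
    fix j assume j: "j \<in> {1..n}"
    define s where "s = 1 + c * lam j"
    have s: "0 < s" "c * lam j = s - 1" using one_plus_pos[OF c j] by (auto simp: s_def)
    have "(f_coord j + Z j \<omega>)\<^sup>2 / s =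
       (f_coord j)\<^sup>2 / s - (s - 1) / s + 2 * (Z j \<omega> * f_coord j / s) + - (((Z j \<omega>)\<^sup>2 - 1) * (s - 1) / s) + (Z j \<omega>)\<^sup>2"
      using s(1) by (simp add: field_simps power2_eq_square)
    then show "ln (1 + c * lam j) + (f_coord j + Z j \<omega>)\<^sup>2 / (1 + c * lam j) =
      (f_coord j)\<^sup>2 / (1 + c * lam j) + (ln (1 + c * lam j) - c * lam j / (1 + c * lam j))
         + 2 * (Z j \<omega> * f_coord j / (1 + c * lam j)) + - (((Z j \<omega>)\<^sup>2 - 1) * c * lam j / (1 + c * lam j)) + (Z j \<omega>)\<^sup>2"
      using s(2) unfolding s_def[symmetric] by (simp add: mult.assoc)
  qed simp
  also have "\<dots> = risk c + remainder1 \<omega> c + remainder2 \<omega> c + (\<Sum>j=1..n. (Z j \<omega>)\<^sup>2)"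
    unfolding D_def D1_def D2_def R1_def R2_def sum.distrib sum_negf sum_distrib_left[symmetric] Z_def by simp
  finally show ?thesis .
qed

definition posterior_weight :: "real \<Rightarrow> real \<Rightarrow> real \<Rightarrow> 'w \<Rightarrow> real \<Rightarrow> real" where
  "posterior_weight \<kappa> l m \<omega> c = exp (- likelihood_exponent \<omega> c / 2) * prior_weight \<kappa> l m n c"

lemma c_interval_nonneg: "c \<in> c_interval m n \<Longrightarrow> 0 \<le> c"
  by (cases "n = 0") (auto simp: c_interval_def intro: order_trans[rotated])

lemma posterior_eq:
  "posterior \<kappa> l m n U (observation \<omega>) = density lborel
     (\<lambda>c. ennreal (posterior_weight \<kappa> l m \<omega> c) / (\<integral>\<^sup>+ c'. ennreal (posterior_weight \<kappa> l m \<omega> c') \<partial>lborel))"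
proof -
  \<comment> \<open>Off the interval both sides vanish through the prior weight; on it
    \<open>c\<close> is nonnegative, so the formula for the likelihood applies.\<close>
  have "marginal_likelihood n U (observation \<omega>) c * prior_weight \<kappa> l m n c = posterior_weight \<kappa> l m \<omega> c" for c
    using c_interval_nonneg[of c m] marginal_likelihood_eq[of c \<omega>]
    by (cases "c \<in> c_interval m n") (auto simp: posterior_weight_def prior_weight_def)
  then show ?thesis by (simp add: posterior_def Let_def)
qed

lemma posterior_weight_measurable_pair:
  "(\<lambda>(\<omega>, c). posterior_weight \<kappa> l m \<omega> c) \<in> borel_measurable (P \<Otimes>\<^sub>M lborel)"
proof -
  have Zp: "(\<lambda>p. Z j (fst p)) \<in> borel_measurable (P \<Otimes>\<^sub>M lborel)" if "j \<in> {1..n}" for j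
    using measurable_compose[OF measurable_fst[of P lborel] Z_measurable[OF that]] by simp
  have "(\<lambda>p. likelihood_exponent (fst p) (snd p)) \<in> borel_measurable (P \<Otimes>\<^sub>M lborel)"
    unfolding likelihood_exponent_def
  proof (rule borel_measurable_sum)
    fix j assume "j \<in> {1..n}"
    note [measurable] = Zp[OF this]
    show "(\<lambda>p. ln (1 + snd p * lam j) + (f_coord j + Z j (fst p))\<^sup>2 / (1 + snd p * lam j)) \<in> borel_measurable (P \<Otimes>\<^sub>M lborel)"
      by measurable
  qed
  note [measurable] = this
  have [measurable]: "c_interval m n \<in> sets borel" by (simp add: c_interval_def)
  show ?thesis unfolding posterior_weight_def prior_weight_def split_beta' by measurable
qed

lemma posterior_weight_measurable:
  assumes "\<omega> \<in> space P"
  shows "posterior_weight \<kappa> l m \<omega> \<in> borel_measurable lborel"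
  using measurable_compose[OF measurable_Pair1'[OF assms] posterior_weight_measurable_pair] by simp

text \<open>Joint measurability of the weight in \<open>\<omega>\<close> and \<open>c\<close> makes
  the integrals over \<open>c\<close> measurable in \<open>\<omega>\<close>. This supplies the
  measurability contained in \<open>tendsto_in_prob\<close>.\<close>

lemma posterior_measurable:
  assumes A: "A \<in> sets borel"
  shows "(\<lambda>\<omega>. measure (posterior \<kappa> l m n U (observation \<omega>)) A) \<in> borel_measurable P"
proof -
  let ?g = "\<lambda>\<omega> c. ennreal (posterior_weight \<kappa> l m \<omega> c)"
  note [measurable] = posterior_weight_measurable_pair A
  have G [measurable]: "(\<lambda>\<omega>. \<integral>\<^sup>+ c. ?g \<omega> c \<partial>lborel) \<in> borel_measurable P"
    by measurable
  have "(\<lambda>\<omega>. \<integral>\<^sup>+ c. ?g \<omega> c / (\<integral>\<^sup>+ c'. ?g \<omega> c' \<partial>lborel) * indicator A c \<partial>lborel) \<in> borel_measurable P"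
    by measurable
  then have "(\<lambda>\<omega>. enn2real (\<integral>\<^sup>+ c. ?g \<omega> c / (\<integral>\<^sup>+ c'. ?g \<omega> c' \<partial>lborel) * indicator A c \<partial>lborel)) \<in> borel_measurable P"
    by measurable
  then show ?thesis
  proof (rule measurable_cong[THEN iffD1, rotated])
    fix \<omega> assume "\<omega> \<in> space P"
    note [measurable] = posterior_weight_measurable[OF this]
    show "enn2real (\<integral>\<^sup>+ c. ?g \<omega> c / (\<integral>\<^sup>+ c'. ?g \<omega> c' \<partial>lborel) * indicator A c \<partial>lborel) =
        measure (posterior \<kappa> l m n U (observation \<omega>)) A"
      unfolding posterior_eq measure_def by (subst emeasure_density) auto
  qed
qed

text \<open>Outside \<open>A\<close> the weight is at most a constant times
  \<open>exp (- M * h / 4)\<close>, where \<open>h\<close> is the penalized risk at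
  \<open>cn\<close>, and on \<open>[cn, 2 * cn]\<close> it is at least a constant times
  \<open>exp (- 3 * h)\<close>. The quotient of the two integral bounds gives the exponential
  factor, and the prior density and interval lengths give the power of
  \<open>2 * b / a\<close>.\<close>

lemma posterior_lower_bound:
  assumes \<omega>: "\<omega> \<in> space P" and I: "c_interval m n = {a..b}" "0 < a"
    and \<kappa>: "0 < \<kappa>" and l: "0 < l"
    and cn: "a \<le> cn" "2 * cn \<le> b"
    and rem: "\<And>c. a \<le> c \<Longrightarrow> c \<le> b \<Longrightarrow> \<bar>remainder1 \<omega> c\<bar> + \<bar>remainder2 \<omega> c\<bar> \<le> risk c / 2"
    and A: "A \<in> sets borel"
    and sub: "\<And>c. a \<le> c \<Longrightarrow> c \<le> b \<Longrightarrow> risk c + 2 * l / c \<le> M * (risk cn + 2 * l / cn) \<Longrightarrow> c \<in> A"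
  shows "1 - (2 * b / a) powr (1 + \<kappa>) * exp (- (M / 4 - 3) * (risk cn + 2 * l / cn))
           \<le> measure (posterior \<kappa> l m n U (observation \<omega>)) A"
    and "measure (posterior \<kappa> l m n U (observation \<omega>)) A \<le> 1"
proof -
  define h where "h = risk cn + 2 * l / cn"
  \<comment> \<open>The factor of the weight that is free of \<open>c\<close>; it cancels in
    \<open>u / z\<close>.\<close>
  define q where "q = exp (- (\<Sum>j=1..n. (Z j \<omega>)\<^sup>2) / 2)"
  have q: "0 < q" by (simp add: q_def)
  let ?g = "posterior_weight \<kappa> l m \<omega>"
  have cn0: "0 < cn" using I cn by simp
  have g_in: "?g c = q * (exp (- (risk c + remainder1 \<omega> c + remainder2 \<omega> c) / 2) * (c powr (- 1 - \<kappa>) * exp (- l / c)))"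
    if "a \<le> c" "c \<le> b" for c
    using that I unfolding posterior_weight_def prior_weight_def q_def
    by (subst likelihood_exponent_eq) (auto simp: exp_add[symmetric] add_divide_distrib diff_divide_distrib)
  have g_out: "?g c = 0" if "\<not> (a \<le> c \<and> c \<le> b)" for c
    using that by (auto simp: posterior_weight_def prior_weight_def I(1))
  have g_upper: "?g c \<le> q * (exp (- (risk c + 2 * l / c) / 4) * a powr (- 1 - \<kappa>))"
    if c: "a \<le> c" "c \<le> b" for c
  proof -
    have c0: "0 < c" using c I by simp
    \<comment> \<open>The remainders take away at most half of \<open>risk c / 2\<close>, and
      \<open>l / c\<close> is halved to match.\<close>
    have "- (risk c + remainder1 \<omega> c + remainder2 \<omega> c) / 2 + - l / c \<le> - (risk c + 2 * l / c) / 4"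
    proof -
      have "0 \<le> l / c" using l c0 by simp
      with rem[OF c] show ?thesis by (simp add: field_simps)
    qed
    then have "exp (- (risk c + remainder1 \<omega> c + remainder2 \<omega> c) / 2) * exp (- l / c) \<le> exp (- (risk c + 2 * l / c) / 4)"
      by (simp add: exp_add[symmetric])
    moreover have "c powr (- 1 - \<kappa>) \<le> a powr (- 1 - \<kappa>)"
      using I c \<kappa> by (intro powr_mono2') auto
    ultimately have "(exp (- (risk c + remainder1 \<omega> c + remainder2 \<omega> c) / 2) * exp (- l / c)) * c powr (- 1 - \<kappa>)
        \<le> exp (- (risk c + 2 * l / c) / 4) * a powr (- 1 - \<kappa>)"
      by (intro mult_mono) auto
    then show ?thesis
      unfolding g_in[OF c] using q by (intro mult_left_mono) (auto simp: mult_ac)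
  qed
  have g_lower: "q * (exp (- 3 * h) * (2 * cn) powr (- 1 - \<kappa>)) \<le> ?g c" if c: "cn \<le> c" "c \<le> 2 * cn" for c
  proof -
    have c': "a \<le> c" "c \<le> b" using c cn by auto
    have "bias c \<le> bias cn" using bias_antimono[of cn c] c cn0 by simp
    moreover have "vari c \<le> 4 * vari cn"
      using vari_mono[of c "2 * cn"] vari_mult_le[of cn 2] c cn0 by simp
    moreover have "l / c \<le> l / cn" using l c cn0 by (intro divide_left_mono) auto
    moreover have "0 \<le> bias cn" "0 \<le> vari cn" "0 \<le> l / cn" using bias_nonneg vari_nonneg cn0 l by auto
    moreover have "2 * l / cn = 2 * (l / cn)" "- l / c = - (l / c)" by simp_all
    \<comment> \<open>The negative of the right side is at most \<open>3/4 * risk c + l / c\<close>,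
      and \<open>risk c \<le> bias cn + 4 * vari cn\<close>. The variance part produces the factor
      3.\<close>
    ultimately have "- 3 * h \<le> - (risk c + remainder1 \<omega> c + remainder2 \<omega> c) / 2 + - l / c"
      using rem[OF c'] abs_ge_self[of "remainder1 \<omega> c"] abs_ge_self[of "remainder2 \<omega> c"]
      unfolding h_def D_def by argo
    then have "exp (- 3 * h) \<le> exp (- (risk c + remainder1 \<omega> c + remainder2 \<omega> c) / 2) * exp (- l / c)"
      by (simp add: exp_add[symmetric])
    moreover have "(2 * cn) powr (- 1 - \<kappa>) \<le> c powr (- 1 - \<kappa>)"
      using c cn0 \<kappa> by (intro powr_mono2') auto
    ultimately have "exp (- 3 * h) * (2 * cn) powr (- 1 - \<kappa>)
       \<le> (exp (- (risk c + remainder1 \<omega> c + remainder2 \<omega> c) / 2) * exp (- l / c)) * c powr (- 1 - \<kappa>)"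
      by (intro mult_mono) auto
    then show ?thesis
      unfolding g_in[OF c'] using q by (intro mult_left_mono) (auto simp: mult_ac)
  qed
  have g_nonneg: "0 \<le> ?g c" for c by (auto simp: posterior_weight_def prior_weight_def)
  have risk_nonneg: "0 \<le> risk c + 2 * l / c" if "0 < c" for c
    using that bias_nonneg[of c] vari_nonneg[of c] l by (simp add: D_def)
  define u where "u = q * (exp (- M * h / 4) * a powr (- 1 - \<kappa>)) * (b - a)"
  define z where "z = q * (exp (- 3 * h) * (2 * cn) powr (- 1 - \<kappa>)) * cn"
  have ab: "0 < b" "0 \<le> b - a" using cn I by auto
  have num: "(\<integral>\<^sup>+ c. ennreal (?g c) * indicator (- A) c \<partial>lborel) \<le> ennreal u"
  proof -
    have "(\<integral>\<^sup>+ c. ennreal (?g c) * indicator (- A) c \<partial>lborel)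
        \<le> (\<integral>\<^sup>+ c. ennreal (q * (exp (- M * h / 4) * a powr (- 1 - \<kappa>))) * indicator {a..b} c \<partial>lborel)"
    proof (rule nn_integral_mono)
      fix c :: real
      show "ennreal (?g c) * indicator (- A) c \<le> ennreal (q * (exp (- M * h / 4) * a powr (- 1 - \<kappa>))) * indicator {a..b} c"
      proof (cases "a \<le> c \<and> c \<le> b \<and> c \<notin> A")
        case True
        then have c: "a \<le> c" "c \<le> b" by auto
        have "\<not> risk c + 2 * l / c \<le> M * h" using sub[of c] True by (auto simp: h_def)
        then have Mh: "M * h \<le> risk c + 2 * l / c" by simp
        have "?g c \<le> q * (exp (- (risk c + 2 * l / c) / 4) * a powr (- 1 - \<kappa>))" by (rule g_upper[OF c])
        also have "\<dots> \<le> q * (exp (- M * h / 4) * a powr (- 1 - \<kappa>))"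
          using q Mh by (intro mult_left_mono mult_right_mono) auto
        finally show ?thesis using True by (simp add: ennreal_leI)
      next
        case False
        then show ?thesis using g_out[of c] by (auto simp: indicator_def)
      qed
    qed
    also have "\<dots> = ennreal (q * (exp (- M * h / 4) * a powr (- 1 - \<kappa>))) * ennreal (b - a)"
      using ab by (subst nn_integral_cmult_indicator) auto
    also have "\<dots> = ennreal u" using q ab by (simp add: u_def ennreal_mult[symmetric])
    finally show ?thesis .
  qed
  have den: "ennreal z \<le> (\<integral>\<^sup>+ c. ennreal (?g c) \<partial>lborel)"
  proof -
    have "ennreal z = ennreal (q * (exp (- 3 * h) * (2 * cn) powr (- 1 - \<kappa>))) * ennreal (2 * cn - cn)"
      using q cn0 by (simp add: z_def ennreal_mult[symmetric])
    also have "\<dots> = (\<integral>\<^sup>+ c. ennreal (q * (exp (- 3 * h) * (2 * cn) powr (- 1 - \<kappa>))) * indicator {cn..2 * cn} c \<partial>lborel)"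
      using cn0 by (subst nn_integral_cmult_indicator) auto
    also have "\<dots> \<le> (\<integral>\<^sup>+ c. ennreal (?g c) \<partial>lborel)"
    proof (rule nn_integral_mono)
      fix c :: real
      show "ennreal (q * (exp (- 3 * h) * (2 * cn) powr (- 1 - \<kappa>))) * indicator {cn..2 * cn} c \<le> ennreal (?g c)"
      proof (cases "c \<in> {cn..2 * cn}")
        case True
        then have "q * (exp (- 3 * h) * (2 * cn) powr (- 1 - \<kappa>)) \<le> ?g c" by (intro g_lower) auto
        then show ?thesis using True by (simp only: indicator_simps mult_1_right ennreal_leI)
      qed simp
    qed
    finally show ?thesis .
  qed
  have fin: "(\<integral>\<^sup>+ c. ennreal (?g c) \<partial>lborel) < \<infinity>"
  proof -
    have "(\<integral>\<^sup>+ c. ennreal (?g c) \<partial>lborel) \<le> (\<integral>\<^sup>+ c. ennreal (q * (1 * a powr (- 1 - \<kappa>))) * indicator {a..b} c \<partial>lborel)"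
    proof (rule nn_integral_mono)
      fix c :: real
      show "ennreal (?g c) \<le> ennreal (q * (1 * a powr (- 1 - \<kappa>))) * indicator {a..b} c"
      proof (cases "a \<le> c \<and> c \<le> b")
        case True
        then have "?g c \<le> q * (exp (- (risk c + 2 * l / c) / 4) * a powr (- 1 - \<kappa>))" by (intro g_upper) auto
        also have "\<dots> \<le> q * (1 * a powr (- 1 - \<kappa>))"
          using q risk_nonneg[of c] True I by (intro mult_left_mono mult_right_mono) auto
        finally show ?thesis using True by (simp add: ennreal_leI)
      next
        case False
        then show ?thesis using g_out[of c] by auto
      qed
    qed
    also have "\<dots> < \<infinity>"
      using ab by (subst nn_integral_cmult_indicator) (auto simp: ennreal_mult_less_top)
    finally show ?thesis .
  qed
  have z: "0 < z" using q cn0 by (simp add: z_def)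
  have u: "0 \<le> u" using q ab by (simp add: u_def)
  note meas = posterior_weight_measurable[OF \<omega>]
  have "u / z \<le> (2 * b / a) powr (1 + \<kappa>) * exp (- (M / 4 - 3) * h)"
  proof -
    have "u / z = exp (- (M / 4 - 3) * h) * (a powr (- 1 - \<kappa>) / (2 * cn) powr (- 1 - \<kappa>)) * ((b - a) / cn)"
    proof -
      have "exp (- (M / 4 - 3) * h) = exp (- M * h / 4) / exp (- 3 * h)"
        unfolding exp_diff[symmetric] by (simp add: field_simps)
      then show ?thesis using q unfolding u_def z_def by simp
    qed
    also have "a powr (- 1 - \<kappa>) / (2 * cn) powr (- 1 - \<kappa>) = (2 * cn / a) powr (1 + \<kappa>)"
      using powr_minus_divide[of a "1 + \<kappa>"] powr_minus_divide[of "2 * cn" "1 + \<kappa>"] I cn0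
      by (simp add: powr_divide)
    also have "exp (- (M / 4 - 3) * h) * (2 * cn / a) powr (1 + \<kappa>) * ((b - a) / cn)
        \<le> exp (- (M / 4 - 3) * h) * (2 * b / a) powr (1 + \<kappa>)"
    proof -
      \<comment> \<open>One factor \<open>cn\<close> cancels against the length of
        \<open>[cn, 2 * cn]\<close>; what is left increases with \<open>cn\<close>, which is at most
        \<open>b\<close>.\<close>
      have "(2 * cn / a) powr (1 + \<kappa>) * ((b - a) / cn) = (2 * cn / a) powr \<kappa> * (2 * (b - a) / a)"
        using I cn0 by (simp add: powr_add field_simps)
      also have "\<dots> \<le> (2 * b / a) powr \<kappa> * (2 * b / a)"
        using I cn cn0 ab \<kappa> by (intro mult_mono powr_mono2 divide_right_mono) auto
      also have "\<dots> = (2 * b / a) powr (1 + \<kappa>)"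
        using I ab by (simp add: powr_add)
      finally show ?thesis unfolding mult.assoc by (rule mult_left_mono) simp
    qed
    finally show ?thesis by (simp add: mult.commute)
  qed
  then show "1 - (2 * b / a) powr (1 + \<kappa>) * exp (- (M / 4 - 3) * (risk cn + 2 * l / cn))
           \<le> measure (posterior \<kappa> l m n U (observation \<omega>)) A"
    using normalized_density_lower_bound(2)[OF meas A fin den z num u]
    unfolding posterior_eq h_def by linarith
  show "measure (posterior \<kappa> l m n U (observation \<omega>)) A \<le> 1"
    using prob_space.prob_le_1[OF normalized_density_lower_bound(1)[OF meas A fin den z num u]]
    unfolding posterior_eq by simp
qed

end

section \<open>Sums over the model eigenvalues\<close>

lemma psi_one_pos: "0 < psi 1"
  using ln_2_less_1 ln2_ge_two_thirds by (simp add: psi_def)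

lemma psi_mult_le_max:
  assumes "0 \<le> x" "0 \<le> K"
  shows "psi (K * x) \<le> (max 1 K)\<^sup>2 * psi x"
proof -
  have "psi (K * x) \<le> psi (max 1 K * x)"
    using assms by (intro psi_mono mult_right_mono) auto
  also have "\<dots> \<le> (max 1 K)\<^sup>2 * psi x" using assms by (intro psi_mult_le) auto
  finally show ?thesis .
qed

text \<open>Indices are split at \<open>x j = 1\<close>. Below 1, \<open>psi\<close> is comparable
  with the square, so it shrinks at least by \<open>k powr s\<close> up to a constant. Above 1,
  \<open>psi (k * x j)\<close> is at most \<open>(k * x j) powr s / s\<close>; the hypothesis bounds
  the sum of these by the number of large indices, each of which contributes at least
  \<open>psi 1\<close> to the right side.\<close>

lemma sum_psi_scaling:
  fixes x :: "'i \<Rightarrow> real" and C :: real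
  assumes J: "finite J" and x: "\<And>j. j \<in> J \<Longrightarrow> 0 < x j" and s: "0 < s" "s \<le> 1" and k: "0 < k" "k \<le> 1"
    and C: "(\<Sum>j\<in>{j\<in>J. 1 \<le> x j}. x j powr s) \<le> C * card {j\<in>J. 1 \<le> x j}" "0 \<le> C"
  shows "(\<Sum>j\<in>J. psi (k * x j)) \<le> (8 + C / (s * psi 1)) * k powr s * (\<Sum>j\<in>J. psi (x j))"
proof -
  let ?L = "{j\<in>J. 1 \<le> x j}" and ?S = "{j\<in>J. \<not> 1 \<le> x j}"
  have split: "(\<Sum>j\<in>J. g j) = (\<Sum>j\<in>?L. g j) + (\<Sum>j\<in>?S. g j)" for g :: "'i \<Rightarrow> real"
    using sum.Int_Diff[OF J, of g "{j. 1 \<le> x j}"] by (simp add: Int_def set_diff_eq)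
  have nn: "0 \<le> psi (x j)" if "j \<in> J" for j using x[OF that] by (simp add: psi_nonneg)
  have "(\<Sum>j\<in>?S. psi (k * x j)) \<le> (\<Sum>j\<in>?S. 8 * k powr s * psi (x j))"
  proof (rule sum_mono)
    fix j assume j: "j \<in> ?S"
    then have xj: "0 < x j" "x j < 1" using x by auto
    have "(x j / 2)\<^sup>2 \<le> (x j / (1 + x j))\<^sup>2"
      using xj by (intro power_mono divide_left_mono) auto
    also have "\<dots> \<le> 2 * psi (x j)" using psi_ge_square[of "x j"] xj by simp
    finally have sq: "(x j)\<^sup>2 \<le> 8 * psi (x j)" by (simp add: power_divide)
    have "psi (k * x j) \<le> (k * x j)\<^sup>2" using xj k by (intro psi_le_square) auto
    also have "\<dots> = k powr 2 * (x j)\<^sup>2" using k by (simp add: power_mult_distrib powr_numeral)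
    also have "\<dots> \<le> k powr s * (8 * psi (x j))"
      using k s sq by (intro mult_mono powr_mono') auto
    finally show "psi (k * x j) \<le> 8 * k powr s * psi (x j)" by simp
  qed
  then have small: "(\<Sum>j\<in>?S. psi (k * x j)) \<le> 8 * k powr s * (\<Sum>j\<in>?S. psi (x j))"
    by (simp add: sum_distrib_left)
  have "(\<Sum>j\<in>?L. psi (k * x j)) \<le> (\<Sum>j\<in>?L. k powr s / s * x j powr s)"
  proof (rule sum_mono)
    fix j assume "j \<in> ?L"
    then have xj: "1 \<le> x j" by simp
    have "psi (k * x j) \<le> (k * x j) powr s / s" using xj k s by (intro psi_le_powr) auto
    then show "psi (k * x j) \<le> k powr s / s * x j powr s" using k xj by (simp add: powr_mult)
  qed
  also have "\<dots> = k powr s / s * (\<Sum>j\<in>?L. x j powr s)" by (simp add: sum_distrib_left)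
  also have "\<dots> \<le> k powr s / s * (C * card ?L)"
    using k s by (intro mult_left_mono C) auto
  also have "\<dots> = C / (s * psi 1) * k powr s * (\<Sum>j\<in>?L. psi 1)"
    using s psi_one_pos by (simp add: field_simps)
  also have "\<dots> \<le> C / (s * psi 1) * k powr s * (\<Sum>j\<in>?L. psi (x j))"
    using s C psi_one_pos by (intro mult_left_mono sum_mono psi_mono) auto
  finally have large: "(\<Sum>j\<in>?L. psi (k * x j)) \<le> C / (s * psi 1) * k powr s * (\<Sum>j\<in>?L. psi (x j))" .
  have "0 \<le> 8 * k powr s * (\<Sum>j\<in>?L. psi (x j))" "0 \<le> C / (s * psi 1) * k powr s * (\<Sum>j\<in>?S. psi (x j))"
    using nn s C psi_one_pos by (auto intro!: mult_nonneg_nonneg sum_nonneg simp del: times_divide_eq_left)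
  with small large show ?thesis
    unfolding split by (simp add: algebra_simps)
qed

text \<open>The pure powers \<open>x j = c * N / w j powr m\<close> are treated first, with exponent
  \<open>1 / (2 * m)\<close>, for which the powers of the large \<open>x j\<close> become the square
  roots in the counting hypothesis. Replacing \<open>lam j\<close> by \<open>N / w j powr m\<close>
  costs a constant on each side.\<close>

lemma sum_psi_scaling_model:
  fixes w lam :: "'i \<Rightarrow> real" and C :: real
  assumes J: "finite J" and w: "\<And>j. j \<in> J \<Longrightarrow> 1 \<le> w j" and d: "0 < d" "d \<le> d'" and m: "1 \<le> m"
    and lam: "\<And>j. j \<in> J \<Longrightarrow> d * N / w j powr m \<le> lam j" "\<And>j. j \<in> J \<Longrightarrow> lam j \<le> d' * N / w j powr m"
    and count: "\<And>t. 0 < t \<Longrightarrow> t \<le> N \<Longrightarrow>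
      (\<Sum>j\<in>{j\<in>J. w j \<le> t}. sqrt (t / w j)) \<le> C * card {j\<in>J. w j \<le> t}" and C: "0 \<le> C"
    and N: "0 < N" and c: "0 < c" "c \<le> N powr (m - 1)" and k: "0 < k" "k \<le> 1"
  shows "(\<Sum>j\<in>J. psi (k * c * lam j)) \<le>
    (max 1 d')\<^sup>2 * (8 + C / (1 / (2 * m) * psi 1)) * (max 1 (1 / d))\<^sup>2 * k powr (1 / (2 * m)) * (\<Sum>j\<in>J. psi (c * lam j))"
proof -
  define x where "x j = c * (N / w j powr m)" for j
  \<comment> \<open>The level of \<open>w\<close> at which \<open>x j\<close> equals 1.\<close>
  define t where "t = (c * N) powr (1 / m)"
  have t0: "0 < t" using c N by (simp add: t_def)
  \<comment> \<open>The upper end of the range of \<open>c\<close> is what places \<open>t\<close>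
    in the range \<open>t \<le> N\<close> of the counting hypothesis.\<close>
  have "c * N \<le> N powr (m - 1) * N powr 1" using c N by (intro mult_mono) auto
  also have "\<dots> = N powr m" by (simp only: powr_add[symmetric]) simp
  finally have "t \<le> (N powr m) powr (1 / m)" unfolding t_def using c N m by (intro powr_mono2) auto
  also have "\<dots> = N" using N m by (simp add: powr_powr)
  finally have tN: "t \<le> N" .
  have xt: "x j = (t / w j) powr m" if "j \<in> J" for j
    using w[OF that] t0 c N m by (simp add: x_def t_def powr_divide powr_powr)
  have x0: "0 < x j" if "j \<in> J" for j
    using w[OF that] c N by (auto simp: x_def)
  have ge1: "1 \<le> x j \<longleftrightarrow> w j \<le> t" if "j \<in> J" for j
  proof -
    have "1 \<le> x j \<longleftrightarrow> 1 powr m \<le> (t / w j) powr m" using xt[OF that] by simp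
    also have "\<dots> \<longleftrightarrow> 1 \<le> t / w j"
      using m t0 w[OF that] powr_mono2[of m 1 "t / w j"] powr_less_mono2[of m "t / w j" 1]
      by (cases "1 \<le> t / w j") auto
    finally show ?thesis using w[OF that] by (simp add: le_divide_eq)
  qed
  have eqset: "{j\<in>J. 1 \<le> x j} = {j\<in>J. w j \<le> t}" using ge1 by auto
  have root: "x j powr (1 / (2 * m)) = sqrt (t / w j)" if "j \<in> J" for j
    using xt[OF that] t0 w[OF that] m by (simp add: powr_powr powr_half_sqrt[symmetric])
  have sums: "(\<Sum>j\<in>{j\<in>J. 1 \<le> x j}. x j powr (1 / (2 * m))) \<le> C * card {j\<in>J. 1 \<le> x j}"
    unfolding eqset using count[OF t0 tN] root by simp
  have s: "0 < 1 / (2 * m)" "1 / (2 * m) \<le> 1" using m by auto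
  have up: "psi (k * c * lam j) \<le> (max 1 d')\<^sup>2 * psi (k * x j)"
    and low: "psi (x j) \<le> (max 1 (1 / d))\<^sup>2 * psi (c * lam j)" if j: "j \<in> J" for j
  proof -
    have l0: "0 < lam j" using lam(1)[OF j] d N w[OF j]
      by (auto elim!: less_le_trans[rotated])
    have "psi (k * c * lam j) \<le> psi (d' * (k * x j))"
    proof (rule psi_mono)
      have "k * c * lam j \<le> k * c * (d' * N / w j powr m)" using k c by (intro mult_left_mono lam j) auto
      then show "k * c * lam j \<le> d' * (k * x j)" by (simp add: x_def mult_ac)
    qed (use l0 k c in auto)
    also have "\<dots> \<le> (max 1 d')\<^sup>2 * psi (k * x j)"
      using k x0[OF j] d by (intro psi_mult_le_max) auto
    finally show "psi (k * c * lam j) \<le> (max 1 d')\<^sup>2 * psi (k * x j)" .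
    have "psi (x j) \<le> psi (1 / d * (c * lam j))"
    proof (rule psi_mono)
      have "1 / d * (c * (d * N / w j powr m)) \<le> 1 / d * (c * lam j)"
        using c d by (intro mult_left_mono lam j) auto
      then show "x j \<le> 1 / d * (c * lam j)" using d by (simp add: x_def)
    qed (use x0[OF j] in auto)
    also have "\<dots> \<le> (max 1 (1 / d))\<^sup>2 * psi (c * lam j)"
      using c l0 d by (intro psi_mult_le_max) auto
    finally show "psi (x j) \<le> (max 1 (1 / d))\<^sup>2 * psi (c * lam j)" .
  qed
  let ?s = "1 / (2 * m)" and ?B = "8 + C / (1 / (2 * m) * psi 1)"
  have B: "0 \<le> ?B" using C m psi_one_pos by (intro add_nonneg_nonneg divide_nonneg_nonneg) auto
  have "(\<Sum>j\<in>J. psi (k * c * lam j)) \<le> (max 1 d')\<^sup>2 * (\<Sum>j\<in>J. psi (k * x j))"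
    unfolding sum_distrib_left by (intro sum_mono up)
  also have "\<dots> \<le> (max 1 d')\<^sup>2 * (?B * k powr ?s * (\<Sum>j\<in>J. psi (x j)))"
    by (intro mult_left_mono sum_psi_scaling J x0 s k sums C) auto
  also have "\<dots> \<le> (max 1 d')\<^sup>2 * (?B * k powr ?s * ((max 1 (1 / d))\<^sup>2 * (\<Sum>j\<in>J. psi (c * lam j))))"
    using B unfolding sum_distrib_left[where r="(max 1 (1 / d))\<^sup>2"]
    by (intro mult_left_mono sum_mono low mult_nonneg_nonneg) auto
  finally show ?thesis by (simp only: mult_ac)
qed

section \<open>Counting indices of weight below a level\<close>

lemma card_interval_le:
  assumes "0 \<le> T" "T \<le> real n"
  shows "{j\<in>{1..n}. real j \<le> T} = {1..nat \<lfloor>T\<rfloor>}" "card {j\<in>{1..n}. real j \<le> T} = nat \<lfloor>T\<rfloor>"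
proof -
  show "{j\<in>{1..n}. real j \<le> T} = {1..nat \<lfloor>T\<rfloor>}"
    using assms by (auto simp: le_nat_iff le_floor_iff)
  then show "card {j\<in>{1..n}. real j \<le> T} = nat \<lfloor>T\<rfloor>" by simp
qed

text \<open>Each term is at most twice the increment of the square root, and the increments
  telescope.\<close>

lemma sum_inverse_sqrt_le: "(\<Sum>j=1..q. 1 / sqrt (real j)) \<le> 2 * sqrt (real q)"
proof (induction q)
  case (Suc q)
  have "1 / sqrt (real (Suc q)) \<le> 2 * (sqrt (real (Suc q)) - sqrt (real q))"
  proof -
    let ?a = "sqrt (real (Suc q))" and ?b = "sqrt (real q)"
    have a: "0 < ?a" "?b \<le> ?a" "0 \<le> ?b" by auto
    have "1 = (?a - ?b) * (?a + ?b)"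
      by (simp add: algebra_simps)
    also have "\<dots> \<le> (?a - ?b) * (2 * ?a)"
      using a by (intro mult_left_mono) auto
    also have "\<dots> = 2 * (?a - ?b) * ?a" by (simp only: mult_ac)
    finally have "1 \<le> 2 * (?a - ?b) * ?a" .
    then show ?thesis using a by (simp add: divide_le_eq)
  qed
  with Suc show ?case by simp
qed simp

lemma sum_sqrt_quotient_le:
  assumes "0 \<le> T"
  shows "(\<Sum>j=1..q. sqrt (T / real j)) \<le> 2 * sqrt T * sqrt (real q)"
proof -
  have "(\<Sum>j=1..q. sqrt (T / real j)) = sqrt T * (\<Sum>j=1..q. 1 / sqrt (real j))"
    by (simp add: sum_distrib_left real_sqrt_divide)
  also have "\<dots> \<le> sqrt T * (2 * sqrt (real q))"
    using assms by (intro mult_left_mono sum_inverse_sqrt_le) auto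
  finally show ?thesis by simp
qed

text \<open>With \<open>q\<close> the integer part of \<open>T\<close>, the sum is at most
  \<open>2 * sqrt T * sqrt q\<close>. If \<open>q \<ge> 1\<close>, then
  \<open>T \<le> q + 1 \<le> 4 * q\<close>; if \<open>q = 0\<close>, the sum is empty.\<close>

lemma count_line:
  assumes "0 \<le> T" "T \<le> real n"
  shows "(\<Sum>j\<in>{j\<in>{1..n}. real j \<le> T}. sqrt (T / real j)) \<le> 4 * card {j\<in>{1..n}. real j \<le> T}"
proof -
  define q where "q = nat \<lfloor>T\<rfloor>"
  have "(\<Sum>j=1..q. sqrt (T / real j)) \<le> 4 * real q"
  proof (cases "q = 0")
    case False
    then have "T \<le> real q + 1" "1 \<le> real q" unfolding q_def using assms by linarith+
    then have T: "sqrt T \<le> sqrt (4 * real q)" by (intro real_sqrt_le_mono) linarith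
    have "(\<Sum>j=1..q. sqrt (T / real j)) \<le> 2 * sqrt T * sqrt (real q)"
      using assms by (intro sum_sqrt_quotient_le)
    also have "\<dots> \<le> 2 * sqrt (4 * real q) * sqrt (real q)"
      using T assms by (intro mult_mono) auto
    also have "\<dots> = 4 * real q" by (simp add: real_sqrt_mult)
    finally show ?thesis .
  qed simp
  then show ?thesis unfolding card_interval_le[OF assms] q_def by simp
qed

text \<open>The region is summed row by row. A row with \<open>t / i \<le> n\<close> falls under
  \<open>count_line\<close> and contributes 4 times its size. A row beyond that is full, with
  \<open>i \<le> \<tau> = t / n\<close>, and contributes at most
  \<open>2 * n * sqrt (\<tau> / i)\<close>. By \<open>count_line\<close> in \<open>i\<close>, the
  full rows together give at most \<open>8 * n * card top\<close>, that is 8 times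
  \<open>card A\<close>.\<close>

lemma count_product:
  assumes t: "0 < t" "t \<le> (real n)\<^sup>2"
  defines "A \<equiv> {p\<in>{1..n} \<times> {1..n}. real (fst p) * real (snd p) \<le> t}"
  shows "(\<Sum>p\<in>A. sqrt (t / (real (fst p) * real (snd p)))) \<le> 12 * card A"
proof -
  have n: "0 < n" using t by (cases "n = 0") auto
  define row where "row i = {j\<in>{1..n}. real j \<le> t / real i}" for i
  define \<tau> where "\<tau> = t / real n"
  have \<tau>: "0 \<le> \<tau>" "\<tau> \<le> real n" using t n by (auto simp: \<tau>_def power2_eq_square divide_le_eq)
  define top where "top = {i\<in>{1..n}. real i \<le> \<tau>}"
  have A: "A = Sigma {1..n} row"
    by (auto simp: A_def row_def le_divide_eq mult.commute)
  have cardA: "real (card A) = (\<Sum>i=1..n. real (card (row i)))"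
    unfolding A by (subst card_SigmaI) (auto simp: row_def)
  have full: "row i = {1..n}" if "i \<in> top" for i
  proof -
    have "real n \<le> t / real i" using that n by (auto simp: top_def \<tau>_def le_divide_eq divide_le_eq mult.commute)
    then show ?thesis by (auto simp: row_def)
  qed
  have "real n * card top = (\<Sum>i\<in>top. real (card (row i)))" by (simp add: full)
  also have "\<dots> \<le> (\<Sum>i=1..n. real (card (row i)))"
    by (intro sum_mono2) (auto simp: top_def)
  finally have ctop: "real n * card top \<le> card A" by (simp add: cardA)
  have "(\<Sum>p\<in>A. sqrt (t / (real (fst p) * real (snd p)))) = (\<Sum>i=1..n. \<Sum>j\<in>row i. sqrt ((t / real i) / real j))"
    unfolding A by (subst sum.Sigma) (auto simp: row_def split_beta)
  also have "\<dots> \<le> (\<Sum>i=1..n. 4 * real (card (row i)) + (if i \<in> top then 2 * real n * sqrt (\<tau> / real i) else 0))"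
  proof (rule sum_mono)
    fix i assume i: "i \<in> {1..n}"
    have pos: "0 \<le> t / real i" using t by simp
    show "(\<Sum>j\<in>row i. sqrt ((t / real i) / real j)) \<le>
       4 * real (card (row i)) + (if i \<in> top then 2 * real n * sqrt (\<tau> / real i) else 0)"
    proof (cases "t / real i \<le> real n")
      case True
      have "(\<Sum>j\<in>row i. sqrt ((t / real i) / real j)) \<le> 4 * real (card (row i))"
        using count_line[OF pos True] by (simp only: row_def)
      then show ?thesis using \<tau> by (auto intro: add_increasing2)
    next
      case False
      then have top: "i \<in> top" using i n by (auto simp: top_def \<tau>_def field_simps)
      have "(\<Sum>j\<in>row i. sqrt ((t / real i) / real j)) \<le> 2 * sqrt (t / real i) * sqrt (real n)"
        unfolding full[OF top] by (rule sum_sqrt_quotient_le[OF pos])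
      also have "sqrt (t / real i) = sqrt (real n) * sqrt (\<tau> / real i)"
        using n by (simp add: \<tau>_def real_sqrt_mult[symmetric])
      also have "2 * (sqrt (real n) * sqrt (\<tau> / real i)) * sqrt (real n) = 2 * (sqrt (real n) * sqrt (real n)) * sqrt (\<tau> / real i)"
        by (simp only: mult_ac)
      also have "sqrt (real n) * sqrt (real n) = real n" by simp
      finally have "(\<Sum>j\<in>row i. sqrt ((t / real i) / real j)) \<le> 2 * real n * sqrt (\<tau> / real i)" .
      then show ?thesis using top by (simp add: add_increasing)
    qed
  qed
  also have "\<dots> = 4 * real (card A) + (\<Sum>i\<in>{1..n}. if i \<in> top then 2 * real n * sqrt (\<tau> / real i) else 0)"
    by (simp add: sum.distrib cardA sum_distrib_left)
  also have "(\<Sum>i\<in>{1..n}. if i \<in> top then 2 * real n * sqrt (\<tau> / real i) else 0) = 2 * real n * (\<Sum>i\<in>top. sqrt (\<tau> / real i))"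
  proof -
    have "{1..n} \<inter> top = top" by (auto simp: top_def)
    then show ?thesis
      using sum.inter_restrict[of "{1..n}" "\<lambda>i. 2 * real n * sqrt (\<tau> / real i)" top]
      by (simp add: sum_distrib_left)
  qed
  also have "(\<Sum>i\<in>top. sqrt (\<tau> / real i)) \<le> 4 * card top"
    unfolding top_def by (rule count_line[OF \<tau>])
  finally show ?thesis using ctop by (simp add: mult_left_mono)
qed

text \<open>Since \<open>i\<^sup>2 + j\<^sup>2 \<ge> i * j\<close>, the sum is at most the square of
  a one-dimensional sum up to \<open>sqrt t\<close>, hence at most \<open>16 * t\<close>. The region
  contains the pairs with both entries at most \<open>sqrt (t / 2)\<close>, so it has at least
  \<open>t / 8\<close> points.\<close>

lemma count_sobolev:
  assumes t: "0 < t" "t \<le> (real n)\<^sup>2"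
  defines "A \<equiv> {p\<in>{1..n} \<times> {1..n}. (real (fst p))\<^sup>2 + (real (snd p))\<^sup>2 \<le> t}"
  shows "(\<Sum>p\<in>A. sqrt (t / ((real (fst p))\<^sup>2 + (real (snd p))\<^sup>2))) \<le> 128 * card A"
proof (cases "A = {}")
  case False
  then obtain p where p: "p \<in> A" by blast
  then have "1 \<le> (real (fst p))\<^sup>2" "1 \<le> (real (snd p))\<^sup>2" by (auto simp: A_def)
  \<comment> \<open>A nonempty region contains a point, and both of its coordinates are at least 1.
    This ensures below that \<open>sqrt (t / 2)\<close> is at least 1.\<close>
  then have t2: "2 \<le> t" using p by (auto simp: A_def)
  define \<rho> where "\<rho> = sqrt t"
  have \<rho>: "0 < \<rho>" "\<rho>\<^sup>2 = t" "\<rho> \<le> real n"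
    using t by (auto simp: \<rho>_def real_le_lsqrt)
  define B where "B = {i\<in>{1..n}. real i \<le> \<rho>}"
  have finA: "finite A" by (auto simp: A_def)
  have sub: "A \<subseteq> B \<times> B"
  proof
    fix p assume p: "p \<in> A"
    then have "(real (fst p))\<^sup>2 \<le> \<rho>\<^sup>2" "(real (snd p))\<^sup>2 \<le> \<rho>\<^sup>2"
      unfolding \<rho>(2) using zero_le_power2[of "real (fst p)"] zero_le_power2[of "real (snd p)"] p
      by (simp_all only: A_def mem_Collect_eq) linarith+
    then show "p \<in> B \<times> B" using p \<rho>(1) by (cases p) (auto simp: A_def B_def power2_le_iff_abs_le)
  qed
  have "(\<Sum>p\<in>A. sqrt (t / ((real (fst p))\<^sup>2 + (real (snd p))\<^sup>2))) \<le> (\<Sum>p\<in>A. sqrt (\<rho> / real (fst p)) * sqrt (\<rho> / real (snd p)))"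
  proof (rule sum_mono)
    fix p assume "p \<in> A"
    then have p: "0 < real (fst p)" "0 < real (snd p)" by (auto simp: A_def)
    have "real (fst p) * real (snd p) \<le> (real (fst p))\<^sup>2 + (real (snd p))\<^sup>2"
      using sum_squares_bound[of "real (fst p)" "real (snd p)"] mult_pos_pos[OF p] by linarith
    then have "t / ((real (fst p))\<^sup>2 + (real (snd p))\<^sup>2) \<le> t / (real (fst p) * real (snd p))"
      using t p by (intro divide_left_mono mult_pos_pos) (auto intro!: add_pos_pos)
    also have "\<dots> = (\<rho> / real (fst p)) * (\<rho> / real (snd p))"
      by (simp add: \<rho>(2)[symmetric] power2_eq_square)
    finally show "sqrt (t / ((real (fst p))\<^sup>2 + (real (snd p))\<^sup>2)) \<le> sqrt (\<rho> / real (fst p)) * sqrt (\<rho> / real (snd p))"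
      unfolding real_sqrt_mult[symmetric] by (rule real_sqrt_le_mono)
  qed
  also have "\<dots> \<le> (\<Sum>p\<in>B \<times> B. sqrt (\<rho> / real (fst p)) * sqrt (\<rho> / real (snd p)))"
    using sub \<rho>(1) by (intro sum_mono2) (auto simp: B_def)
  also have "\<dots> = (\<Sum>i\<in>B. sqrt (\<rho> / real i))\<^sup>2"
    by (simp add: power2_eq_square sum_product sum.cartesian_product split_beta)
  also have "\<dots> \<le> (4 * \<rho>)\<^sup>2"
  proof (rule power_mono)
    have "(\<Sum>i\<in>B. sqrt (\<rho> / real i)) \<le> 4 * card B"
      unfolding B_def using \<rho> by (intro count_line) auto
    moreover have "real (card B) \<le> \<rho>"
      unfolding B_def using \<rho> by (subst card_interval_le(2)) auto
    ultimately show "(\<Sum>i\<in>B. sqrt (\<rho> / real i)) \<le> 4 * \<rho>" by simp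
  qed (use \<rho>(1) in \<open>auto intro!: sum_nonneg\<close>)
  also have "\<dots> = 16 * t" by (simp add: power_mult_distrib \<rho>)
  finally have le: "(\<Sum>p\<in>A. sqrt (t / ((real (fst p))\<^sup>2 + (real (snd p))\<^sup>2))) \<le> 16 * t" .
  define y where "y = sqrt (t / 2)"
  have y: "1 \<le> y" "y \<le> real n" "y\<^sup>2 = t / 2"
  proof -
    show "1 \<le> y" using t2 by (simp add: y_def)
    have "y \<le> \<rho>" using t by (simp add: y_def \<rho>_def)
    then show "y \<le> real n" using \<rho> by simp
    show "y\<^sup>2 = t / 2" using t by (simp add: y_def)
  qed
  define C where "C = {i\<in>{1..n}. real i \<le> y}"
  have "C \<times> C \<subseteq> A"
  proof
    fix p assume p: "p \<in> C \<times> C"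
    then have "(real (fst p))\<^sup>2 \<le> y\<^sup>2" "(real (snd p))\<^sup>2 \<le> y\<^sup>2"
      by (auto simp: C_def intro!: power_mono)
    then show "p \<in> A" using p y(3) by (auto simp: A_def C_def)
  qed
  then have "card (C \<times> C) \<le> card A" by (intro card_mono finA)
  then have "real ((card C)\<^sup>2) \<le> real (card A)"
    by (simp add: card_cartesian_product power2_eq_square del: of_nat_power of_nat_mult)
  then have "(real (card C))\<^sup>2 \<le> card A"
    by (simp only: of_nat_power)
  moreover have "y / 2 \<le> card C"
    proof -
    \<comment> \<open>For \<open>y \<ge> 1\<close> rounding down loses at most half of
      \<open>y\<close>.\<close>
    have "1 \<le> real_of_int \<lfloor>y\<rfloor>" using y by simp
    then have "y / 2 \<le> real_of_int \<lfloor>y\<rfloor>" using real_of_int_floor_add_one_gt[of y] by linarith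
    then have "y / 2 \<le> real (nat \<lfloor>y\<rfloor>)" using y by simp
    then show ?thesis unfolding C_def using y by (subst card_interval_le(2)) auto
  qed
  then have "(y / 2)\<^sup>2 \<le> (real (card C))\<^sup>2" using y by (intro power_mono) auto
  moreover have "(y / 2)\<^sup>2 = t / 8" using y(3) by (simp add: power_divide)
  ultimately have "t / 8 \<le> card A" by linarith
  with le show ?thesis by simp
qed simp

section \<open>Location of the near minimizers\<close>

context gaussian_model
begin

text \<open>Doubling \<open>cn\<close> cannot lower the penalized risk, although it saves the
  fraction \<open>1 - 2 powr (- \<alpha>)\<close> of the bias and half of \<open>2 * l / cn\<close>.
  The variance grows at most fourfold, so these savings are at most
  \<open>3 * vari cn\<close>.\<close>

lemma minimizer_risk_le_variance:
  assumes l: "0 < l" and cn: "0 < cn"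
    and min: "\<And>c. 0 < c \<Longrightarrow> risk cn + 2 * l / cn \<le> risk c + 2 * l / c"
    and \<alpha>: "0 < \<alpha>" and gb: "bias (2 * cn) \<le> 2 powr (- \<alpha>) * bias cn"
  shows "risk cn + 2 * l / cn \<le> (3 / (1 - 2 powr (- \<alpha>)) + 7) * vari cn" "0 < vari cn"
proof -
  define q where "q = 1 - (2 :: real) powr (- \<alpha>)"
  have q: "0 < q" using \<alpha> powr_less_mono[of "- \<alpha>" 0 2] by (simp add: q_def)
  have v2: "vari (2 * cn) \<le> 4 * vari cn" using vari_mult_le[of cn 2] cn by simp
  have "bias cn + vari cn + 2 * (l / cn) \<le> bias (2 * cn) + vari (2 * cn) + l / cn"
  proof -
    have "2 * l / (2 * cn) = l / cn" "2 * l / cn = 2 * (l / cn)" by simp_all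
    then show ?thesis using min[of "2 * cn"] cn unfolding D_def by linarith
  qed
  also have "\<dots> \<le> (1 - q) * bias cn + 4 * vari cn + l / cn"
    using gb v2 by (simp add: q_def)
  finally have *: "q * bias cn + l / cn \<le> 3 * vari cn" unfolding left_diff_distrib by linarith
  have nn: "0 \<le> q * bias cn" "0 < l / cn" using q bias_nonneg[of cn] cn l by auto
  with * show "0 < vari cn" by linarith
  have "bias cn \<le> 3 / q * vari cn" using * nn q by (simp add: field_simps)
  moreover have "l / cn \<le> 3 * vari cn" using * nn by linarith
  moreover have "2 * l / cn = 2 * (l / cn)" by simp
  ultimately show "risk cn + 2 * l / cn \<le> (3 / (1 - 2 powr (- \<alpha>)) + 7) * vari cn"
    unfolding q_def[symmetric] D_def distrib_right by linarith
qed

text \<open>A near minimizer \<open>c\<close> has penalized risk at most \<open>G * vari cn\<close>.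
  If \<open>c\<close> is much larger than \<open>cn\<close>, its variance exceeds this bound. If it
  is much smaller, its bias or its term \<open>2 * l / c\<close> does, because comparison of
  \<open>cn\<close> with \<open>cn / K0\<close> shows that bias and penalty at \<open>cn\<close> are
  at least a constant times \<open>vari cn\<close>.\<close>

lemma near_minimizer_location:
  fixes M \<alpha> \<beta> B l :: real
  defines "G \<equiv> M * (3 / (1 - 2 powr (- \<alpha>)) + 7)"
  defines "K \<equiv> max 2 ((B * G) powr (1 / \<beta>))"
  defines "K0 \<equiv> (2 * B) powr (1 / \<beta>)"
  defines "k \<equiv> 1 / max K0 ((2 * K0 * G) powr (1 / min 1 \<alpha>))"
  assumes l: "0 < l" and a: "0 < a" and cn: "a \<le> cn" "cn \<le> b"
    and min: "\<And>c. 0 < c \<Longrightarrow> risk cn + 2 * l / cn \<le> risk c + 2 * l / c"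
    and \<alpha>: "0 < \<alpha>" and gb: "\<And>c K. a \<le> c \<Longrightarrow> c \<le> b \<Longrightarrow> 1 < K \<Longrightarrow> bias (K * c) \<le> K powr (- \<alpha>) * bias c"
    and B: "1 \<le> B" and \<beta>: "0 < \<beta>"
    and var: "\<And>c k. a \<le> c \<Longrightarrow> c \<le> b \<Longrightarrow> 0 < k \<Longrightarrow> k < 1 \<Longrightarrow> a \<le> k * c \<Longrightarrow>
        vari (k * c) \<le> B * k powr \<beta> * vari c"
    and M: "0 < M" and c: "a \<le> c" "c \<le> b" and near: "risk c + 2 * l / c \<le> M * (risk cn + 2 * l / cn)"
  shows "k * cn \<le> c" "c \<le> K * cn" "bias c + 2 * l / c \<le> G / k\<^sup>2 * vari c"
proof -
  have cn0: "0 < cn" and c0: "0 < c" using a cn c by auto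
  have q: "0 < 1 - (2 :: real) powr (- \<alpha>)" using \<alpha> powr_less_mono[of "- \<alpha>" 0 2] by simp
  have G: "0 < G" using M q by (simp add: G_def add_pos_pos)
  have gb2: "bias (2 * cn) \<le> 2 powr (- \<alpha>) * bias cn" using gb[of cn 2] cn by simp
  note hn = minimizer_risk_le_variance[OF l cn0 min \<alpha> gb2]
  have "M * (risk cn + 2 * l / cn) \<le> G * vari cn"
    using mult_left_mono[OF hn(1), of M] M by (simp add: G_def)
  with near have near': "risk c + 2 * l / c \<le> G * vari cn" by simp
  have nn: "0 \<le> bias c" "0 \<le> vari c" "0 < 2 * l / c" "0 \<le> bias cn" "0 < 2 * l / cn"
    using bias_nonneg vari_nonneg c0 cn0 l by auto
  have K0: "1 < K0"
  proof -
    have "1 powr (1 / \<beta>) < (2 * B) powr (1 / \<beta>)" using B \<beta> by (intro powr_less_mono2) auto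
    then show ?thesis by (simp add: K0_def)
  qed
  show "c \<le> K * cn"
  proof (cases "c \<le> cn")
    case True
    have "1 * cn \<le> K * cn" using cn0 by (intro mult_right_mono) (auto simp: K_def)
    then show ?thesis using True by simp
  next
    case False
    have "vari (cn / c * c) \<le> B * (cn / c) powr \<beta> * vari c"
      using False c c0 cn0 cn by (intro var) auto
    then have "vari cn \<le> B * (cn / c) powr \<beta> * vari c" using c0 by simp
    also have "\<dots> \<le> B * (cn / c) powr \<beta> * (G * vari cn)"
      using near' nn B by (intro mult_left_mono) (auto simp: D_def)
    finally have "1 \<le> B * (cn / c) powr \<beta> * G" using hn(2) by simp
    also have "(cn / c) powr \<beta> = 1 / (c / cn) powr \<beta>"
      using c0 cn0 by (simp add: powr_divide)
    finally have "(c / cn) powr \<beta> \<le> B * G"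
      using c0 cn0 by (simp add: field_simps)
    then have "((c / cn) powr \<beta>) powr (1 / \<beta>) \<le> (B * G) powr (1 / \<beta>)"
      using \<beta> by (intro powr_mono2) auto
    then have "c / cn \<le> K" using \<beta> c0 cn0 by (simp add: K_def powr_powr)
    then show ?thesis using cn0 by (simp add: divide_le_eq)
  qed
  have k0: "0 < k" "k \<le> 1" using K0 by (auto simp: k_def)
  show kc: "k * cn \<le> c"
  proof (cases "cn / K0 \<le> c")
    case True
    have "k \<le> 1 / K0" using K0 unfolding k_def by (intro divide_left_mono) auto
    then have "k * cn \<le> 1 / K0 * cn" using cn0 by (intro mult_right_mono) auto
    then show ?thesis using True by simp
  next
    case False
    \<comment> \<open>The factor by which \<open>c\<close> lies below \<open>cn\<close>; the rest of
      this case bounds it by \<open>1 / k\<close>.\<close>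
    define \<rho> where "\<rho> = cn / c"
    have \<rho>: "K0 < \<rho>" "cn = \<rho> * c" using False K0 c0 by (auto simp: \<rho>_def field_simps)
    have "vari (1 / K0 * cn) \<le> B * (1 / K0) powr \<beta> * vari cn"
      using False K0 c cn by (intro var) auto
    \<comment> \<open>\<open>K0\<close> is chosen so that dividing \<open>cn\<close> by it at least
      halves the variance.\<close>
    also have "B * (1 / K0) powr \<beta> = 1 / 2"
      using B \<beta> by (simp add: K0_def powr_divide powr_powr)
    finally have v: "vari (cn / K0) \<le> vari cn / 2" by simp
    have b: "bias (cn / K0) \<le> K0 * bias cn" using bias_le_mult[of "cn / K0" K0] K0 cn0 by simp
    have "bias cn + vari cn + 2 * l / cn \<le> bias (cn / K0) + vari (cn / K0) + K0 * (2 * l / cn)"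
      using min[of "cn / K0"] cn0 K0 by (simp add: D_def mult_ac)
    with v b nn have "vari cn / 2 \<le> K0 * bias cn + K0 * (2 * l / cn)" by linarith
    then have v_le: "vari cn \<le> 2 * K0 * (bias cn + 2 * l / cn)" by (simp add: algebra_simps)
    \<comment> \<open>From \<open>c\<close> to \<open>cn\<close> the bias decays with exponent
      \<open>\<alpha>\<close> and \<open>2 * l / c\<close> with exponent 1; the smaller exponent
      serves both, as \<open>\<rho>\<close> exceeds 1.\<close>
    let ?\<alpha> = "min 1 \<alpha>"
    have "bias cn \<le> \<rho> powr (- \<alpha>) * bias c" using gb[of c \<rho>] c \<rho> K0 by simp
    also have "\<dots> \<le> \<rho> powr (- ?\<alpha>) * bias c"
      using nn \<rho> K0 by (intro mult_right_mono powr_mono) auto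
    finally have 1: "bias cn \<le> \<rho> powr (- ?\<alpha>) * bias c" .
    have "2 * l / cn = \<rho> powr (- 1) * (2 * l / c)"
      using \<rho> K0 c0 by (simp add: powr_minus_divide)
    also have "\<dots> \<le> \<rho> powr (- ?\<alpha>) * (2 * l / c)"
      using nn \<rho> K0 by (intro mult_right_mono powr_mono) auto
    finally have "bias cn + 2 * l / cn \<le> \<rho> powr (- ?\<alpha>) * (bias c + 2 * l / c)"
      using 1 by (simp add: distrib_left)
    also have "\<dots> \<le> \<rho> powr (- ?\<alpha>) * (G * vari cn)"
      using near' nn by (intro mult_left_mono) (auto simp: D_def)
    finally have "2 * K0 * (bias cn + 2 * l / cn) \<le> 2 * K0 * (\<rho> powr (- ?\<alpha>) * (G * vari cn))"
      using K0 by (intro mult_left_mono) auto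
    with v_le have "1 * vari cn \<le> (2 * K0 * \<rho> powr (- ?\<alpha>) * G) * vari cn" by (simp add: mult_ac)
    then have "1 \<le> 2 * K0 * \<rho> powr (- ?\<alpha>) * G" using hn(2) by (simp only: mult_le_cancel_right_pos)
    then have "\<rho> powr ?\<alpha> \<le> 2 * K0 * G"
      using \<rho> K0 by (simp add: powr_minus_divide field_simps)
    then have "(\<rho> powr ?\<alpha>) powr (1 / ?\<alpha>) \<le> (2 * K0 * G) powr (1 / ?\<alpha>)"
      using \<alpha> by (intro powr_mono2) auto
    moreover have "?\<alpha> * (1 / ?\<alpha>) = 1" using \<alpha> by (simp add: min_def)
    ultimately have "\<rho> \<le> (2 * K0 * G) powr (1 / ?\<alpha>)"
      using \<rho> K0 by (simp only: powr_powr) simp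
    then have "\<rho> \<le> 1 / k" by (simp add: k_def)
    then have "k * \<rho> \<le> 1" using k0 by (simp add: field_simps)
    then have "k * \<rho> * c \<le> 1 * c" using c0 by (intro mult_right_mono) auto
    then show ?thesis using \<rho>(2) by (simp add: mult.assoc)
  qed
  \<comment> \<open>The lower location bound turns the bound by \<open>vari cn\<close> into one by
    \<open>vari c\<close>.\<close>
  have "vari cn \<le> vari (1 / k * c)" using kc k0 cn0 by (intro vari_mono) (auto simp: field_simps)
  also have "\<dots> \<le> (1 / k)\<^sup>2 * vari c" using k0 c0 by (intro vari_mult_le) auto
  finally have "G * vari cn \<le> G * ((1 / k)\<^sup>2 * vari c)" using G by (intro mult_left_mono) auto
  then show "bias c + 2 * l / c \<le> G / k\<^sup>2 * vari c"
    using near' nn by (simp add: D_def power_divide)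
qed

end

section \<open>The three eigenvalue conditions\<close>

text \<open>The upper estimate of the good variance condition, with the constant taken at least 1.
  Together with \<open>variance_log_lower\<close> it is common to the general assumptions and the
  three eigenvalue conditions.\<close>

definition variance_upper :: "real \<Rightarrow> (nat \<Rightarrow> nat) \<Rightarrow> (nat \<Rightarrow> nat \<Rightarrow> real) \<Rightarrow> bool" where
  "variance_upper m N lam \<longleftrightarrow> (\<exists>\<beta>>0. \<exists>B\<ge>1. \<forall>\<^sub>F n in sequentially.
     \<forall>c\<in>c_interval m (N n). \<forall>k\<in>{0<..<1}. k * c \<in> c_interval m (N n) \<longrightarrow>
       D2 (N n) (lam n) (k * c) \<le> B * k powr \<beta> * D2 (N n) (lam n) c)"

text \<open>The general assumptions give \<open>\<theta> = 1\<close>; the eigenvalue conditions are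
  shown to give \<open>\<theta> = 1 / 2\<close>.\<close>

definition variance_log_lower :: "real \<Rightarrow> (nat \<Rightarrow> nat) \<Rightarrow> (nat \<Rightarrow> nat \<Rightarrow> real) \<Rightarrow> bool" where
  "variance_log_lower m N lam \<longleftrightarrow> (\<exists>\<theta>>0. \<forall>\<^sub>F n in sequentially.
     \<forall>c\<in>c_interval m (N n). \<theta> * ln (real (N n) * c) \<le> D2 (N n) (lam n) c)"

lemma c_interval_lower:
  assumes "c \<in> c_interval m n" "2 \<le> n"
  shows "ln (real n) \<le> real n * c" "0 < c"
proof -
  show *: "ln (real n) \<le> real n * c"
    using assms by (auto simp: c_interval_def divide_le_eq mult.commute)
  have "0 < ln (real n)" using assms by simp
  with * have "0 < real n * c" by linarith
  then show "0 < c" using assms by (simp add: zero_less_mult_iff)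
qed

text \<open>The upper estimate is \<open>sum_psi_scaling_model\<close> on the reindexed sum. For the
  lower one a single eigenvalue of weight at most 2 suffices: it has order \<open>N n\<close>, so
  its contribution alone is logarithmic in \<open>N n * c\<close>. The bound 2 is the Sobolev weight
  of the pair \<open>(1, 1)\<close>.\<close>

lemma eigenvalue_model_regular:
  fixes w :: "nat \<Rightarrow> 'i \<Rightarrow> real" and C :: real and lam :: "nat \<Rightarrow> nat \<Rightarrow> real"
  assumes m: "1 \<le> m" and d: "0 < d" "d \<le> d'" and N: "filterlim N at_top sequentially"
    and J: "\<And>n. finite (J n)" and h: "\<And>n. bij_betw (h n) (J n) {1..N n}"
    and w: "\<And>n j. j \<in> J n \<Longrightarrow> 1 \<le> w n j"
    and lam: "\<And>n j. j \<in> J n \<Longrightarrow> d * real (N n) / w n j powr m \<le> lam n (h n j)"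
      "\<And>n j. j \<in> J n \<Longrightarrow> lam n (h n j) \<le> d' * real (N n) / w n j powr m"
    and count: "\<And>n t. 0 < t \<Longrightarrow> t \<le> real (N n) \<Longrightarrow>
      (\<Sum>j\<in>{j\<in>J n. w n j \<le> t}. sqrt (t / w n j)) \<le> C * card {j\<in>J n. w n j \<le> t}" and C: "0 \<le> C"
    and top: "\<And>n. 1 \<le> N n \<Longrightarrow> \<exists>j\<in>J n. w n j \<le> 2"
  shows "variance_upper m N lam" "variance_log_lower m N lam"
proof -
  have D2_eq: "D2 (N n) (lam n) c = (\<Sum>j\<in>J n. psi (c * lam n (h n j)))" for n c
    unfolding D2_eq_sum_psi by (rule sum.reindex_bij_betw[OF h, symmetric])
  have N2: "\<forall>\<^sub>F n in sequentially. 2 \<le> N n"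
    using N by (auto simp: filterlim_at_top)
  define B where "B = (max 1 d')\<^sup>2 * (8 + C / (1 / (2 * m) * psi 1)) * (max 1 (1 / d))\<^sup>2"
  have "1 * 1 * 1 \<le> (max 1 d')\<^sup>2 * (8 + C / (1 / (2 * m) * psi 1)) * (max 1 (1 / d))\<^sup>2"
  proof (intro mult_mono)
    have "0 \<le> C / (1 / (2 * m) * psi 1)" using C m psi_one_pos by (intro divide_nonneg_nonneg) auto
    then show "1 \<le> 8 + C / (1 / (2 * m) * psi 1)" "0 \<le> (max 1 d')\<^sup>2 * (8 + C / (1 / (2 * m) * psi 1))" by auto
  qed (auto intro: one_le_power)
  then have B: "1 \<le> B" by (simp add: B_def)
  show "variance_upper m N lam"
    unfolding variance_upper_def
  proof (intro exI conjI)
    show "0 < 1 / (2 * m)" "1 \<le> B" using m B by auto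
    show "\<forall>\<^sub>F n in sequentially. \<forall>c\<in>c_interval m (N n). \<forall>k\<in>{0<..<1}. k * c \<in> c_interval m (N n) \<longrightarrow>
       D2 (N n) (lam n) (k * c) \<le> B * k powr (1 / (2 * m)) * D2 (N n) (lam n) c"
      using N2
    proof eventually_elim
      case (elim n)
      show ?case
      proof (intro ballI impI)
        fix c k :: real assume c: "c \<in> c_interval m (N n)" and k: "k \<in> {0<..<1}"
        show "D2 (N n) (lam n) (k * c) \<le> B * k powr (1 / (2 * m)) * D2 (N n) (lam n) c"
          unfolding D2_eq B_def
          using elim c k c_interval_lower(2)[OF c elim]
          by (intro sum_psi_scaling_model[OF J w d m lam count C]) (auto simp: c_interval_def)
      qed
    qed
  qed
  define \<delta> where "\<delta> = d / 2 powr m"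
  have \<delta>: "0 < \<delta>" using d by (simp add: \<delta>_def)
  have "filterlim (\<lambda>n. ln (real (N n))) at_top sequentially"
    by (rule filterlim_compose[OF ln_at_top])
       (rule filterlim_compose[OF filterlim_real_sequentially N])
  \<comment> \<open>\<open>N n * c\<close> is at least \<open>ln (N n)\<close>, so it eventually
    exceeds the value from which half of the logarithm absorbs the constant
    \<open>1 - ln \<delta>\<close>.\<close>
  then have large: "\<forall>\<^sub>F n in sequentially. max 1 (exp (2 * (1 - ln \<delta>))) \<le> ln (real (N n))"
    unfolding filterlim_at_top by (rule spec)
  show "variance_log_lower m N lam"
    unfolding variance_log_lower_def
  proof (intro exI conjI)
    show "(0::real) < 1 / 2" by simp
    show "\<forall>\<^sub>F n in sequentially. \<forall>c\<in>c_interval m (N n). 1 / 2 * ln (real (N n) * c) \<le> D2 (N n) (lam n) c"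
      using N2 large
    proof eventually_elim
      case (elim n)
      show ?case
      proof
        fix c assume c: "c \<in> c_interval m (N n)"
        define y where "y = real (N n) * c"
        have c0: "0 < c" and y: "max 1 (exp (2 * (1 - ln \<delta>))) \<le> y"
          using c_interval_lower[OF c elim(1)] elim(2) by (auto simp: y_def)
        then have y0: "0 < y" by linarith
        have "ln (exp (2 * (1 - ln \<delta>))) \<le> ln y"
          using y y0 by (subst ln_le_cancel_iff) auto
        then have "ln y / 2 \<le> ln y + ln \<delta> - 1" by simp
        also have "\<dots> = ln (\<delta> * y) - 1" using \<delta> y0 by (simp add: ln_mult)
        also have "\<dots> \<le> psi (\<delta> * y)"
        proof -
          have "ln (\<delta> * y) \<le> ln (1 + \<delta> * y)" using \<delta> y0 by (intro ln_mono) auto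
          moreover have "\<delta> * y / (1 + \<delta> * y) \<le> 1" using mult_pos_pos[OF \<delta> y0] by simp
          ultimately show ?thesis by (simp add: psi_def)
        qed
        also have "\<dots> \<le> D2 (N n) (lam n) c"
        proof -
          obtain j where j: "j \<in> J n" "w n j \<le> 2" using top[of n] elim(1) by auto
          have pos: "0 < lam n (h n i)" if "i \<in> J n" for i
            using lam(1)[OF that] d elim(1) w[OF that] by (auto elim!: less_le_trans[rotated])
          have "d * real (N n) / 2 powr m \<le> d * real (N n) / w n j powr m"
            using j w[OF j(1)] d m by (intro divide_left_mono powr_mono2) auto
          also have "\<dots> \<le> lam n (h n j)" by (rule lam(1)[OF j(1)])
          finally have "c * (d * real (N n) / 2 powr m) \<le> c * lam n (h n j)"
            using c0 by (intro mult_left_mono) auto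
          then have "\<delta> * y \<le> c * lam n (h n j)" by (simp add: \<delta>_def y_def mult_ac)
          then have "psi (\<delta> * y) \<le> psi (c * lam n (h n j))"
            using \<delta> y0 by (intro psi_mono) auto
          also have "\<dots> \<le> (\<Sum>j\<in>J n. psi (c * lam n (h n j)))"
            using pos c0 by (intro member_le_sum j J psi_nonneg mult_nonneg_nonneg) (auto intro: less_imp_le)
          finally show ?thesis unfolding D2_eq .
        qed
        finally show "1 / 2 * ln (real (N n) * c) \<le> D2 (N n) (lam n) c" by (simp add: y_def)
      qed
    qed
  qed
qed

section \<open>Weights for the three conditions: \<open>j\<close>, \<open>i * j\<close>, and the sum
  of the squares of \<open>i\<close> and \<open>j\<close>\<close>

lemma filterlim_square_nat: "filterlim (\<lambda>n::nat. n\<^sup>2) at_top sequentially"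
  by (rule filterlim_at_top_mono[OF filterlim_ident]) (auto simp: power2_eq_square intro: eventually_sequentiallyI[of 1])

lemma polynomial_eigenvalues_regular:
  assumes "polynomial_eigenvalues m lam" "1 \<le> m"
  shows "variance_upper m (\<lambda>n. n) lam" "variance_log_lower m (\<lambda>n. n) lam"
proof -
  obtain d d' where d: "0 < d" "d \<le> d'"
    "\<And>n j. j \<in> {1..n} \<Longrightarrow> d * real n / real j powr m \<le> lam n j"
    "\<And>n j. j \<in> {1..n} \<Longrightarrow> lam n j \<le> d' * real n / real j powr m"
    using assms(1) unfolding polynomial_eigenvalues_def by blast
  have top: "\<exists>j\<in>{1..n}. real j \<le> 2" if "1 \<le> n" for n
    using that by (intro bexI[of _ 1]) auto
  note regular = eigenvalue_model_regular[where N="\<lambda>n. n" and J="\<lambda>n. {1..n}" and h="\<lambda>n j. j"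
      and w="\<lambda>n j. real j" and C=4 and lam=lam, OF assms(2) d(1,2) filterlim_ident _ _ _ d(3,4) _ _ top]
  show "variance_upper m (\<lambda>n. n) lam" "variance_log_lower m (\<lambda>n. n) lam"
    by (rule regular; use count_line in \<open>force simp: bij_betw_def\<close>)+
qed

lemma product_eigenvalues_regular:
  assumes "product_eigenvalues m lam" "1 \<le> m"
  shows "variance_upper m (\<lambda>n. n\<^sup>2) lam" "variance_log_lower m (\<lambda>n. n\<^sup>2) lam"
proof -
  obtain d d' where d: "0 < d" "d \<le> d'" and "\<forall>n. \<exists>h. bij_betw h ({1..n} \<times> {1..n}) {1..n\<^sup>2} \<and>
        (\<forall>i\<in>{1..n}. \<forall>j\<in>{1..n}.
           d * (real n)\<^sup>2 / (real i powr m * real j powr m) \<le> lam n (h (i, j)) \<and>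
           lam n (h (i, j)) \<le> d' * (real n)\<^sup>2 / (real i powr m * real j powr m))"
    using assms(1) unfolding product_eigenvalues_def by blast
  then obtain h where h: "\<And>n. bij_betw (h n) ({1..n} \<times> {1..n}) {1..n\<^sup>2}"
    "\<And>n i j. i \<in> {1..n} \<Longrightarrow> j \<in> {1..n} \<Longrightarrow> d * (real n)\<^sup>2 / (real i powr m * real j powr m) \<le> lam n (h n (i, j))"
    "\<And>n i j. i \<in> {1..n} \<Longrightarrow> j \<in> {1..n} \<Longrightarrow> lam n (h n (i, j)) \<le> d' * (real n)\<^sup>2 / (real i powr m * real j powr m)"
    by metis
  have w: "1 \<le> real (fst p) * real (snd p)" if "p \<in> {1..n} \<times> {1..n}" for p :: "nat \<times> nat" and n
    using that mult_mono[of 1 "real (fst p)" 1 "real (snd p)"] by auto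
  have top: "\<exists>p\<in>{1..n} \<times> {1..n}. real (fst p) * real (snd p) \<le> 2" if "1 \<le> n\<^sup>2" for n :: nat
    using that by (intro bexI[of _ "(1, 1)"]) (cases "n = 0"; auto)+
  have lower: "d * real (n\<^sup>2) / (real (fst p) * real (snd p)) powr m \<le> lam n (h n p)"
    and upper: "lam n (h n p) \<le> d' * real (n\<^sup>2) / (real (fst p) * real (snd p)) powr m"
    if "p \<in> {1..n} \<times> {1..n}" for p n
    using that h(2,3)[of "fst p" n "snd p"] by (auto simp: powr_mult)
  note regular = eigenvalue_model_regular[where N="\<lambda>n. n\<^sup>2" and J="\<lambda>n. {1..n} \<times> {1..n}" and h=h
      and w="\<lambda>n p. real (fst p) * real (snd p)" and C=12 and lam=lam,
      OF assms(2) d filterlim_square_nat _ h(1) w lower upper _ _ top]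
  show "variance_upper m (\<lambda>n. n\<^sup>2) lam" "variance_log_lower m (\<lambda>n. n\<^sup>2) lam"
    by (rule regular; use count_product in \<open>force\<close>)+
qed

lemma sobolev_eigenvalues_regular:
  assumes "sobolev_eigenvalues m lam" "1 \<le> m"
  shows "variance_upper m (\<lambda>n. n\<^sup>2) lam" "variance_log_lower m (\<lambda>n. n\<^sup>2) lam"
proof -
  obtain d d' where d: "0 < d" "d \<le> d'" and "\<forall>n. \<exists>h. bij_betw h ({1..n} \<times> {1..n}) {1..n\<^sup>2} \<and>
        (\<forall>i\<in>{1..n}. \<forall>j\<in>{1..n}.
           d * (real n)\<^sup>2 / ((real i)\<^sup>2 + (real j)\<^sup>2) powr m \<le> lam n (h (i, j)) \<and>
           lam n (h (i, j)) \<le> d' * (real n)\<^sup>2 / ((real i)\<^sup>2 + (real j)\<^sup>2) powr m)"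
    using assms(1) unfolding sobolev_eigenvalues_def by blast
  then obtain h where h: "\<And>n. bij_betw (h n) ({1..n} \<times> {1..n}) {1..n\<^sup>2}"
    "\<And>n i j. i \<in> {1..n} \<Longrightarrow> j \<in> {1..n} \<Longrightarrow> d * (real n)\<^sup>2 / ((real i)\<^sup>2 + (real j)\<^sup>2) powr m \<le> lam n (h n (i, j))"
    "\<And>n i j. i \<in> {1..n} \<Longrightarrow> j \<in> {1..n} \<Longrightarrow> lam n (h n (i, j)) \<le> d' * (real n)\<^sup>2 / ((real i)\<^sup>2 + (real j)\<^sup>2) powr m"
    by metis
  have w: "1 \<le> (real (fst p))\<^sup>2 + (real (snd p))\<^sup>2" if "p \<in> {1..n} \<times> {1..n}" for p :: "nat \<times> nat" and n
    using that by (auto intro!: add_increasing2)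
  have top: "\<exists>p\<in>{1..n} \<times> {1..n}. (real (fst p))\<^sup>2 + (real (snd p))\<^sup>2 \<le> 2" if "1 \<le> n\<^sup>2" for n :: nat
    using that by (intro bexI[of _ "(1, 1)"]) (cases "n = 0"; auto)+
  have lower: "d * real (n\<^sup>2) / ((real (fst p))\<^sup>2 + (real (snd p))\<^sup>2) powr m \<le> lam n (h n p)"
    and upper: "lam n (h n p) \<le> d' * real (n\<^sup>2) / ((real (fst p))\<^sup>2 + (real (snd p))\<^sup>2) powr m"
    if "p \<in> {1..n} \<times> {1..n}" for p n
    using that h(2,3)[of "fst p" n "snd p"] by (auto)
  note regular = eigenvalue_model_regular[where N="\<lambda>n. n\<^sup>2" and J="\<lambda>n. {1..n} \<times> {1..n}" and h=h
      and w="\<lambda>n p. (real (fst p))\<^sup>2 + (real (snd p))\<^sup>2" and C=128 and lam=lam,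
      OF assms(2) d filterlim_square_nat _ h(1) w lower upper _ _ top]
  show "variance_upper m (\<lambda>n. n\<^sup>2) lam" "variance_log_lower m (\<lambda>n. n\<^sup>2) lam"
    by (rule regular; use count_sobolev in \<open>force\<close>)+
qed

section \<open>Posterior concentration\<close>

text \<open>All stages together; \<open>cmin n\<close> stands for the minimizer of the penalized
  risk at stage \<open>n\<close>.\<close>

locale gaussian_model_sequence =
  fixes N :: "nat \<Rightarrow> nat" and U :: "nat \<Rightarrow> real Matrix.mat"
    and e :: "nat \<Rightarrow> nat \<Rightarrow> real Matrix.vec" and lam :: "nat \<Rightarrow> nat \<Rightarrow> real"
    and P :: "nat \<Rightarrow> 'w measure" and eps :: "nat \<Rightarrow> nat \<Rightarrow> 'w \<Rightarrow> real" and fv :: "nat \<Rightarrow> real Matrix.vec"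
    and m l :: real and cmin :: "nat \<Rightarrow> real"
  assumes model: "\<And>n. gaussian_model (N n) (U n) (e n) (lam n) (P n) (eps n) (fv n)"
    and N_at_top: "filterlim N at_top sequentially"
    and variance_upper: "variance_upper m N lam"
    and constants: "1 \<le> m" "0 < l"
    and minimizer: "\<forall>\<^sub>F n in sequentially.
        0 < cmin n \<and>
        (\<forall>c>0. D (N n) (e n) (lam n) (fv n) (cmin n) + 2 * l / cmin n
                 \<le> D (N n) (e n) (lam n) (fv n) c + 2 * l / c) \<and>
        cmin n \<in> c_interval m (N n) \<and> 2 * cmin n \<in> c_interval m (N n)"
begin

lemma real_N_at_top: "filterlim (\<lambda>n. real (N n)) at_top sequentially"
  by (rule filterlim_compose[OF filterlim_real_sequentially N_at_top])

text \<open>The constants in \<open>near_minimizer_location\<close> depend only on \<open>M\<close>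
  and on the constants of the bias and variance conditions, so they are the same for all large
  \<open>n\<close>.\<close>

lemma near_minimizer_location_eventually:
  assumes gb: "good_bias m N e lam fv" and M: "0 < M"
  shows "\<exists>k K C. 0 < k \<and> k < K \<and> (\<forall>\<^sub>F n in sequentially. \<forall>c\<in>c_interval m (N n).
      D (N n) (e n) (lam n) (fv n) c + 2 * l / c
        \<le> M * (D (N n) (e n) (lam n) (fv n) (cmin n) + 2 * l / cmin n) \<longrightarrow>
      k * cmin n \<le> c \<and> c \<le> K * cmin n \<and>
      D1 (N n) (e n) (lam n) (fv n) c + 2 * l / c \<le> C * D2 (N n) (lam n) c)"
proof -
  obtain \<alpha> where \<alpha>: "0 < \<alpha>" and gb': "\<forall>\<^sub>F n in sequentially. \<forall>c\<in>c_interval m (N n). \<forall>K>1.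
        D1 (N n) (e n) (lam n) (fv n) (K * c) \<le> K powr (- \<alpha>) * D1 (N n) (e n) (lam n) (fv n) c"
    using gb by (auto simp: good_bias_def)
  obtain \<beta> B where \<beta>: "0 < \<beta>" and B: "1 \<le> B" and var: "\<forall>\<^sub>F n in sequentially.
     \<forall>c\<in>c_interval m (N n). \<forall>k\<in>{0<..<1}. k * c \<in> c_interval m (N n) \<longrightarrow>
       D2 (N n) (lam n) (k * c) \<le> B * k powr \<beta> * D2 (N n) (lam n) c"
    using variance_upper by (auto simp: variance_upper_def)
  define G where "G = M * (3 / (1 - 2 powr (- \<alpha>)) + 7)"
  define K where "K = max 2 ((B * G) powr (1 / \<beta>))"
  define K0 where "K0 = (2 * B) powr (1 / \<beta>)"
  define k where "k = 1 / max K0 ((2 * K0 * G) powr (1 / min 1 \<alpha>))"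
  have "1 powr (1 / \<beta>) < (2 * B) powr (1 / \<beta>)" using B \<beta> by (intro powr_less_mono2) auto
  then have K0: "1 < K0" by (simp add: K0_def)
  have k: "0 < k" "k \<le> 1" using K0 by (auto simp: k_def)
  have N2: "\<forall>\<^sub>F n in sequentially. 2 \<le> N n"
    using N_at_top by (auto simp: filterlim_at_top)
  have "\<forall>\<^sub>F n in sequentially. \<forall>c\<in>c_interval m (N n).
      D (N n) (e n) (lam n) (fv n) c + 2 * l / c
        \<le> M * (D (N n) (e n) (lam n) (fv n) (cmin n) + 2 * l / cmin n) \<longrightarrow>
      k * cmin n \<le> c \<and> c \<le> K * cmin n \<and>
      D1 (N n) (e n) (lam n) (fv n) c + 2 * l / c \<le> G / k\<^sup>2 * D2 (N n) (lam n) c"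
    using N2 gb' var minimizer
  proof eventually_elim
    case (elim n)
    interpret gaussian_model "N n" "U n" "e n" "lam n" "P n" "eps n" "fv n" by (rule model)
    define a where "a = ln (real (N n)) / real (N n)"
    define b where "b = real (N n) powr (m - 1)"
    have I: "c_interval m (N n) = {a..b}" by (simp add: c_interval_def a_def b_def)
    have a: "0 < a" using elim(1) by (simp add: a_def)
    have cn: "a \<le> cmin n" "cmin n \<le> b" using elim(4) by (auto simp: I)
    have min: "risk (cmin n) + 2 * l / cmin n \<le> risk c + 2 * l / c" if "0 < c" for c
      using elim(4) that by blast
    have gbn: "bias (K * c) \<le> K powr (- \<alpha>) * bias c" if "a \<le> c" "c \<le> b" "1 < K" for c K
      using elim(2) that by (auto simp: I)
    have varn: "vari (k * c) \<le> B * k powr \<beta> * vari c"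
      if "a \<le> c" "c \<le> b" "0 < k" "k < 1" "a \<le> k * c" for c k
    proof -
      have "k * c \<le> 1 * c" using that a by (intro mult_right_mono) auto
      then show ?thesis using elim(3) that by (auto simp: I)
    qed
    show ?case
    proof (intro ballI impI)
      fix c assume "c \<in> c_interval m (N n)"
        and near: "risk c + 2 * l / c \<le> M * (risk (cmin n) + 2 * l / cmin n)"
      then have c: "a \<le> c" "c \<le> b" by (auto simp: I)
      from near_minimizer_location[OF constants(2) a cn min \<alpha> gbn B \<beta> varn M c near]
      show "k * cmin n \<le> c \<and> c \<le> K * cmin n \<and> bias c + 2 * l / c \<le> G / k\<^sup>2 * vari c"
        unfolding G_def K_def K0_def k_def by blast
    qed
  qed
  moreover have "k < K" using k by (auto simp: K_def)
  ultimately show ?thesis using k(1) by blast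
qed

text \<open>If \<open>cmin n\<close> is at least \<open>N n powr (- (1 / 2))\<close>, the variance
  alone is at least \<open>\<theta> / 2 * ln (N n)\<close>. Otherwise the penalty is at least
  \<open>2 * l * sqrt (N n)\<close>, which eventually dominates the logarithm.\<close>

lemma minimal_risk_ge_log:
  assumes \<theta>: "0 < \<theta>" and log: "\<forall>\<^sub>F n in sequentially.
     \<forall>c\<in>c_interval m (N n). \<theta> * ln (real (N n) * c) \<le> D2 (N n) (lam n) c"
  shows "\<forall>\<^sub>F n in sequentially. \<theta> / 2 * ln (real (N n))
    \<le> D (N n) (e n) (lam n) (fv n) (cmin n) + 2 * l / cmin n"
proof -
  have "\<forall>\<^sub>F x in at_top. \<theta> / 2 * ln x \<le> 2 * l * x powr (1 / 2)"
    using \<theta> constants(2) by real_asymp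
  then have big: "\<forall>\<^sub>F n in sequentially. \<theta> / 2 * ln (real (N n)) \<le> 2 * l * real (N n) powr (1 / 2)"
    by (rule eventually_compose_filterlim[OF _ real_N_at_top])
  have N2: "\<forall>\<^sub>F n in sequentially. 2 \<le> N n"
    using N_at_top by (auto simp: filterlim_at_top)
  show ?thesis
    using N2 big log minimizer
  proof eventually_elim
    case (elim n)
    interpret gaussian_model "N n" "U n" "e n" "lam n" "P n" "eps n" "fv n" by (rule model)
    let ?x = "real (N n)" and ?c = "cmin n"
    have x: "0 < ?x" using elim(1) by simp
    have c: "0 < ?c" "?c \<in> c_interval m (N n)" using elim(4) by auto
    have nn: "0 \<le> bias ?c" "0 \<le> vari ?c" "0 \<le> 2 * l / ?c"
      using bias_nonneg vari_nonneg c constants by auto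
    show ?case
    proof (cases "?x powr (- (1 / 2)) \<le> ?c")
      case True
      then have "?x * ?x powr (- (1 / 2)) \<le> ?x * ?c" using x by (intro mult_left_mono) auto
      also have "?x * ?x powr (- (1 / 2)) = ?x powr 1 * ?x powr (- (1 / 2))" using x by simp
      also have "\<dots> = ?x powr (1 / 2)" unfolding powr_add[symmetric] by simp
      finally have "ln (?x powr (1 / 2)) \<le> ln (?x * ?c)" using x c by (intro ln_mono) auto
      then have "\<theta> * (1 / 2 * ln ?x) \<le> \<theta> * ln (?x * ?c)"
        using x \<theta> by (intro mult_left_mono) (auto simp: ln_powr)
      also have "\<dots> \<le> vari ?c" using elim(3) c(2) by auto
      finally show ?thesis using nn unfolding D_def by simp
    next
      case False
      then have "1 / ?x powr (- (1 / 2)) \<le> 1 / ?c" using c x by (intro divide_left_mono) auto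
      then have "2 * l * ?x powr (1 / 2) \<le> 2 * l * (1 / ?c)"
        using constants x by (intro mult_left_mono) (auto simp: powr_minus_divide)
      with elim(2) nn show ?thesis unfolding D_def by simp
    qed
  qed
qed

text \<open>One \<open>M\<close> serves for all sequences \<open>A\<close>, so each assertion of the
  theorem is reduced to the eventual inclusion of the near minimizers in a Borel set.\<close>

lemma posterior_concentration:
  assumes \<kappa>: "0 < \<kappa>" and vl: "variance_log_lower m N lam"
  shows "\<exists>M>0. \<forall>A. (\<forall>n. A n \<in> sets borel) \<longrightarrow>
    (\<forall>\<^sub>F n in sequentially. \<forall>c\<in>c_interval m (N n).
      D (N n) (e n) (lam n) (fv n) c + 2 * l / c
        \<le> M * (D (N n) (e n) (lam n) (fv n) (cmin n) + 2 * l / cmin n) \<longrightarrow> c \<in> A n) \<longrightarrow>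
    tendsto_in_prob P (\<lambda>n \<omega>. measure (posterior \<kappa> l m (N n) (U n) (fv n + vec1 (N n) (\<lambda>i. eps n i \<omega>))) (A n)) 1"
proof -
  obtain \<theta> where \<theta>: "0 < \<theta>" and log: "\<forall>\<^sub>F n in sequentially.
     \<forall>c\<in>c_interval m (N n). \<theta> * ln (real (N n) * c) \<le> D2 (N n) (lam n) c"
    using vl by (auto simp: variance_log_lower_def)
  obtain \<beta> B where \<beta>: "0 < \<beta>" and B: "1 \<le> B" and var: "\<forall>\<^sub>F n in sequentially.
     \<forall>c\<in>c_interval m (N n). \<forall>k\<in>{0<..<1}. k * c \<in> c_interval m (N n) \<longrightarrow>
       D2 (N n) (lam n) (k * c) \<le> B * k powr \<beta> * D2 (N n) (lam n) c"
    using variance_upper by (auto simp: variance_upper_def)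
  \<comment> \<open>As \<open>b / a \<le> N powr m\<close>, the polynomial factor of the posterior
    bound is at most a constant times \<open>N powr p\<close>. The choice of \<open>t\<close> gives
    \<open>t * \<theta> / 2 = p + 1\<close>, so the exponential factor beats it by one power of
    \<open>N\<close>, and \<open>M\<close> is then fixed by \<open>M / 4 - 3 = t\<close>.\<close>
  define p where "p = m * (1 + \<kappa>)"
  define t where "t = 2 * (p + 1) / \<theta>"
  define M where "M = 4 * (3 + t)"
  have p: "0 < p" using \<kappa> constants by (simp add: p_def)
  have M: "0 < M" using p \<theta> by (auto simp: M_def t_def intro!: add_pos_pos)
  have M_eq: "M / 4 - 3 = t" by (simp add: M_def add_divide_distrib)
  define \<rho> where "\<rho> = (4/5 :: real) powr \<beta>"
  have \<rho>: "0 < 1 - \<rho>" using \<beta> powr_less_mono2[of \<beta> "4/5" "1::real"] by (simp add: \<rho>_def)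
  \<comment> \<open>\<open>\<delta> n\<close> bounds the posterior mass outside \<open>A n\<close>
    on the good event, and \<open>\<eta> n\<close> the probability of the bad event.\<close>
  define \<delta> where "\<delta> n = 2 powr (1 + \<kappa>) / real (N n)" for n
  define \<eta> where "\<eta> n = 3000 * B / (1 - \<rho>) / (\<theta> * ln (ln (real (N n))))" for n
  have \<delta>_lim: "\<delta> \<longlonglongrightarrow> 0"
    unfolding \<delta>_def[abs_def] by (rule tendsto_divide_0[OF tendsto_const filterlim_at_top_imp_at_infinity[OF real_N_at_top]])
  have "filterlim (\<lambda>n. \<theta> * ln (ln (real (N n)))) at_top sequentially"
    by (intro filterlim_tendsto_pos_mult_at_top[OF tendsto_const \<theta>]
        filterlim_compose[OF ln_at_top] real_N_at_top)
  then have \<eta>_lim: "\<eta> \<longlonglongrightarrow> 0"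
    unfolding \<eta>_def[abs_def] by (intro tendsto_divide_0[OF tendsto_const] filterlim_at_top_imp_at_infinity)
  have N2: "\<forall>\<^sub>F n in sequentially. 2 \<le> N n"
    using N_at_top by (auto simp: filterlim_at_top)
  have "filterlim (\<lambda>n. ln (real (N n))) at_top sequentially"
    by (rule filterlim_compose[OF ln_at_top real_N_at_top])
  then have ln1: "\<forall>\<^sub>F n in sequentially. 1 < ln (real (N n))"
    by (simp add: filterlim_at_top_dense)
  show ?thesis
  proof (intro exI[of _ M] conjI allI impI M)
    fix A assume A: "\<forall>n. A n \<in> sets borel"
      and sub: "\<forall>\<^sub>F n in sequentially. \<forall>c\<in>c_interval m (N n).
      D (N n) (e n) (lam n) (fv n) c + 2 * l / c
        \<le> M * (D (N n) (e n) (lam n) (fv n) (cmin n) + 2 * l / cmin n) \<longrightarrow> c \<in> A n"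
    define X where "X n \<omega> = measure (posterior \<kappa> l m (N n) (U n) (fv n + vec1 (N n) (\<lambda>i. eps n i \<omega>))) (A n)" for n \<omega>
    have X: "X n \<in> borel_measurable (P n)" for n
      unfolding X_def using gaussian_model.posterior_measurable[OF model] A by blast
    have bound: "\<forall>\<^sub>F n in sequentially. \<forall>r>\<delta> n. measure (P n) {\<omega> \<in> space (P n). r < \<bar>X n \<omega> - 1\<bar>} \<le> \<eta> n"
      using N2 ln1 var log minimizer sub minimal_risk_ge_log[OF \<theta> log]
    proof eventually_elim
      case (elim n)
      interpret gaussian_model "N n" "U n" "e n" "lam n" "P n" "eps n" "fv n" by (rule model)
      let ?x = "real (N n)" and ?c = "cmin n"
      define a where "a = ln ?x / ?x"
      define b where "b = ?x powr (m - 1)"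
      have I: "c_interval m (N n) = {a..b}" by (simp add: c_interval_def a_def b_def)
      have x: "0 < ?x" using elim(1) by simp
      have a: "0 < a" using elim(1) by (simp add: a_def)
      have cn: "a \<le> ?c" "2 * ?c \<le> b" "0 < ?c" using elim(5) by (auto simp: I)
      have varn: "vari (k * c) \<le> B * k powr \<beta> * vari c"
        if "a \<le> c" "c \<le> b" "0 < k" "k < 1" "a \<le> k * c" for c k
      proof -
        have "k * c \<le> 1 * c" using that a by (intro mult_right_mono) auto
        then show ?thesis using elim(3) that by (auto simp: I)
      qed
      have "a \<in> c_interval m (N n)" using cn by (auto simp: I)
      \<comment> \<open>At the left end point \<open>N * a\<close> equals \<open>ln N\<close>, so
        the variance there is at least \<open>\<theta> * ln (ln N)\<close> and tends to
        infinity.\<close>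
      then have "\<theta> * ln (?x * a) \<le> vari a" using elim(4) by blast
      then have va: "\<theta> * ln (ln ?x) \<le> vari a" using x by (simp add: a_def)
      have lnln: "0 < \<theta> * ln (ln ?x)" using \<theta> elim(2) by simp
      obtain bad where bad: "bad \<in> events"
        "prob bad \<le> 3000 * B / (1 - (4/5) powr \<beta>) / vari a"
        "\<And>\<omega> c. \<omega> \<in> space (P n) - bad \<Longrightarrow> c \<in> {a..b} \<Longrightarrow>
          \<bar>remainder1 \<omega> c\<bar> + \<bar>remainder2 \<omega> c\<bar> \<le> risk c / 2"
        using uniform_remainder_bound[where b=b, OF a B \<beta> varn less_le_trans[OF lnln va]] by blast
      have "prob bad \<le> 3000 * B / (1 - \<rho>) / vari a" using bad(2) by (simp add: \<rho>_def)
      also have "\<dots> \<le> \<eta> n"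
        unfolding \<eta>_def using B \<rho> va lnln by (intro divide_left_mono) auto
      finally have bad_le: "prob bad \<le> \<eta> n" .
      have near_one: "\<bar>X n \<omega> - 1\<bar> \<le> \<delta> n" if \<omega>: "\<omega> \<in> space (P n)" "\<omega> \<notin> bad" for \<omega>
      proof -
        let ?h = "risk ?c + 2 * l / ?c"
        have subn: "c \<in> A n" if "a \<le> c" "c \<le> b" "risk c + 2 * l / c \<le> M * ?h" for c
          using elim(6) that by (auto simp: I)
        have rem: "\<bar>remainder1 \<omega> c\<bar> + \<bar>remainder2 \<omega> c\<bar> \<le> risk c / 2" if "a \<le> c" "c \<le> b" for c
          using bad(3)[of \<omega> c] \<omega> that by auto
        have lower: "1 - (2 * b / a) powr (1 + \<kappa>) * exp (- (M / 4 - 3) * ?h) \<le> X n \<omega>" "X n \<omega> \<le> 1"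
          unfolding X_def
          by (rule posterior_lower_bound[where M=M, OF _ I a \<kappa> constants(2) cn(1,2)];
              use \<omega> rem subn A in blast)+
        have "b / a \<le> ?x powr m"
        proof -
          have "1 / ?x \<le> a" unfolding a_def using x elim(2) by (intro divide_right_mono) auto
          moreover have "0 \<le> b" by (simp add: b_def)
          moreover have "0 < a * (1 / ?x)" using a x by (intro mult_pos_pos) auto
          ultimately have "b / a \<le> b / (1 / ?x)" by (rule divide_left_mono)
          also have "\<dots> = ?x powr (m - 1) * ?x powr 1" using x by (simp add: b_def)
          also have "\<dots> = ?x powr m" unfolding powr_add[symmetric] by simp
          finally show ?thesis .
        qed
        then have "(2 * b / a) powr (1 + \<kappa>) \<le> (2 * ?x powr m) powr (1 + \<kappa>)"
          using \<kappa> a x by (intro powr_mono2) (auto simp: b_def)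
        also have "\<dots> = 2 powr (1 + \<kappa>) * ?x powr p"
          using x by (simp add: powr_mult powr_powr p_def)
        finally have 1: "(2 * b / a) powr (1 + \<kappa>) \<le> 2 powr (1 + \<kappa>) * ?x powr p" .
        have "(p + 1) * ln ?x = t * (\<theta> / 2 * ln ?x)" using \<theta> by (simp add: t_def)
        also have "\<dots> \<le> t * ?h"
          using elim(7) p \<theta> by (intro mult_left_mono) (auto simp: t_def)
        finally have "- t * ?h \<le> - (p + 1) * ln ?x" by (simp only: mult_minus_left neg_le_iff_le)
        then have "exp (- (M / 4 - 3) * ?h) \<le> exp (- (p + 1) * ln ?x)"
          unfolding M_eq by (rule exp_le_cancel_iff[THEN iffD2])
        also have "\<dots> = ?x powr (- (p + 1))" using x by (simp add: powr_def)
        finally have 2: "exp (- (M / 4 - 3) * ?h) \<le> ?x powr (- (p + 1))" .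
        have "(2 * b / a) powr (1 + \<kappa>) * exp (- (M / 4 - 3) * ?h)
            \<le> 2 powr (1 + \<kappa>) * ?x powr p * ?x powr (- (p + 1))"
          by (intro mult_mono 1 2) auto
        also have "\<dots> = 2 powr (1 + \<kappa>) * ?x powr (- 1)"
          by (simp only: mult.assoc powr_add[symmetric]) simp
        also have "\<dots> = \<delta> n" using x by (simp add: \<delta>_def powr_minus_divide)
        finally show ?thesis
          using lower by linarith
      qed
      show ?case
      proof (intro allI impI)
        fix r assume r: "\<delta> n < r"
        have "{\<omega> \<in> space (P n). r < \<bar>X n \<omega> - 1\<bar>} \<subseteq> bad"
          using near_one r by force
        then have "prob {\<omega> \<in> space (P n). r < \<bar>X n \<omega> - 1\<bar>} \<le> prob bad"
          by (intro finite_measure_mono bad(1))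
        then show "prob {\<omega> \<in> space (P n). r < \<bar>X n \<omega> - 1\<bar>} \<le> \<eta> n" using bad_le by simp
      qed
    qed
    show "tendsto_in_prob P (\<lambda>n \<omega>. measure (posterior \<kappa> l m (N n) (U n) (fv n + vec1 (N n) (\<lambda>i. eps n i \<omega>))) (A n)) 1"
      unfolding X_def[symmetric] tendsto_in_prob_def
    proof (intro conjI allI impI)
      show "\<forall>\<^sub>F n in sequentially. X n \<in> borel_measurable (P n)" using X by simp
      fix r :: real assume r: "0 < r"
      have "\<forall>\<^sub>F n in sequentially. \<delta> n < r" using order_tendstoD(2)[OF \<delta>_lim r] .
      with bound have "\<forall>\<^sub>F n in sequentially. measure (P n) {\<omega> \<in> space (P n). r < \<bar>X n \<omega> - 1\<bar>} \<le> \<eta> n"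
        by eventually_elim auto
      then show "(\<lambda>n. measure (P n) {\<omega> \<in> space (P n). r < \<bar>X n \<omega> - 1\<bar>}) \<longlonglongrightarrow> 0"
        by (intro tendsto_sandwich[OF _ _ tendsto_const \<eta>_lim]) auto
    qed
  qed
qed

end

section \<open>Deduction of the theorem from posterior concentration\<close>

lemma good_variance_imp_variance_upper:
  assumes "good_variance m N lam" and nonneg: "\<And>n c. 0 \<le> c \<Longrightarrow> 0 \<le> D2 (N n) (lam n) c"
    and N: "filterlim N at_top sequentially"
  shows "variance_upper m N lam"
proof -
  obtain b B B' where b: "0 < b" "0 < B'" and *: "\<forall>\<^sub>F n in sequentially.
        \<forall>c\<in>c_interval m (N n). \<forall>k\<in>{0<..<1}. k * c \<in> c_interval m (N n) \<longrightarrow>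
          B * k powr b * D2 (N n) (lam n) c \<le> D2 (N n) (lam n) (k * c) \<and>
          D2 (N n) (lam n) (k * c) \<le> B' * k powr b * D2 (N n) (lam n) c"
    using assms(1) by (auto simp: good_variance_def)
  have N2: "\<forall>\<^sub>F n in sequentially. 2 \<le> N n"
    using N by (auto simp: filterlim_at_top)
  have "\<forall>\<^sub>F n in sequentially. \<forall>c\<in>c_interval m (N n). \<forall>k\<in>{0<..<1}. k * c \<in> c_interval m (N n) \<longrightarrow>
          D2 (N n) (lam n) (k * c) \<le> max 1 B' * k powr b * D2 (N n) (lam n) c"
    using * N2
  proof eventually_elim
    case (elim n)
    show ?case
    proof (intro ballI impI)
      fix c k :: real assume c: "c \<in> c_interval m (N n)" "k \<in> {0<..<1}" "k * c \<in> c_interval m (N n)"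
      have "D2 (N n) (lam n) (k * c) \<le> B' * k powr b * D2 (N n) (lam n) c" using elim(1) c by blast
      also have "\<dots> \<le> max 1 B' * k powr b * D2 (N n) (lam n) c"
        using nonneg[of c n] c_interval_lower(2)[OF c(1) elim(2)] by (intro mult_right_mono) auto
      finally show "D2 (N n) (lam n) (k * c) \<le> max 1 B' * k powr b * D2 (N n) (lam n) c" .
    qed
  qed
  then show ?thesis unfolding variance_upper_def using b by (intro exI[of _ b] conjI exI[of _ "max 1 B'"]) auto
qed

lemma D_measurable [measurable]:
  "D1 n e lam v \<in> borel_measurable borel" "D2 n lam \<in> borel_measurable borel"
  "D n e lam v \<in> borel_measurable borel"
  unfolding D_def[abs_def] D1_def[abs_def] D2_def[abs_def] by measurable

theorem theorem25:
  fixes N :: "nat \<Rightarrow> nat"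
    and x :: "nat \<Rightarrow> nat \<Rightarrow> 'x"
    and f :: "'x \<Rightarrow> real"
    and S :: "'s measure" and W :: "'x \<Rightarrow> 's \<Rightarrow> real"
    and P :: "nat \<Rightarrow> 'w measure" and eps :: "nat \<Rightarrow> nat \<Rightarrow> 'w \<Rightarrow> real"
    and U :: "nat \<Rightarrow> real Matrix.mat"
    and e :: "nat \<Rightarrow> nat \<Rightarrow> real Matrix.vec" and lam :: "nat \<Rightarrow> nat \<Rightarrow> real"
    and fv :: "nat \<Rightarrow> real Matrix.vec" and epsv Y :: "nat \<Rightarrow> 'w \<Rightarrow> real Matrix.vec"
    and m \<kappa> l :: real and cmin :: "nat \<Rightarrow> real"
  defines "U \<equiv> \<lambda>n. covariance_mat S W (N n) (x n)"
    and "fv \<equiv> \<lambda>n. vec1 (N n) (\<lambda>i. f (x n i))"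
    and "epsv \<equiv> \<lambda>n \<omega>. vec1 (N n) (\<lambda>i. eps n i \<omega>)"
    and "Y \<equiv> \<lambda>n \<omega>. fv n + epsv n \<omega>"
  assumes sample_size: "N = (\<lambda>n. n) \<or> N = (\<lambda>n. n\<^sup>2)"
    and gaussian_process: "centered_gaussian_process S W"
    and eigenbasis: "\<And>n. orthonormal_eigenbasis (N n) (U n) (e n) (lam n)"
    and noise: "\<And>n. standard_gaussian_noise (P n) (N n) (eps n)"
    and constants: "1 \<le> m" "0 < \<kappa>" "0 < l"
    and minimizer: "\<forall>\<^sub>F n in sequentially.
        0 < cmin n \<and>
        (\<forall>c>0. D (N n) (e n) (lam n) (fv n) (cmin n) + 2 * l / cmin n
                 \<le> D (N n) (e n) (lam n) (fv n) c + 2 * l / c) \<and>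
        cmin n \<in> c_interval m (N n) \<and> 2 * cmin n \<in> c_interval m (N n)"
  shows
    "(tendsto_in_prob P
        (\<lambda>n \<omega>. SUP c\<in>c_interval m (N n).
           (\<bar>R1 (N n) (e n) (lam n) (fv n) (epsv n \<omega>) c\<bar>
              + \<bar>R2 (N n) (e n) (lam n) (epsv n \<omega>) c\<bar>)
           / D (N n) (e n) (lam n) (fv n) c) 0
      \<and> good_variance m N lam
      \<and> (\<forall>\<^sub>F n in sequentially. \<forall>c\<in>c_interval m (N n).
            ln (real (N n) * c) \<le> D2 (N n) (lam n) c))
     \<or> (N = (\<lambda>n. n) \<and> polynomial_eigenvalues m lam)
     \<or> (N = (\<lambda>n. n\<^sup>2) \<and> (product_eigenvalues m lam \<or> sobolev_eigenvalues m lam))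
     \<longrightarrow>
     (\<exists>M0. \<forall>M\<ge>M0. tendsto_in_prob P
        (\<lambda>n \<omega>. measure (posterior \<kappa> l m (N n) (U n) (Y n \<omega>))
           {c. 0 < c \<and> D (N n) (e n) (lam n) (fv n) c + 1 / c
                 \<le> M * (INF c'\<in>{0<..}. D (N n) (e n) (lam n) (fv n) c' + 1 / c')}) 1)
     \<and> (good_bias m N e lam fv \<longrightarrow>
         (\<exists>C. tendsto_in_prob P
            (\<lambda>n \<omega>. measure (posterior \<kappa> l m (N n) (U n) (Y n \<omega>))
               {c. 0 < c \<and> D1 (N n) (e n) (lam n) (fv n) c + 1 / c
                     \<le> C * D2 (N n) (lam n) c}) 1)
         \<and> (\<exists>k K. 0 < k \<and> k < K \<and> tendsto_in_prob P
            (\<lambda>n \<omega>. measure (posterior \<kappa> l m (N n) (U n) (Y n \<omega>))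
               {k * cmin n .. K * cmin n}) 1))"
proof -
  have N_top: "filterlim N at_top sequentially"
    using sample_size filterlim_square_nat by (auto simp: filterlim_ident)
  have model: "gaussian_model (N n) (U n) (e n) (lam n) (P n) (eps n) (fv n)" for n
  proof -
    have "eigenbasis (N n) (U n) (e n) (lam n)"
      using eigenbasis[of n] by unfold_locales (auto simp: U_def covariance_mat_def)
    moreover have "prob_space (P n)"
      using noise[of n] by (simp add: standard_gaussian_noise_def)
    moreover have "fv n \<in> carrier_vec (N n)" by (simp add: fv_def vec1_def)
    moreover have "0 \<le> lam n j" if "j \<in> {1..N n}" for j
      using covariance_eigenvalue_nonneg[OF gaussian_process _ that] eigenbasis[of n] unfolding U_def by blast
    ultimately show ?thesis
      using noise[of n] by (simp add: gaussian_model_def gaussian_model_axioms_def)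
  qed
  have Y_eq: "Y n \<omega> = fv n + vec1 (N n) (\<lambda>i. eps n i \<omega>)" for n \<omega>
    by (simp add: Y_def epsv_def)
  let ?D = "\<lambda>n. D (N n) (e n) (lam n) (fv n)" and ?D1 = "\<lambda>n. D1 (N n) (e n) (lam n) (fv n)"
  let ?D2 = "\<lambda>n. D2 (N n) (lam n)" and ?I = "\<lambda>n. c_interval m (N n)"
  let ?post = "\<lambda>n \<omega>. posterior \<kappa> l m (N n) (U n) (Y n \<omega>)"
  have D1_nonneg: "0 \<le> ?D1 n c" and D2_nonneg: "0 \<le> ?D2 n c" if "0 \<le> c" for n c
    using gaussian_model.bias_nonneg[OF model that] gaussian_model.vari_nonneg[OF model that] by auto
  have N2: "\<forall>\<^sub>F n in sequentially. 2 \<le> N n"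
    using N_top by (auto simp: filterlim_at_top)
  show ?thesis (is "?cases \<longrightarrow> ?conclusion")
  proof (rule impI)
    assume cases: ?cases
    \<comment> \<open>From here on the general assumptions and the three eigenvalue conditions are
      treated alike.\<close>
    have regular: "variance_upper m N lam \<and> variance_log_lower m N lam"
      using cases
    proof (elim disjE conjE)
      assume gv: "good_variance m N lam"
        and log: "\<forall>\<^sub>F n in sequentially. \<forall>c\<in>?I n. ln (real (N n) * c) \<le> ?D2 n c"
      have "variance_log_lower m N lam"
        unfolding variance_log_lower_def using log by (intro exI[of _ 1]) simp
      then show ?thesis using good_variance_imp_variance_upper[OF gv D2_nonneg N_top] by simp
    next
      assume "N = (\<lambda>n. n)" "polynomial_eigenvalues m lam"
      then show ?thesis using polynomial_eigenvalues_regular[OF _ constants(1)] by blast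
    next
      assume "N = (\<lambda>n. n\<^sup>2)" "product_eigenvalues m lam"
      then show ?thesis using product_eigenvalues_regular[OF _ constants(1)] by blast
    next
      assume "N = (\<lambda>n. n\<^sup>2)" "sobolev_eigenvalues m lam"
      then show ?thesis using sobolev_eigenvalues_regular[OF _ constants(1)] by blast
    qed
    have seq: "gaussian_model_sequence N U e lam P eps fv m l cmin"
      by (rule gaussian_model_sequence.intro[OF model N_top conjunct1[OF regular] constants(1,3) minimizer])
    obtain M1 where M1: "0 < M1" and conc_all: "\<forall>A. (\<forall>n. A n \<in> sets borel) \<longrightarrow> (\<forall>\<^sub>F n in sequentially. \<forall>c\<in>?I n.
        ?D n c + 2 * l / c \<le> M1 * (?D n (cmin n) + 2 * l / cmin n) \<longrightarrow> c \<in> A n) \<longrightarrow>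
        tendsto_in_prob P (\<lambda>n \<omega>. measure (?post n \<omega>) (A n)) 1"
      using gaussian_model_sequence.posterior_concentration[OF seq constants(2) conjunct2[OF regular]]
      unfolding Y_eq by (elim exE conjE)
    have conc: "tendsto_in_prob P (\<lambda>n \<omega>. measure (?post n \<omega>) (A n)) 1"
      if "\<And>n. A n \<in> sets borel" and "\<forall>\<^sub>F n in sequentially. \<forall>c\<in>?I n.
        ?D n c + 2 * l / c \<le> M1 * (?D n (cmin n) + 2 * l / cmin n) \<longrightarrow> c \<in> A n" for A
      by (rule conc_all[rule_format]) (rule that)+
    \<comment> \<open>The assertions use the penalty \<open>1 / c\<close>, the minimizer is defined
      with \<open>2 * l / c\<close>; \<open>u\<close> and \<open>v\<close> are the costs of passing
      from one to the other.\<close>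
    define u where "u = max 1 (1 / (2 * l))"
    define v where "v = max 1 (2 * l)"
    have uv: "1 \<le> u" "1 \<le> v" "0 < u" "0 < v" by (auto simp: u_def v_def)
    have u_le: "g + 1 / c \<le> u * (g + 2 * l / c)" if "0 \<le> g" "0 < c" for g c :: real
    proof -
      have "1 / (2 * l) * (2 * l / c) \<le> u * (2 * l / c)"
        using constants(3) that by (intro mult_right_mono) (auto simp: u_def)
      moreover have "1 * g \<le> u * g" using that uv by (intro mult_right_mono) auto
      ultimately show ?thesis using constants(3) by (simp add: distrib_left)
    qed
    have v_le: "g + 2 * l / c \<le> v * (g + 1 / c)" if "0 \<le> g" "0 < c" for g c :: real
    proof -
      have "2 * l * (1 / c) \<le> v * (1 / c)"
        using that by (intro mult_right_mono) (auto simp: v_def)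
      moreover have "1 * g \<le> v * g" using that uv by (intro mult_right_mono) auto
      ultimately show ?thesis by (simp add: distrib_left)
    qed
    have D_nonneg: "0 \<le> ?D n c" if "0 < c" for n c
      using D1_nonneg[of c n] D2_nonneg[of c n] that by (simp add: D_def)
    have borel_meas: "?D n \<in> borel_measurable borel" "?D1 n \<in> borel_measurable borel"
      "?D2 n \<in> borel_measurable borel" for n by measurable
    have part1: "tendsto_in_prob P (\<lambda>n \<omega>. measure (?post n \<omega>)
        {c. 0 < c \<and> ?D n c + 1 / c \<le> M * (INF c'\<in>{0<..}. ?D n c' + 1 / c')}) 1"
      if M: "u * M1 * v \<le> M" for M
    proof (rule conc)
      fix n
      note [measurable] = borel_meas[of n]
      show "{c. 0 < c \<and> ?D n c + 1 / c \<le> M * (INF c'\<in>{0<..}. ?D n c' + 1 / c')} \<in> sets borel"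
        by measurable
    next
      show "\<forall>\<^sub>F n in sequentially. \<forall>c\<in>?I n.
        ?D n c + 2 * l / c \<le> M1 * (?D n (cmin n) + 2 * l / cmin n) \<longrightarrow>
        c \<in> {c. 0 < c \<and> ?D n c + 1 / c \<le> M * (INF c'\<in>{0<..}. ?D n c' + 1 / c')}"
        using N2 minimizer
      proof eventually_elim
        case (elim n)
        let ?h = "?D n (cmin n) + 2 * l / cmin n" and ?inf = "INF c'\<in>{0<..}. ?D n c' + 1 / c'"
        \<comment> \<open>The minimum for the penalty \<open>2 * l / c\<close> is at most
          \<open>v\<close> times every value for the penalty \<open>1 / c\<close>, hence at most
          \<open>v\<close> times their infimum. With the factor \<open>u\<close> on the other side
          this yields the threshold \<open>u * M1 * v\<close>.\<close>
        have "?h / v \<le> ?inf"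
        proof (rule cINF_greatest)
          fix c :: real assume c: "c \<in> {0<..}"
          have "?h \<le> ?D n c + 2 * l / c" using elim(2) c by simp
          also have "\<dots> \<le> v * (?D n c + 1 / c)" using c by (intro v_le D_nonneg) auto
          finally show "?h / v \<le> ?D n c + 1 / c" using uv by (simp add: divide_le_eq mult.commute)
        qed simp
        then have h: "?h \<le> v * ?inf" using uv by (simp add: divide_le_eq mult.commute)
        have inf: "0 \<le> ?inf" by (rule cINF_greatest) (auto intro!: add_nonneg_nonneg D_nonneg)
        show ?case
        proof (intro ballI impI CollectI conjI)
          fix c assume c: "c \<in> ?I n" and near: "?D n c + 2 * l / c \<le> M1 * ?h"
          show c0: "0 < c" using c_interval_lower(2)[OF c elim(1)] .
          have "?D n c + 1 / c \<le> u * (?D n c + 2 * l / c)" using c0 by (intro u_le D_nonneg)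
          also have "\<dots> \<le> u * (M1 * (v * ?inf))"
            using near uv M1 h by (intro mult_left_mono order_trans[OF near]) auto
          also have "\<dots> = u * M1 * v * ?inf" by simp
          also have "\<dots> \<le> M * ?inf" using M inf by (rule mult_right_mono)
          finally show "?D n c + 1 / c \<le> M * ?inf" .
        qed
      qed
    qed
    have part2: "(\<exists>C. tendsto_in_prob P (\<lambda>n \<omega>. measure (?post n \<omega>)
          {c. 0 < c \<and> ?D1 n c + 1 / c \<le> C * ?D2 n c}) 1)
        \<and> (\<exists>k K. 0 < k \<and> k < K \<and> tendsto_in_prob P (\<lambda>n \<omega>. measure (?post n \<omega>) {k * cmin n .. K * cmin n}) 1)"
      if gb: "good_bias m N e lam fv"
    proof -
      obtain k K C where k: "0 < k" "k < K" and loc: "\<forall>\<^sub>F n in sequentially. \<forall>c\<in>?I n.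
          ?D n c + 2 * l / c \<le> M1 * (?D n (cmin n) + 2 * l / cmin n) \<longrightarrow>
          k * cmin n \<le> c \<and> c \<le> K * cmin n \<and> ?D1 n c + 2 * l / c \<le> C * ?D2 n c"
        using gaussian_model_sequence.near_minimizer_location_eventually[OF seq gb M1] by blast
      have "tendsto_in_prob P (\<lambda>n \<omega>. measure (?post n \<omega>) {c. 0 < c \<and> ?D1 n c + 1 / c \<le> u * C * ?D2 n c}) 1"
      proof (rule conc)
        fix n
        note [measurable] = borel_meas[of n]
        show "{c. 0 < c \<and> ?D1 n c + 1 / c \<le> u * C * ?D2 n c} \<in> sets borel" by measurable
      next
        show "\<forall>\<^sub>F n in sequentially. \<forall>c\<in>?I n.
          ?D n c + 2 * l / c \<le> M1 * (?D n (cmin n) + 2 * l / cmin n) \<longrightarrow>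
          c \<in> {c. 0 < c \<and> ?D1 n c + 1 / c \<le> u * C * ?D2 n c}"
          using N2 loc
        proof eventually_elim
          case (elim n)
          show ?case
          proof (intro ballI impI CollectI conjI)
            fix c assume c: "c \<in> ?I n"
              and near: "?D n c + 2 * l / c \<le> M1 * (?D n (cmin n) + 2 * l / cmin n)"
            show c0: "0 < c" using c_interval_lower(2)[OF c elim(1)] .
            have "?D1 n c + 1 / c \<le> u * (?D1 n c + 2 * l / c)" using c0 by (intro u_le D1_nonneg) auto
            also have "\<dots> \<le> u * (C * ?D2 n c)"
              using elim(2) c near uv by (intro mult_left_mono) auto
            finally show "?D1 n c + 1 / c \<le> u * C * ?D2 n c" by (simp add: mult.assoc)
          qed
        qed
      qed
      moreover have "tendsto_in_prob P (\<lambda>n \<omega>. measure (?post n \<omega>) {k * cmin n .. K * cmin n}) 1"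
      proof (rule conc)
        show "\<forall>\<^sub>F n in sequentially. \<forall>c\<in>?I n.
          ?D n c + 2 * l / c \<le> M1 * (?D n (cmin n) + 2 * l / cmin n) \<longrightarrow> c \<in> {k * cmin n .. K * cmin n}"
          using loc by eventually_elim auto
      qed simp
      ultimately show ?thesis using k by blast
    qed
    show ?conclusion
      using part1 part2 by blast
  qed
qed

end
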